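(* Let $k$ be an algebraically closed field of characteristic $p>0$, let $q=p^e$ with $e>0$, and let $X\subset\mathbb P^n_k$ be a smooth extremal hypersurface of degree $q+1$ and dimension $d$. Then the Gauss map of $X$ is purely inseparable of degree $q^d$. Moreover, the dual hypersurface of $X$ (that is, the image of $X$ under the Gauss map) is also a smooth extremal hypersurface of the same degree $q+1$.
   Context: A Frobenius form of degree $q+1$ is a homogeneous polynomial of degree $q+1$ in $k[x_0,\dots,x_n]$ lying in the ideal $\langle x_0^q,\dots,x_n^q\rangle$, where $q=p^e$ with $e>0$. An extremal hypersurface is a projective hypersurface defined by a (not necessarily reduced) Frobenius form. For a hypersurface $X=\mathbb V(f)\subset\mathbb P^n$ defined by a reduced form $f$, the Gauss map is the rational map $X\dashrightarrow(\mathbb P^n)^*$ sending a smooth point $x$ to its embedded projective tangent space, given explicitly by $x\mapsto\left[\frac{\partial f}{\partial x_0}:\frac{\partial f}{\partial x_1}:\cdots:\frac{\partial f}{\partial x_n}\right]$; it is a morphism when $X$ is smooth. The Gauss map is called purely inseparable if the induced map on generic stalks (from the function field of the image to the function field of $X$) is a purely inseparable field extension; its degree is the degree of this extension. *)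

theory Defs
  imports
    "HOL-Library.Poly_Mapping"
    "HOL-Computational_Algebra.Polynomial"
    "HOL-Analysis.Finite_Cartesian_Product"
    "HOL-Algebra.Embedded_Algebras"
begin

section \<open>Forms in several variables\<close>

text \<open>
  The homogeneous coordinates of the projective space are indexed by a finite type \<open>'n\<close>, so that
  \<open>P^n\<close> corresponds to \<open>CARD('n) = n + 1\<close>. A polynomial is a finitely supported map from exponent
  vectors to coefficients; multiplication is the convolution product of \<^theory>\<open>HOL-Library.Poly_Mapping\<close>.
\<close>

type_synonym ('n, 'k) mpoly = "('n \<Rightarrow>\<^sub>0 nat) \<Rightarrow>\<^sub>0 'k"

definition Const :: "'k::comm_ring_1 \<Rightarrow> ('n, 'k) mpoly"
  where "Const c = Poly_Mapping.single 0 c"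

definition Var :: "'n \<Rightarrow> ('n, 'k::comm_ring_1) mpoly"
  where "Var i = Poly_Mapping.single (Poly_Mapping.single i 1) 1"

definition eval_hom :: "('k::zero \<Rightarrow> 'r::comm_ring_1) \<Rightarrow> ('n::finite \<Rightarrow> 'r) \<Rightarrow> ('n, 'k) mpoly \<Rightarrow> 'r"
  where "eval_hom c x f = (\<Sum>t\<in>Poly_Mapping.keys f.
    c (Poly_Mapping.lookup f t) * (\<Prod>i\<in>UNIV. x i ^ Poly_Mapping.lookup t i))"

definition eval :: "('n::finite, 'k::comm_ring_1) mpoly \<Rightarrow> 'k ^ 'n \<Rightarrow> 'k"
  where "eval f v = eval_hom (\<lambda>c. c) (\<lambda>i. v $ i) f"

definition subst :: "('n::finite, 'k::comm_ring_1) mpoly \<Rightarrow> ('n \<Rightarrow> ('n, 'k) mpoly) \<Rightarrow> ('n, 'k) mpoly"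
  where "subst f F = eval_hom Const F f"

text \<open>The truncated subtraction is harmless: if \<open>x\<^sub>i\<close> does not occur in the monomial \<open>t\<close>, the
  coefficient vanishes.\<close>

definition partial :: "'n \<Rightarrow> ('n, 'k::comm_ring_1) mpoly \<Rightarrow> ('n, 'k) mpoly"
  where "partial i f = (\<Sum>t\<in>Poly_Mapping.keys f.
    Poly_Mapping.single (t - Poly_Mapping.single i 1)
      (of_nat (Poly_Mapping.lookup t i) * Poly_Mapping.lookup f t))"

definition homogeneous :: "nat \<Rightarrow> ('n::finite, 'k::zero) mpoly \<Rightarrow> bool"
  where "homogeneous m f \<longleftrightarrow>
    (\<forall>t\<in>Poly_Mapping.keys f. (\<Sum>i\<in>UNIV. Poly_Mapping.lookup t i) = m)"

definition generated_ideal :: "'r::comm_ring_1 set \<Rightarrow> 'r set"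
  where "generated_ideal S = Modules.module.span (*) S"

definition frobenius_form :: "nat \<Rightarrow> ('n::finite, 'k::comm_ring_1) mpoly \<Rightarrow> bool"
  where "frobenius_form q f \<longleftrightarrow>
    f \<noteq> 0 \<and> homogeneous (q + 1) f \<and> f \<in> generated_ideal {Var i ^ q |i. True}"


section \<open>Projective space and its closed subsets\<close>

text \<open>The point with homogeneous coordinates \<open>v\<close> is the set of all its coordinate vectors. The
  dual projective space is identified with projective space by the dual coordinates.\<close>

definition point :: "'k::field ^ 'n \<Rightarrow> ('k ^ 'n) set"
  where "point v = {c *s v |c. c \<noteq> 0}"

definition proj_space :: "('k::field ^ 'n) set set"
  where "proj_space = point ` {v. v \<noteq> 0}"

definition vanishes_at :: "('n::finite, 'k::field) mpoly \<Rightarrow> ('k ^ 'n) set \<Rightarrow> bool"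
  where "vanishes_at g P \<longleftrightarrow> (\<forall>v\<in>P. eval g v = 0)"

definition zeros :: "('n::finite, 'k::field) mpoly set \<Rightarrow> ('k ^ 'n) set set"
  where "zeros S = {P \<in> proj_space. \<forall>g\<in>S. vanishes_at g P}"

definition zariski_closed :: "('k::field ^ 'n::finite) set set \<Rightarrow> bool"
  where "zariski_closed Z \<longleftrightarrow>
    (\<exists>S :: ('n, 'k) mpoly set. (\<forall>g\<in>S. \<exists>m. homogeneous m g) \<and> Z = zeros S)"

definition irreducible_closed :: "('k::field ^ 'n::finite) set set \<Rightarrow> bool"
  where "irreducible_closed Y \<longleftrightarrow> zariski_closed Y \<and> Y \<noteq> {} \<and>
    (\<forall>Z Z'. zariski_closed Z \<longrightarrow> zariski_closed Z' \<longrightarrow> Y = Z \<union> Z' \<longrightarrow> Y = Z \<or> Y = Z')"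

definition irreducible_components :: "('k::field ^ 'n::finite) set set \<Rightarrow> ('k ^ 'n) set set set"
  where "irreducible_components X =
    {Y. irreducible_closed Y \<and> Y \<subseteq> X \<and> (\<forall>Y'. irreducible_closed Y' \<longrightarrow> Y' \<subseteq> X \<longrightarrow> Y \<subseteq> Y' \<longrightarrow> Y' = Y)}"


section \<open>Function fields\<close>

text \<open>Fractions \<open>g/h\<close> of forms of equal degree whose denominator does not vanish identically on
  \<open>Y\<close>, modulo equality of cross products on \<open>Y\<close>. For irreducible \<open>Y\<close> this is the degree-zero part
  of the homogeneous localisation of the coordinate ring of \<open>Y\<close> at the zero ideal. Only the
  vanishing of forms on \<open>Y\<close> enters, so \<open>Y\<close> may be replaced by any dense subset.\<close>

definition fractions :: "('k::field ^ 'n::finite) set set \<Rightarrow> (('n, 'k) mpoly \<times> ('n, 'k) mpoly) set"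
  where "fractions Y = {(g, h). (\<exists>m. homogeneous m g \<and> homogeneous m h) \<and> \<not> (\<forall>P\<in>Y. vanishes_at h P)}"

definition fraction_rel :: "('k::field ^ 'n::finite) set set \<Rightarrow>
    ((('n, 'k) mpoly \<times> ('n, 'k) mpoly) \<times> (('n, 'k) mpoly \<times> ('n, 'k) mpoly)) set"
  where "fraction_rel Y = {((g, h), (g', h')). (g, h) \<in> fractions Y \<and> (g', h') \<in> fractions Y \<and>
    (\<forall>P\<in>Y. vanishes_at (g * h' - g' * h) P)}"

definition function_field :: "('k::field ^ 'n::finite) set set \<Rightarrow> (('n, 'k) mpoly \<times> ('n, 'k) mpoly) set ring"
  where "function_field Y = \<lparr>
    carrier = fractions Y // fraction_rel Y,
    monoid.mult = (\<lambda>A B. \<Union>(g, h)\<in>A. \<Union>(g', h')\<in>B. fraction_rel Y `` {(g * g', h * h')}),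
    one = fraction_rel Y `` {(1, 1)},
    zero = fraction_rel Y `` {(0, 1)},
    add = (\<lambda>A B. \<Union>(g, h)\<in>A. \<Union>(g', h')\<in>B. fraction_rel Y `` {(g * h' + g' * h, h * h')})\<rparr>"


section \<open>Purely inseparable extensions\<close>

definition field_extension :: "'a set \<Rightarrow> ('a, 'b) ring_scheme \<Rightarrow> bool"
  where "field_extension K L \<longleftrightarrow> field L \<and> subfield K L"

definition purely_inseparable :: "nat \<Rightarrow> 'a set \<Rightarrow> ('a, 'b) ring_scheme \<Rightarrow> bool"
  where "purely_inseparable p K L \<longleftrightarrow> field_extension K L \<and>
    (\<forall>a\<in>carrier L. \<exists>m::nat. a [^]\<^bsub>L\<^esub> (p ^ m) \<in> K)"

definition extension_degree :: "nat \<Rightarrow> 'a set \<Rightarrow> ('a, 'b) ring_scheme \<Rightarrow> bool"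
  where "extension_degree N K L \<longleftrightarrow> field_extension K L \<and> ring.dimension L N K (carrier L)"


section \<open>Hypersurfaces and the Gauss map\<close>

text \<open>A hypersurface is represented by a form \<open>f\<close> defining it; \<open>hypersurface f\<close> is its set of
  points.\<close>

definition hypersurface :: "('n::finite, 'k::field) mpoly \<Rightarrow> ('k ^ 'n) set set"
  where "hypersurface f = zeros {f}"

definition smooth_points :: "('n::finite, 'k::field) mpoly \<Rightarrow> ('k ^ 'n) set set"
  where "smooth_points f = {P \<in> hypersurface f. \<exists>i. \<not> vanishes_at (partial i f) P}"

definition smooth :: "('n::finite, 'k::field) mpoly \<Rightarrow> bool"
  where "smooth f \<longleftrightarrow> smooth_points f = hypersurface f"

definition gauss_map :: "('n::finite, 'k::field) mpoly \<Rightarrow> ('k ^ 'n) set \<Rightarrow> ('k ^ 'n) set"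
  where "gauss_map f P = (\<Union>v\<in>P. point (\<chi> i. eval (partial i f) v))"

definition gauss_image :: "('n::finite, 'k::field) mpoly \<Rightarrow> ('k ^ 'n) set set \<Rightarrow> ('k ^ 'n) set set"
  where "gauss_image f Y = gauss_map f ` (Y \<inter> smooth_points f)"

definition dual_hypersurface :: "('n::finite, 'k::field) mpoly \<Rightarrow> ('k ^ 'n) set set"
  where "dual_hypersurface f = gauss_image f (hypersurface f)"

text \<open>On an irreducible component \<open>Y\<close> of the hypersurface, the Gauss map sends the rational
  function \<open>g/h\<close> on the image of \<open>Y\<close> to the rational function
  \<open>g(\<partial>f/\<partial>x\<^sub>0,\<dots>,\<partial>f/\<partial>x\<^sub>n) / h(\<partial>f/\<partial>x\<^sub>0,\<dots>,\<partial>f/\<partial>x\<^sub>n)\<close> on \<open>Y\<close>.\<close>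

definition gauss_pullback :: "('n::finite, 'k::field) mpoly \<Rightarrow> ('k ^ 'n) set set \<Rightarrow>
    (('n, 'k) mpoly \<times> ('n, 'k) mpoly) set \<Rightarrow> (('n, 'k) mpoly \<times> ('n, 'k) mpoly) set"
  where "gauss_pullback f Y A =
    (\<Union>(g, h)\<in>A. fraction_rel Y `` {(subst g (\<lambda>i. partial i f), subst h (\<lambda>i. partial i f))})"

definition gauss_subfield :: "('n::finite, 'k::field) mpoly \<Rightarrow> ('k ^ 'n) set set \<Rightarrow>
    (('n, 'k) mpoly \<times> ('n, 'k) mpoly) set set"
  where "gauss_subfield f Y = gauss_pullback f Y ` carrier (function_field (gauss_image f Y))"

text \<open>The generic stalks of the hypersurface of a reduced form are the function fields of its irreducible
  components. If the hypersurface is irreducible, it is its own only component; zero-dimensional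
  hypersurfaces have several.\<close>

definition gauss_map_purely_inseparable :: "('n::finite, 'k::field) mpoly \<Rightarrow> bool"
  where "gauss_map_purely_inseparable f \<longleftrightarrow>
    (\<forall>Y\<in>irreducible_components (hypersurface f).
      purely_inseparable CHAR('k) (gauss_subfield f Y) (function_field Y))"

definition gauss_map_degree :: "('n::finite, 'k::field) mpoly \<Rightarrow> nat \<Rightarrow> bool"
  where "gauss_map_degree f N \<longleftrightarrow>
    (\<forall>Y\<in>irreducible_components (hypersurface f).
      extension_degree N (gauss_subfield f Y) (function_field Y))"

end

theory Submission
  imports Defs "HOL-Analysis.Cartesian_Space"
begin

text \<open>
  Write \<open>f = \<Sum> A\<^sub>i\<^sub>j x\<^sub>i\<^sup>q x\<^sub>j\<close>. The gradient of \<open>f\<close> at \<open>v\<close> is a linear image of the coordinatewise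
  \<open>q\<close>-th power of \<open>v\<close>, so smoothness means that \<open>A\<close> is invertible, the Gauss map is bijective onto
  the hypersurface of the transposed inverse matrix, and the pullback of rational functions has
  image \<open>L\<^sup>q\<close>, where \<open>L\<close> is the function field of a component \<open>Y\<close>. It remains to see that
  \<open>[L : L\<^sup>q] = q\<^sup>d\<close>. Choose \<open>i0 \<noteq> j\<close> such that neither \<open>x\<^sub>i\<^sub>0\<close> nor \<open>\<partial>f/\<partial>x\<^sub>j\<close> vanishes on \<open>Y\<close>, and let \<open>y\<^sub>i = x\<^sub>i / x\<^sub>i\<^sub>0\<close>.
  The relation \<open>\<Sum> \<partial>f/\<partial>x\<^sub>l x\<^sub>l = 0\<close> is linear over \<open>L\<^sup>q\<close>, so the monomials in the \<open>d\<close> functions \<open>y\<^sub>i\<close>,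
  \<open>i \<notin> {i0, j}\<close>, with exponents below \<open>q\<close> span \<open>L\<close>. They are independent because a tangent line meets
  the hypersurface to order \<open>q\<close>: every polynomial vanishing on the hypersurface vanishes to order \<open>q\<close>
  along each tangent line, and along such a line \<open>q\<close>-th powers are constant to that order. To pass
  from the hypersurface to the component \<open>Y\<close>, one multiplies by a form that vanishes on the other
  components.
\<close>

section \<open>Ring homomorphisms and evaluation of polynomials\<close>

text \<open>All geometry is expressed through vanishing at points, and counting roots on lines is
  the bridge back to algebra. Where \<open>f\<close> has degree q + 1 on a line, vanishing of
  \<open>H\<close> at the zeros of \<open>f\<close> yields only that \<open>f\<close> divides
  \<open>H ^ (q + 1)\<close> there. This lost multiplicity is the main obstacle, since independence
  needs \<open>H\<close> itself to vanish to order q along a tangent line. It is overcome by bending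
  the tangent line into an approximate curve inside {f = 0} that agrees with the line modulo s^q;
  the approximation is precise enough that order q survives taking a (q + 1)-st root. The nonzero
  derivative required for it comes from the invertibility of \<open>A\<close>. The function field is
  treated one component at a time because X may be reducible: for d = 0 it consists of q + 1
  points.\<close>

definition is_hom :: "('a::comm_ring_1 \<Rightarrow> 'b::comm_ring_1) \<Rightarrow> bool"
  where "is_hom \<phi> \<longleftrightarrow> \<phi> 1 = 1 \<and> (\<forall>x y. \<phi> (x + y) = \<phi> x + \<phi> y) \<and> (\<forall>x y. \<phi> (x * y) = \<phi> x * \<phi> y)"

lemma is_homI:
  assumes "\<phi> 1 = 1" "\<And>x y. \<phi> (x + y) = \<phi> x + \<phi> y" "\<And>x y. \<phi> (x * y) = \<phi> x * \<phi> y"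
  shows "is_hom \<phi>"
  using assms by (auto simp: is_hom_def)

context
  fixes \<phi> :: "'a::comm_ring_1 \<Rightarrow> 'b::comm_ring_1"
  assumes hom: "is_hom \<phi>"
begin

lemma hom_one: "\<phi> 1 = 1"
  and hom_add: "\<phi> (x + y) = \<phi> x + \<phi> y"
  and hom_mult: "\<phi> (x * y) = \<phi> x * \<phi> y"
  using hom by (auto simp: is_hom_def)

lemma hom_zero: "\<phi> 0 = 0"
  using hom_add[of 0 0] by simp

lemma hom_uminus: "\<phi> (- x) = - \<phi> x"
  using hom_add[of x "- x"] hom_zero by (simp add: eq_neg_iff_add_eq_0 add.commute)

lemma hom_diff: "\<phi> (x - y) = \<phi> x - \<phi> y"
  using hom_add[of x "- y"] hom_uminus by simp

lemma hom_power: "\<phi> (x ^ n) = \<phi> x ^ n"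
  by (induction n) (auto simp: hom_one hom_mult)

lemma hom_sum: "\<phi> (sum F A) = (\<Sum>i\<in>A. \<phi> (F i))"
  by (induction A rule: infinite_finite_induct) (auto simp: hom_zero hom_add)

lemma hom_prod: "\<phi> (prod F A) = (\<Prod>i\<in>A. \<phi> (F i))"
  by (induction A rule: infinite_finite_induct) (auto simp: hom_one hom_mult)

end

lemma is_hom_comp: "is_hom \<phi> \<Longrightarrow> is_hom \<psi> \<Longrightarrow> is_hom (\<lambda>x. \<psi> (\<phi> x))"
  by (auto simp: is_hom_def)

lemma is_hom_id: "is_hom (\<lambda>x. x)"
  by (auto simp: is_hom_def)

lemma is_hom_const_poly: "is_hom (\<lambda>c. [:c:])"
  by (auto simp: is_hom_def one_pCons)

lemma is_hom_poly: "is_hom (\<lambda>p. poly p x)"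
  by (auto simp: is_hom_def)

lemma is_hom_map_poly:
  assumes "is_hom (\<phi> :: 'a::comm_ring_1 \<Rightarrow> 'b::comm_ring_1)"
  shows "is_hom (map_poly \<phi>)"
proof (rule is_homI)
  show "map_poly \<phi> 1 = 1" using hom_one[OF assms] by simp
  show "map_poly \<phi> (p + q) = map_poly \<phi> p + map_poly \<phi> q" for p q
    by (rule poly_eqI) (simp add: coeff_map_poly hom_zero[OF assms] hom_add[OF assms])
  show "map_poly \<phi> (p * q) = map_poly \<phi> p * map_poly \<phi> q" for p q
    by (rule poly_eqI) (simp add: coeff_map_poly hom_zero[OF assms] coeff_mult hom_sum[OF assms] hom_mult[OF assms])
qed

section \<open>Universal property of the polynomial ring\<close>

lemma eval_hom_superset:
  assumes "finite S" "Poly_Mapping.keys f \<subseteq> S" "c 0 = 0"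
  shows "eval_hom c x f =
    (\<Sum>t\<in>S. c (Poly_Mapping.lookup f t) * (\<Prod>i\<in>UNIV. x i ^ Poly_Mapping.lookup t i))"
  unfolding eval_hom_def
  by (rule sum.mono_neutral_left[OF assms(1,2)]) (auto simp: in_keys_iff assms(3))

lemma eval_hom_add:
  assumes "is_hom c"
  shows "eval_hom c x (f + g) = eval_hom c x f + eval_hom c x g"
proof -
  let ?S = "Poly_Mapping.keys f \<union> Poly_Mapping.keys g"
  note z = hom_zero[OF assms]
  have "eval_hom c x h = (\<Sum>t\<in>?S. c (Poly_Mapping.lookup h t) * (\<Prod>i\<in>UNIV. x i ^ Poly_Mapping.lookup t i))"
    if "h \<in> {f, g, f + g}" for h
    by (rule eval_hom_superset) (use that z keys_add[of f g] in auto)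
  then show ?thesis
    by (simp add: lookup_add hom_add[OF assms] distrib_right sum.distrib)
qed

lemma eval_hom_single:
  assumes "c 0 = 0"
  shows "eval_hom c x (Poly_Mapping.single t a) = c a * (\<Prod>i\<in>UNIV. x i ^ Poly_Mapping.lookup t i)"
  by (subst eval_hom_superset[of "{t}"]) (auto simp: assms)

lemma eval_hom_0: "eval_hom c x 0 = 0"
  by (simp add: eval_hom_def)

lemma eval_hom_sum:
  assumes "is_hom c"
  shows "eval_hom c x (sum F A) = (\<Sum>i\<in>A. eval_hom c x (F i))"
  by (induction A rule: infinite_finite_induct) (auto simp: eval_hom_0 eval_hom_add[OF assms])

lemma mpoly_sum_monomials:
  "f = (\<Sum>t\<in>Poly_Mapping.keys f. Poly_Mapping.single t (Poly_Mapping.lookup f t))"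
  by (rule poly_mapping_eqI)
    (auto simp: lookup_sum lookup_single when_def sum.delta in_keys_iff)

lemma is_hom_eval_hom:
  fixes c :: "'k::comm_ring_1 \<Rightarrow> 'r::comm_ring_1" and x :: "'n::finite \<Rightarrow> 'r"
  assumes "is_hom c"
  shows "is_hom (eval_hom c x)"
proof (rule is_homI)
  have z: "c 0 = 0" by (rule hom_zero[OF assms])
  show "eval_hom c x 1 = 1"
    using eval_hom_single[of c x 0 1] z hom_one[OF assms] by simp
  show "eval_hom c x (f + g) = eval_hom c x f + eval_hom c x g" for f g
    by (rule eval_hom_add[OF assms])
  show "eval_hom c x (f * g) = eval_hom c x f * eval_hom c x g" for f g
  proof -
    have "eval_hom c x (f * g) = eval_hom c x
      ((\<Sum>t\<in>Poly_Mapping.keys f. Poly_Mapping.single t (Poly_Mapping.lookup f t)) *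
       (\<Sum>t\<in>Poly_Mapping.keys g. Poly_Mapping.single t (Poly_Mapping.lookup g t)))"
      by (simp flip: mpoly_sum_monomials)
    also have "\<dots> = (\<Sum>s\<in>Poly_Mapping.keys f. \<Sum>t\<in>Poly_Mapping.keys g.
      eval_hom c x (Poly_Mapping.single s (Poly_Mapping.lookup f s)) *
      eval_hom c x (Poly_Mapping.single t (Poly_Mapping.lookup g t)))"
      by (simp add: sum_product mult_single eval_hom_sum[OF assms] eval_hom_single z
          hom_mult[OF assms] lookup_add power_add prod.distrib mult_ac)
    also have "\<dots> = (\<Sum>s\<in>Poly_Mapping.keys f. eval_hom c x (Poly_Mapping.single s (Poly_Mapping.lookup f s))) *
      (\<Sum>t\<in>Poly_Mapping.keys g. eval_hom c x (Poly_Mapping.single t (Poly_Mapping.lookup g t)))"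
      by (simp add: sum_product)
    also have "\<dots> = eval_hom c x f * eval_hom c x g"
      by (simp flip: mpoly_sum_monomials eval_hom_sum[OF assms])
    finally show ?thesis .
  qed
qed

lemma eval_hom_Const:
  assumes "is_hom c" shows "eval_hom c x (Const a) = c a"
  using eval_hom_single[of c x 0 a] hom_zero[OF assms] by (simp add: Const_def)

lemma eval_hom_Var:
  assumes "is_hom c" shows "eval_hom c x (Var i) = x i"
proof -
  have "(\<Prod>j\<in>UNIV. x j ^ Poly_Mapping.lookup (Poly_Mapping.single i 1) j) = (\<Prod>j\<in>UNIV. if i = j then x j else 1)"
    by (rule prod.cong) (auto simp: lookup_single when_def)
  then show ?thesis
    using eval_hom_single[of c x "Poly_Mapping.single i 1" 1] hom_zero[OF assms] hom_one[OF assms]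
    by (simp add: Var_def)
qed

lemma hom_eval_hom:
  assumes "is_hom \<phi>"
  shows "\<phi> (eval_hom c x f) = eval_hom (\<lambda>a. \<phi> (c a)) (\<lambda>i. \<phi> (x i)) f"
  by (simp add: eval_hom_def hom_sum[OF assms] hom_mult[OF assms] hom_prod[OF assms] hom_power[OF assms])

lemma is_hom_eval: "is_hom (\<lambda>f. eval f v)"
  unfolding eval_def by (rule is_hom_eval_hom[OF is_hom_id])

lemmas eval_add = hom_add[OF is_hom_eval]
  and eval_mult = hom_mult[OF is_hom_eval]
  and eval_0 = hom_zero[OF is_hom_eval]
  and eval_1 = hom_one[OF is_hom_eval]
  and eval_diff = hom_diff[OF is_hom_eval]
  and eval_power = hom_power[OF is_hom_eval]
  and eval_sum = hom_sum[OF is_hom_eval]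
  and eval_prod = hom_prod[OF is_hom_eval]

lemma eval_Const: "eval (Const a) v = a"
  by (simp add: eval_def eval_hom_Const[OF is_hom_id])

lemma eval_Var: "eval (Var i) v = v $ i"
  by (simp add: eval_def eval_hom_Var[OF is_hom_id])

lemmas eval_simps = eval_add eval_mult eval_0 eval_1 eval_diff eval_power eval_sum eval_prod
  eval_Const eval_Var

text \<open>The coefficient map \<open>r\<close> is arbitrary, so that coefficients can be replaced
  by chosen q-th roots as well as by q-th powers.\<close>

lemma eval_eval_hom_Const:
  "eval (eval_hom (\<lambda>a. Const (r a)) F f) v = eval_hom r (\<lambda>i. eval (F i) v) f"
  by (subst hom_eval_hom[OF is_hom_eval]) (simp add: eval_Const)

lemma eval_subst: "eval (subst f F) v = eval f (\<chi> i. eval (F i) v)"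
  unfolding subst_def eval_eval_hom_Const by (simp add: eval_def)

section \<open>Homogeneous forms\<close>

lemma homogeneous_0: "homogeneous m 0"
  by (simp add: homogeneous_def)

lemma homogeneous_add: "homogeneous m f \<Longrightarrow> homogeneous m g \<Longrightarrow> homogeneous m (f + g)"
  unfolding homogeneous_def using keys_add[of f g] by blast

lemma homogeneous_sum: "(\<And>i. i \<in> A \<Longrightarrow> homogeneous m (F i)) \<Longrightarrow> homogeneous m (sum F A)"
  by (induction A rule: infinite_finite_induct) (auto simp: homogeneous_0 homogeneous_add)

lemma homogeneous_mult:
  assumes "homogeneous m f" "homogeneous n g"
  shows "homogeneous (m + n) (f * g)"
  using assms keys_mult[of f g] unfolding homogeneous_def
  by (fastforce simp: lookup_add sum.distrib)

lemma homogeneous_Const: "homogeneous 0 (Const a)"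
  by (auto simp: homogeneous_def Const_def)

lemma homogeneous_1: "homogeneous 0 1"
  by (auto simp: homogeneous_def)

lemma homogeneous_Var: "homogeneous 1 (Var i)"
  by (auto simp: homogeneous_def Var_def lookup_single when_def)

lemma homogeneous_power: "homogeneous m f \<Longrightarrow> homogeneous (m * n) (f ^ n)"
  by (induction n) (auto simp: homogeneous_1 intro: homogeneous_mult)

lemma homogeneous_prod:
  assumes "\<And>i. i \<in> A \<Longrightarrow> homogeneous (m i) (F i)"
  shows "homogeneous (sum m A) (prod F A)"
  using assms
  by (induction A rule: infinite_finite_induct) (auto simp: homogeneous_1 intro: homogeneous_mult)

lemma homogeneous_diff:
  "homogeneous m f \<Longrightarrow> homogeneous m g \<Longrightarrow> homogeneous m (f - g)"
  for f g :: "('n::finite, 'k::comm_ring_1) mpoly"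
  by (auto simp: homogeneous_def in_keys_iff lookup_minus)

lemma homogeneous_eval_hom_Const:
  assumes "homogeneous m f" "\<And>i. homogeneous r (F i)"
  shows "homogeneous (m * r) (eval_hom (\<lambda>a. Const (c a)) F f)"
  unfolding eval_hom_def
proof (rule homogeneous_sum)
  fix t assume t: "t \<in> Poly_Mapping.keys f"
  have "homogeneous (0 + (\<Sum>i\<in>UNIV. r * Poly_Mapping.lookup t i))
    (Const (c (Poly_Mapping.lookup f t)) * (\<Prod>i\<in>UNIV. F i ^ Poly_Mapping.lookup t i))"
    by (intro homogeneous_mult homogeneous_Const homogeneous_prod homogeneous_power assms)
  moreover have "(\<Sum>i\<in>UNIV. Poly_Mapping.lookup t i) = m"
    using assms(1) t by (simp add: homogeneous_def)
  ultimately show "homogeneous (m * r)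
    (Const (c (Poly_Mapping.lookup f t)) * (\<Prod>i\<in>UNIV. F i ^ Poly_Mapping.lookup t i))"
    by (simp add: mult.commute flip: sum_distrib_left)
qed

lemma homogeneous_subst:
  "homogeneous m f \<Longrightarrow> (\<And>i. homogeneous r (F i)) \<Longrightarrow> homogeneous (m * r) (subst f F)"
  unfolding subst_def by (rule homogeneous_eval_hom_Const)

lemma eval_homogeneous:
  assumes "homogeneous m f"
  shows "eval f (c *s v) = c ^ m * eval f v"
proof -
  have "eval f (c *s v) = (\<Sum>t\<in>Poly_Mapping.keys f. Poly_Mapping.lookup f t *
      (c ^ (\<Sum>i\<in>UNIV. Poly_Mapping.lookup t i) * (\<Prod>i\<in>UNIV. (v $ i) ^ Poly_Mapping.lookup t i)))"
    by (simp add: eval_def eval_hom_def power_mult_distrib prod.distrib power_sum)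
  also have "\<dots> = (\<Sum>t\<in>Poly_Mapping.keys f. c ^ m * (Poly_Mapping.lookup f t *
      (\<Prod>i\<in>UNIV. (v $ i) ^ Poly_Mapping.lookup t i)))"
    using assms by (intro sum.cong) (auto simp: homogeneous_def mult_ac)
  finally show ?thesis
    by (simp add: eval_def eval_hom_def sum_distrib_left)
qed


section \<open>Frobenius forms and matrices\<close>

text \<open>Euclid's argument: adding 1 to the product of all linear factors would give a
  nonconstant polynomial without a root.\<close>

lemma infinite_UNIV_alg_closed_field: "infinite (UNIV :: 'k::alg_closed_field set)"
proof
  assume fin: "finite (UNIV :: 'k set)"
  define P where "P = (\<Prod>a\<in>(UNIV :: 'k set). [:- a, 1:])"
  have "degree P = card (UNIV :: 'k set)"
    unfolding P_def by (subst degree_prod_sum_eq) auto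
  then have "degree P > 0"
    using fin by (simp add: card_gt_0_iff)
  then have "degree (P + 1) > 0"
    by (simp add: degree_add_eq_left)
  then obtain x where "poly (P + 1) x = 0"
    using alg_closed_imp_poly_has_root by blast
  moreover have "poly P x = 0"
    unfolding P_def poly_prod using fin by (intro prod_zero) auto
  ultimately show False by simp
qed

lemma poly_eq_0_if_infinite_zeros:
  "infinite {x. poly p x = 0} \<Longrightarrow> p = 0" for p :: "'k::{comm_ring_1,ring_no_zero_divisors} poly"
  using poly_roots_finite by blast

lemma Var_power: "Var i ^ m = Poly_Mapping.single (Poly_Mapping.single i m) 1"
proof (induction m)
  case (Suc m)
  then show ?case
    by (simp add: Var_def mult_single flip: single_add)
qed simp

definition frobenius_poly :: "nat \<Rightarrow> 'k::comm_ring_1 ^ 'n ^ 'n \<Rightarrow> ('n::finite, 'k) mpoly"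
  where "frobenius_poly q A = (\<Sum>i\<in>UNIV. \<Sum>j\<in>UNIV. Const (A $ i $ j) * Var i ^ q * Var j)"

definition frobenius_exponent :: "nat \<Rightarrow> 'n \<Rightarrow> 'n \<Rightarrow> 'n \<Rightarrow>\<^sub>0 nat"
  where "frobenius_exponent q i j = Poly_Mapping.single i q + Poly_Mapping.single j 1"

lemma frobenius_monomial:
  "Const a * Var i ^ q * Var j = Poly_Mapping.single (frobenius_exponent q i j) a"
  unfolding Var_power by (simp add: Const_def Var_def mult_single frobenius_exponent_def)

text \<open>The first index is recognisable as the only variable of exponent at least q. For q = 1
  the monomials x_i x_j and x_j x_i would coincide.\<close>

lemma frobenius_exponent_inject:
  assumes "q \<ge> 2" "frobenius_exponent q i j = frobenius_exponent q i' j'"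
  shows "i = i' \<and> j = j'"
proof -
  have *: "Poly_Mapping.lookup (frobenius_exponent q i j) i = Poly_Mapping.lookup (frobenius_exponent q i' j') i"
    using assms by simp
  have i: "i = i'"
    using * assms(1) by (auto simp: frobenius_exponent_def lookup_add lookup_single when_def split: if_splits)
  have "Poly_Mapping.single j (1::nat) = Poly_Mapping.single j' 1"
    using assms(2) unfolding i frobenius_exponent_def by simp
  then have "j = j'"
    by (metis lookup_single_eq lookup_single_not_eq zero_neq_one)
  then show ?thesis
    using i by blast
qed

lemma lookup_frobenius_poly:
  assumes "q \<ge> 2"
  shows "Poly_Mapping.lookup (frobenius_poly q A) (frobenius_exponent q i j) = A $ i $ j"
proof -
  have *: "frobenius_exponent q i' j' = frobenius_exponent q i j \<longleftrightarrow> i' = i \<and> j' = j" for i' j'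
    by (auto dest: frobenius_exponent_inject[OF assms])
  have "Poly_Mapping.lookup (frobenius_poly q A) (frobenius_exponent q i j)
    = (\<Sum>i'\<in>UNIV. \<Sum>j'\<in>UNIV. if i' = i then (if j' = j then A $ i' $ j' else 0) else 0)"
    unfolding frobenius_poly_def frobenius_monomial lookup_sum
    by (intro sum.cong) (auto simp: lookup_single when_def *)
  also have "\<dots> = (\<Sum>i'\<in>UNIV. if i' = i then A $ i' $ j else 0)"
    by (intro sum.cong) auto
  finally show ?thesis by simp
qed

lemma frobenius_exponentI:
  assumes "(\<Sum>l\<in>UNIV. Poly_Mapping.lookup t l) = q + 1" "q \<le> Poly_Mapping.lookup t (i :: 'n::finite)"
  shows "\<exists>j. t = frobenius_exponent q i j"
proof -
  define s where "s l = Poly_Mapping.lookup t l - (if l = i then q else 0)" for l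
  have t: "Poly_Mapping.lookup t l = s l + (if l = i then q else 0)" for l
    using assms(2) by (simp add: s_def)
  have "(\<Sum>l\<in>UNIV. s l) = 1"
    using assms(1) unfolding t sum.distrib by simp
  then obtain j where j: "s j = 1" "\<And>l. l \<noteq> j \<Longrightarrow> s l = 0"
    by (auto simp: sum_eq_Suc0_iff)
  have "t = frobenius_exponent q i j"
  proof (rule poly_mapping_eqI)
    show "Poly_Mapping.lookup t l = Poly_Mapping.lookup (frobenius_exponent q i j) l" for l
      using j by (cases "l = j") (auto simp: frobenius_exponent_def lookup_add lookup_single when_def t)
  qed
  then show ?thesis by blast
qed

lemma module_mult: "Modules.module ((*) :: 'r::comm_ring_1 \<Rightarrow> 'r \<Rightarrow> 'r)"
  by unfold_locales (auto simp: algebra_simps)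

text \<open>Membership in the ideal passes to monomials: each monomial of \<open>f\<close> is
  divisible by some x_i^q, and degree q + 1 leaves room for exactly one more variable. The
  coefficients then form the matrix.\<close>

lemma frobenius_form_imp_frobenius_poly:
  fixes f :: "('n::finite, 'k::comm_ring_1) mpoly"
  assumes "frobenius_form q f" "q \<ge> 2"
  shows "\<exists>A. f = frobenius_poly q A"
proof -
  interpret M: Modules.module "(*) :: ('n, 'k) mpoly \<Rightarrow> _" by (rule module_mult)
  have hom: "homogeneous (q + 1) f" and sp: "f \<in> M.span {Var i ^ q |i. True}"
    using assms by (auto simp: frobenius_form_def generated_ideal_def)
  have "\<forall>t\<in>Poly_Mapping.keys f. \<exists>i. q \<le> Poly_Mapping.lookup t i"
    using sp
  proof (induction rule: M.span_induct_alt)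
    case (step c x y)
    show ?case
    proof
      fix t assume "t \<in> Poly_Mapping.keys (c * x + y)"
      then consider "t \<in> Poly_Mapping.keys y" | "t \<in> Poly_Mapping.keys (c * x)"
        using keys_add[of "c * x" y] by blast
      then show "\<exists>i. q \<le> Poly_Mapping.lookup t i"
      proof cases
        case 2
        from step(1) obtain i where "x = Var i ^ q" by blast
        then have "\<exists>a. t = a + Poly_Mapping.single i q"
          using 2 keys_mult[of c x] by (auto simp: Var_power split: if_splits)
        then have "q \<le> Poly_Mapping.lookup t i"
          by (auto simp: lookup_add)
        then show ?thesis by blast
      qed (use step in blast)
    qed
  qed simp
  then have keys: "\<exists>i j. t = frobenius_exponent q i j" if "t \<in> Poly_Mapping.keys f" for t
    using that hom frobenius_exponentI unfolding homogeneous_def by blast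
  have "f = frobenius_poly q (\<chi> i j. Poly_Mapping.lookup f (frobenius_exponent q i j))"
    (is "_ = ?g")
  proof (rule poly_mapping_eqI)
    fix t
    show "Poly_Mapping.lookup f t = Poly_Mapping.lookup ?g t"
    proof (cases "\<exists>i j. t = frobenius_exponent q i j")
      case True
      then show ?thesis by (auto simp: lookup_frobenius_poly[OF assms(2)])
    next
      case False
      then have "Poly_Mapping.lookup f t = 0"
        using keys[of t] by (meson in_keys_iff)
      moreover have "Poly_Mapping.lookup ?g t = 0"
        using False unfolding frobenius_poly_def frobenius_monomial lookup_sum
        by (intro sum.neutral ballI) (auto simp: lookup_single when_def)
      ultimately show ?thesis by simp
    qed
  qed
  then show ?thesis by blast
qed

lemma homogeneous_frobenius_poly: "homogeneous (q + 1) (frobenius_poly q A)"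
  unfolding frobenius_poly_def
proof (intro homogeneous_sum)
  fix i j
  have "homogeneous (0 + 1 * q + 1) (Const (A $ i $ j) * Var i ^ q * Var j)"
    by (intro homogeneous_mult homogeneous_power homogeneous_Const homogeneous_Var)
  then show "homogeneous (q + 1) (Const (A $ i $ j) * Var i ^ q * Var j)" by simp
qed

lemma frobenius_form_frobenius_poly:
  fixes A :: "'k::comm_ring_1 ^ 'n ^ 'n"
  assumes "A \<noteq> 0" "q \<ge> 2"
  shows "frobenius_form q (frobenius_poly q A)"
proof -
  interpret M: Modules.module "(*) :: ('n, 'k) mpoly \<Rightarrow> _" by (rule module_mult)
  obtain i j where "A $ i $ j \<noteq> 0"
    using assms(1) by (auto simp: vec_eq_iff)
  then have "frobenius_poly q A \<noteq> 0"
    using lookup_frobenius_poly[OF assms(2), of A i j] by (metis lookup_zero)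
  moreover have "frobenius_poly q A \<in> M.span {Var i ^ q |i. True}"
    unfolding frobenius_poly_def
  proof (intro M.span_sum)
    fix i j :: 'n
    have "(Var i :: ('n, 'k) mpoly) ^ q \<in> {Var i ^ q |i. True}" by blast
    then have "(Const (A $ i $ j) * Var j) * Var i ^ q \<in> M.span {Var i ^ q |i. True}"
      by (rule M.span_scale[OF M.span_base])
    moreover have "(Const (A $ i $ j) * Var j) * Var i ^ q = Const (A $ i $ j) * Var i ^ q * Var j"
      by (simp only: mult_ac)
    ultimately show "Const (A $ i $ j) * Var i ^ q * Var j \<in> M.span {Var i ^ q |i. True}"
      by simp
  qed
  ultimately show ?thesis
    using homogeneous_frobenius_poly by (simp add: frobenius_form_def generated_ideal_def)
qed

lemma eval_hom_frobenius_poly: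
  assumes "is_hom c"
  shows "eval_hom c x (frobenius_poly q A) = (\<Sum>i\<in>UNIV. \<Sum>j\<in>UNIV. c (A $ i $ j) * x i ^ q * x j)"
  unfolding frobenius_poly_def
  by (simp add: hom_sum[OF is_hom_eval_hom[OF assms]] hom_mult[OF is_hom_eval_hom[OF assms]]
      hom_power[OF is_hom_eval_hom[OF assms]] eval_hom_Const[OF assms] eval_hom_Var[OF assms])

section \<open>Formal partial derivatives\<close>

lemma partial_superset:
  assumes "finite S" "Poly_Mapping.keys f \<subseteq> S"
  shows "partial i f = (\<Sum>t\<in>S. Poly_Mapping.single (t - Poly_Mapping.single i 1)
      (of_nat (Poly_Mapping.lookup t i) * Poly_Mapping.lookup f t))"
  unfolding partial_def
  by (rule sum.mono_neutral_left[OF assms]) (auto simp: in_keys_iff)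

lemma partial_add: "partial i (f + g) = partial i f + partial i g"
proof -
  let ?S = "Poly_Mapping.keys f \<union> Poly_Mapping.keys g"
  have "partial i h = (\<Sum>t\<in>?S. Poly_Mapping.single (t - Poly_Mapping.single i 1)
      (of_nat (Poly_Mapping.lookup t i) * Poly_Mapping.lookup h t))" if "h \<in> {f, g, f + g}" for h
    by (rule partial_superset) (use that keys_add[of f g] in auto)
  then show ?thesis
    by (simp add: lookup_add distrib_left single_add sum.distrib)
qed

lemma partial_0: "partial i 0 = 0"
  by (simp add: partial_def)

lemma partial_sum: "partial i (sum F A) = (\<Sum>a\<in>A. partial i (F a))"
  by (induction A rule: infinite_finite_induct) (auto simp: partial_0 partial_add)

lemma partial_single:
  "partial i (Poly_Mapping.single t a) = Poly_Mapping.single (t - Poly_Mapping.single i 1)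
      (of_nat (Poly_Mapping.lookup t i) * a)"
  by (subst partial_superset[of "{t}"]) auto

lemma homogeneous_partial:
  assumes "homogeneous (Suc m) f"
  shows "homogeneous m (partial l f)"
  unfolding partial_def
proof (rule homogeneous_sum)
  fix t assume "t \<in> Poly_Mapping.keys f"
  then have t: "(\<Sum>i\<in>UNIV. Poly_Mapping.lookup t i) = Suc m"
    using assms by (simp add: homogeneous_def)
  show "homogeneous m (Poly_Mapping.single (t - Poly_Mapping.single l 1)
      (of_nat (Poly_Mapping.lookup t l) * Poly_Mapping.lookup f t))"
  proof (cases "Poly_Mapping.lookup t l = 0")
    case False
    have "(\<Sum>i\<in>UNIV. Poly_Mapping.lookup (t - Poly_Mapping.single l 1) i)
      = (\<Sum>i\<in>UNIV. Poly_Mapping.lookup t i - (if i = l then 1 else 0))"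
      by (intro sum.cong) (auto simp: lookup_minus lookup_single when_def)
    also have "\<dots> = Suc m - (\<Sum>i\<in>UNIV. if i = l then 1 else 0)"
      using False unfolding t[symmetric] by (intro sum_subtractf_nat) auto
    finally show ?thesis by (simp add: homogeneous_def)
  qed (simp add: homogeneous_0)
qed

text \<open>Only the linear factor x_j is differentiated, since the derivative of x_i^q carries the
  factor q = 0.\<close>

lemma eval_partial_frobenius_poly:
  fixes A :: "'k::comm_ring_1 ^ 'n ^ 'n"
  assumes "of_nat q = (0 :: 'k)"
  shows "eval (partial l (frobenius_poly q A)) v = (\<Sum>i\<in>UNIV. A $ i $ l * v $ i ^ q)"
proof -
  have *: "eval (Poly_Mapping.single (frobenius_exponent q i j - Poly_Mapping.single l 1)
      (of_nat (Poly_Mapping.lookup (frobenius_exponent q i j) l) * a)) v =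
    (if j = l then a * v $ i ^ q else 0)" for i j and a :: 'k
  proof -
    \<comment> \<open>This includes i = j = l, where the exponent q + 1 becomes 1 in k.\<close>
    have l: "of_nat (Poly_Mapping.lookup (frobenius_exponent q i j) l) = (if j = l then 1 else 0 :: 'k)"
      using assms by (auto simp: frobenius_exponent_def lookup_add lookup_single when_def)
    show ?thesis
    proof (cases "j = l")
      case True
      then have "frobenius_exponent q i j - Poly_Mapping.single l 1 = Poly_Mapping.single i q"
        by (simp add: frobenius_exponent_def)
      then have "eval (Poly_Mapping.single (frobenius_exponent q i j - Poly_Mapping.single l 1) a) v
        = eval (Const a * Var i ^ q) v"
        by (simp add: Const_def Var_power mult_single)
      then show ?thesis using True l by (simp add: eval_simps)
    qed (simp add: l eval_0)
  qed
  show ?thesis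
    unfolding frobenius_poly_def frobenius_monomial partial_sum partial_single eval_sum *
    by simp
qed


section \<open>Restriction to lines and planes\<close>

definition line :: "('n::finite, 'k::comm_ring_1) mpoly \<Rightarrow> 'k ^ 'n \<Rightarrow> 'k ^ 'n \<Rightarrow> 'k poly"
  where "line H v w = eval_hom (\<lambda>c. [:c:]) (\<lambda>i. [:v $ i, w $ i:]) H"

text \<open>The restriction of \<open>H\<close> to \<open>v + s w + t u\<close>; the coefficients are polynomials in \<open>s\<close>, the main
  variable is \<open>t\<close>.\<close>

definition plane :: "('n::finite, 'k::comm_ring_1) mpoly \<Rightarrow> 'k ^ 'n \<Rightarrow> 'k ^ 'n \<Rightarrow> 'k ^ 'n \<Rightarrow> 'k poly poly"
  where "plane H v w u = eval_hom (\<lambda>c. [:[:c:]:]) (\<lambda>i. [:[:v $ i, w $ i:], [:u $ i:]:]) H"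

lemma vec_nth_add_scale: "($) (v + s *s w) = (\<lambda>i. v $ i + s * w $ i)"
  by (simp add: fun_eq_iff)

lemma is_hom_line: "is_hom (\<lambda>H. line H v w)"
  unfolding line_def by (rule is_hom_eval_hom[OF is_hom_const_poly])

lemma is_hom_const_poly_poly: "is_hom (\<lambda>c. [:[:c:]:])"
  using is_hom_comp[OF is_hom_const_poly is_hom_const_poly] by simp

lemma poly_line: "poly (line H v w) s = eval H (v + s *s w)"
  unfolding line_def eval_def by (subst hom_eval_hom[OF is_hom_poly]) (simp add: vec_nth_add_scale)

lemma map_poly_plane: "map_poly (\<lambda>c. poly c s) (plane H v w u) = line H (v + s *s w) u"
  unfolding line_def plane_def
  by (subst hom_eval_hom[OF is_hom_map_poly[OF is_hom_poly]])
    (simp add: map_poly_pCons algebra_simps)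

lemma poly_plane:
  "poly (plane H v w u) \<phi> = eval_hom (\<lambda>c. [:c:]) (\<lambda>i. [:v $ i, w $ i:] + \<phi> * [:u $ i:]) H"
  unfolding plane_def by (subst hom_eval_hom[OF is_hom_poly]) simp

lemma poly_plane_0: "poly (plane H v w u) 0 = line H v w"
  unfolding poly_plane line_def by simp

text \<open>Every root of \<open>F\<close> is a root of \<open>H\<close>, and its multiplicity in
  \<open>F\<close> is at most the degree of \<open>F\<close>, whence the exponent. For restrictions
  of \<open>f\<close> it will be q + 1.\<close>

lemma dvd_power_if_roots_subset:
  fixes F H :: "'k::alg_closed_field poly"
  assumes "F \<noteq> 0" "\<And>t. poly F t = 0 \<Longrightarrow> poly H t = 0"
  shows "F dvd H ^ degree F"
proof -
  obtain S where S: "size S = degree F" "F = Polynomial.smult (lead_coeff F) (\<Prod>x\<in>#S. [:- x, 1:])"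
    using alg_closed_imp_factorization[OF assms(1)] by blast
  have root: "poly H x = 0" if "x \<in># S" for x
  proof (rule assms(2))
    have "[:- x, 1:] dvd (\<Prod>x\<in>#S. [:- x, 1:])"
      using that by (intro dvd_prod_mset) auto
    then have "[:- x, 1:] dvd F"
      by (subst S(2)) (rule dvd_smult)
    then show "poly F x = 0" by (simp add: poly_eq_0_iff_dvd)
  qed
  have "(\<Prod>x\<in>#T. [:- x, 1:]) dvd H ^ size T" if "set_mset T \<subseteq> set_mset S" for T
    using that
  proof (induction T)
    case (add x T)
    have "[:- x, 1:] dvd H"
      using root add.prems by (simp add: poly_eq_0_iff_dvd[symmetric])
    then have "[:- x, 1:] * (\<Prod>x\<in>#T. [:- x, 1:]) dvd H * H ^ size T"
      using add by (intro mult_dvd_mono) auto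
    then show ?case by (simp del: mult_pCons_left)
  qed simp
  from this[of S] have "Polynomial.smult (lead_coeff F) (\<Prod>x\<in>#S. [:- x, 1:]) dvd H ^ degree F"
    using S(1) assms(1) by (simp add: smult_dvd_iff)
  then show ?thesis
    by (simp only: S(2)[symmetric])
qed

lemma X_power_dvd_power_cancel:
  fixes x :: "'k::field poly"
  assumes "[:0, 1:] ^ (n * m) dvd x ^ m" "m > 0"
  shows "[:0, 1:] ^ n dvd x"
proof (cases "x = 0")
  case False
  have "Polynomial.order 0 (x ^ l) = l * Polynomial.order 0 x" for l
    by (induction l) (use False in \<open>auto simp: order_mult order_root\<close>)
  moreover have "n * m \<le> Polynomial.order 0 (x ^ m)"
    using assms(1) False order_divides[of 0 "n * m" "x ^ m"] by simp
  ultimately have "n \<le> Polynomial.order 0 x"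
    using assms(2) by simp
  then show ?thesis
    using order_divides[of 0 n x] by simp
qed simp

lemma X_power_dvd_mult_cancel:
  fixes x :: "'k::field poly"
  assumes "[:0, 1:] ^ n dvd g * x" "Polynomial.coeff g 0 \<noteq> 0"
  shows "[:0, 1:] ^ n dvd x"
proof (cases "x = 0")
  case False
  have g: "g \<noteq> 0" using assms(2) by auto
  have "Polynomial.order 0 g = 0"
    using assms(2) by (intro order_0I) (simp add: poly_0_coeff_0)
  moreover have "n \<le> Polynomial.order 0 (g * x)"
    using assms(1) False g order_divides[of 0 n "g * x"] by simp
  ultimately have "n \<le> Polynomial.order 0 x"
    using False g by (simp add: order_mult)
  then show ?thesis
    using order_divides[of 0 n x] by simp
qed simp

lemma matrix_mult_eq_mat_1_iff:
  fixes A M :: "'a::semiring_1 ^ 'n::finite ^ 'n"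
  shows "A ** M = mat 1 \<longleftrightarrow> (\<forall>i j. (\<Sum>l\<in>UNIV. A $ i $ l * M $ l $ j) = (if i = j then 1 else 0))"
  by (simp add: matrix_matrix_mult_def mat_def vec_eq_iff)

section \<open>The sesquilinear form of an invertible matrix\<close>

locale frobenius_hypersurface =
  fixes A M :: "'k::alg_closed_field ^ 'n::finite ^ 'n" and p e q :: nat and f :: "('n, 'k) mpoly"
  assumes char: "CHAR('k) = p" "p > 0" and exponent: "e > 0" "q = p ^ e"
    and inverse: "A ** M = mat 1"
    and f_eq: "f = frobenius_poly q A"
begin

lemma prime_p: "prime p"
  using prime_CHAR_semidom[where ?'a = 'k] char by simp

lemma q_ge_2: "q \<ge> 2"
  using exponent prime_ge_2_nat[OF prime_p] self_le_power[of p e] by linarith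

lemma of_nat_q: "of_nat q = (0 :: 'k)"
  using char exponent by (simp add: of_nat_eq_0_iff_char_dvd)

lemma frobenius_add: "CHAR('r::comm_ring_1) = p \<Longrightarrow> (x + y :: 'r) ^ q = x ^ q + y ^ q"
  by (rule freshmans_dream') (use prime_p exponent in auto)

lemma frobenius_sum: "CHAR('r::comm_ring_1) = p \<Longrightarrow> sum F S ^ q = (\<Sum>i\<in>S. (F i :: 'r) ^ q)"
  by (rule freshmans_dream_sum') (use prime_p exponent in auto)

lemma frobenius_diff: "CHAR('r::comm_ring_1) = p \<Longrightarrow> (x - y :: 'r) ^ q = x ^ q - y ^ q"
  using frobenius_add[of "x - y" y] by (simp add: algebra_simps)

text \<open>Frobenius-semilinear in the first slot and linear in the second; \<open>f\<close> is its
  diagonal. The map \<open>c\<close> admits coordinates in k, k[s] or k[s][t], as needed for points,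
  lines and planes.\<close>

definition bil :: "('k \<Rightarrow> 'r::comm_ring_1) \<Rightarrow> ('n \<Rightarrow> 'r) \<Rightarrow> ('n \<Rightarrow> 'r) \<Rightarrow> 'r"
  where "bil c x y = (\<Sum>i\<in>UNIV. \<Sum>j\<in>UNIV. c (A $ i $ j) * x i ^ q * y j)"

lemma eval_hom_f: "is_hom c \<Longrightarrow> eval_hom c x f = bil c x x"
  unfolding f_eq bil_def by (rule eval_hom_frobenius_poly)

lemma bil_add_left:
  fixes x :: "'n \<Rightarrow> 'r::comm_ring_1"
  assumes "CHAR('r) = p"
  shows "bil c (\<lambda>i. x i + T * y i) z = bil c x z + T ^ q * bil c y z"
  unfolding bil_def frobenius_add[OF assms]
  by (simp add: algebra_simps sum.distrib sum_distrib_left power_mult_distrib)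

lemma bil_add_right:
  "bil c z (\<lambda>i. x i + T * y i) = bil c z x + T * bil c z y"
  unfolding bil_def by (simp add: algebra_simps sum.distrib sum_distrib_left)

lemma bil_expand:
  fixes x :: "'n \<Rightarrow> 'r::comm_ring_1"
  assumes "CHAR('r) = p"
  shows "bil c (\<lambda>i. x i + T * y i) (\<lambda>i. x i + T * y i) =
    bil c x x + T * bil c x y + T ^ q * bil c y x + T ^ (q + 1) * bil c y y"
  unfolding bil_add_left[OF assms] bil_add_right by (simp add: algebra_simps)

lemma hom_bil:
  "is_hom \<phi> \<Longrightarrow> \<phi> (bil c x y) = bil (\<lambda>a. \<phi> (c a)) (\<lambda>i. \<phi> (x i)) (\<lambda>i. \<phi> (y i))"
  unfolding bil_def by (simp add: hom_sum hom_mult hom_power)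

abbreviation form :: "'k ^ 'n \<Rightarrow> 'k ^ 'n \<Rightarrow> 'k"
  where "form v w \<equiv> bil (\<lambda>c. c) (($) v) (($) w)"

definition grad :: "'k ^ 'n \<Rightarrow> 'n \<Rightarrow> 'k"
  where "grad v l = (\<Sum>i\<in>UNIV. A $ i $ l * v $ i ^ q)"

lemma eval_f: "eval f v = form v v"
  unfolding eval_def by (rule eval_hom_f[OF is_hom_id])

lemma eval_partial: "eval (partial l f) v = grad v l"
  unfolding f_eq grad_def by (rule eval_partial_frobenius_poly[OF of_nat_q])

lemma form_grad: "form v w = (\<Sum>l\<in>UNIV. grad v l * w $ l)"
  unfolding bil_def grad_def sum_distrib_right by (rule sum.swap)

text \<open>\<open>M\<close> undoes the linear part of the gradient, so the gradient recovers the
  q-th powers of all coordinates. Nonvanishing of the gradient, the shape of the Gauss subfield and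
  the dual equation all rest on this.\<close>

lemma grad_inverse: "(\<Sum>l\<in>UNIV. grad v l * M $ l $ i) = v $ i ^ q"
proof -
  have AM: "(\<Sum>l\<in>UNIV. A $ j $ l * M $ l $ i) = (if j = i then 1 else 0)" for j
    using inverse by (simp add: matrix_mult_eq_mat_1_iff)
  have "(\<Sum>l\<in>UNIV. grad v l * M $ l $ i) = (\<Sum>l\<in>UNIV. \<Sum>j\<in>UNIV. v $ j ^ q * (A $ j $ l * M $ l $ i))"
    unfolding grad_def sum_distrib_right by (simp add: mult_ac)
  also have "\<dots> = (\<Sum>j\<in>UNIV. v $ j ^ q * (\<Sum>l\<in>UNIV. A $ j $ l * M $ l $ i))"
    unfolding sum_distrib_left by (rule sum.swap)
  also have "\<dots> = v $ i ^ q"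
    unfolding AM by (simp add: if_distrib[of "\<lambda>x. _ * x"] cong: if_cong)
  finally show ?thesis .
qed

lemma grad_nonzero:
  assumes "v \<noteq> 0"
  shows "\<exists>l. grad v l \<noteq> 0"
proof (rule ccontr)
  assume "\<not> ?thesis"
  then have "v $ i ^ q = 0" for i
    using grad_inverse[of v i] by simp
  then have "v = 0"
    by (simp add: vec_eq_iff)
  with assms show False by simp
qed

lemma form_nonzero:
  assumes "v \<noteq> 0"
  shows "\<exists>w. form v w \<noteq> 0"
proof -
  obtain l where "grad v l \<noteq> 0" using grad_nonzero[OF assms] by blast
  then have "form v (axis l 1) \<noteq> 0"
    by (simp add: form_grad axis_def if_distrib[of "\<lambda>x. _ * x"] cong: if_cong)
  then show ?thesis by blast
qed

lemma form_add_scale: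
  "form z (x + T *s y) = form z x + T * form z y"
  using bil_add_right[of "\<lambda>c. c" "($) z" "($) x" T "($) y"]
  by (simp add: vec_nth_add_scale)

text \<open>Additivity of the q-th power leaves only the exponents 0, 1, q and q + 1. A line tangent
  at a zero x kills the first two terms and therefore meets {f = 0} to order at least q.\<close>

lemma line_f:
  "line f x y = [:form x x:] + Polynomial.monom (form x y) 1 + Polynomial.monom (form y x) q + Polynomial.monom (form y y) (q + 1)"
proof -
  let ?c = "\<lambda>c :: 'k. [:c:]"
  have *: "bil ?c (\<lambda>i. [:x $ i:]) (\<lambda>i. [:y $ i:]) = [:form x y:]" for x y
    using hom_bil[OF is_hom_const_poly, of "\<lambda>c. c" "($) x" "($) y"] by simp
  have "line f x y = bil ?c (\<lambda>i. [:x $ i:] + [:0, 1:] * [:y $ i:]) (\<lambda>i. [:x $ i:] + [:0, 1:] * [:y $ i:])"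
    unfolding line_def eval_hom_f[OF is_hom_const_poly] by simp
  also have "\<dots> = [:form x x:] + [:0, 1:] * [:form x y:] + [:0, 1:] ^ q * [:form y x:]
    + [:0, 1:] ^ (q + 1) * [:form y y:]"
    by (subst bil_expand) (auto simp: char *)
  finally show ?thesis
    by (simp add: monom_altdef)
qed

lemma coeff_line_f: "Polynomial.coeff (line f x y) (q + 1) = form y y"
  using q_ge_2 unfolding line_f by (auto simp: coeff_pCons split: nat.splits)

lemma degree_line_f:
  assumes "eval f y \<noteq> 0"
  shows "degree (line f x y) = q + 1"
proof (rule antisym)
  show "degree (line f x y) \<le> q + 1"
    using q_ge_2 by (intro degree_le) (auto simp: line_f coeff_pCons split: nat.splits)
  show "q + 1 \<le> degree (line f x y)"
    using assms coeff_line_f[of x y] by (intro le_degree) (auto simp: eval_f)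
qed

lemma degree_plane_f:
  assumes "eval f u \<noteq> 0"
  shows "degree (plane f v w u) = q + 1" "lead_coeff (plane f v w u) = [:eval f u:]"
proof -
  let ?c = "\<lambda>c :: 'k. [:[:c:]:]"
  let ?X = "\<lambda>i. [:[:v $ i, w $ i:]:]" and ?U = "\<lambda>i. [:[:u $ i:]:]"
  let ?d = "\<lambda>c :: 'k. [:c:]"
  let ?x = "\<lambda>i. [:v $ i, w $ i:]" and ?u = "\<lambda>i. [:u $ i:]"
  have *: "bil ?c (\<lambda>i. [:x i:]) (\<lambda>i. [:y i:]) = [:bil ?d x y:]" for x y
    using hom_bil[OF is_hom_const_poly, of ?d x y] by simp
  have uu: "bil ?d ?u ?u = [:eval f u:]"
    using hom_bil[OF is_hom_const_poly, of "\<lambda>c. c" "($) u" "($) u"] by (simp add: eval_f)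
  have "plane f v w u = bil ?c (\<lambda>i. ?X i + [:0, 1:] * ?U i) (\<lambda>i. ?X i + [:0, 1:] * ?U i)"
    unfolding plane_def eval_hom_f[OF is_hom_const_poly_poly] by simp
  also have "\<dots> = [:bil ?d ?x ?x:] + [:0, 1:] * [:bil ?d ?x ?u:] + [:0, 1:] ^ q * [:bil ?d ?u ?x:]
    + [:0, 1:] ^ (q + 1) * [:bil ?d ?u ?u:]"
    by (subst bil_expand) (auto simp: char *)
  finally have P: "plane f v w u = [:bil ?d ?x ?x:] + Polynomial.monom (bil ?d ?x ?u) 1 + Polynomial.monom (bil ?d ?u ?x) q
    + Polynomial.monom [:eval f u:] (q + 1)"
    by (simp add: monom_altdef uu)
  have top: "Polynomial.coeff (plane f v w u) (q + 1) = [:eval f u:]"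
    using q_ge_2 unfolding P by (auto simp: coeff_pCons split: nat.splits)
  show deg: "degree (plane f v w u) = q + 1"
  proof (rule antisym)
    show "degree (plane f v w u) \<le> q + 1"
      using q_ge_2 by (intro degree_le) (auto simp: P coeff_pCons split: nat.splits)
    show "q + 1 \<le> degree (plane f v w u)"
      using assms top by (intro le_degree) auto
  qed
  show "lead_coeff (plane f v w u) = [:eval f u:]"
    unfolding deg by (rule top)
qed

text \<open>The restriction of \<open>f\<close> has a constant leading coefficient in \<open>t\<close>, so it may be divided off. The
  coefficients of the remainder are polynomials in \<open>s\<close> with infinitely many zeros.\<close>

lemma plane_dvd:
  assumes u: "eval f u \<noteq> 0"
    and inf: "infinite {s. \<forall>t. eval f (v + s *s w + t *s u) = 0 \<longrightarrow> eval H (v + s *s w + t *s u) = 0}"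
  shows "\<exists>c Q. c \<noteq> 0 \<and> Polynomial.smult [:c:] (plane H v w u ^ (q + 1)) = plane f v w u * Q"
proof -
  let ?F = "plane f v w u" and ?H = "plane H v w u ^ (q + 1)"
  have F0: "?F \<noteq> 0"
    using degree_plane_f(1)[OF u, of v w] by auto
  obtain Q R where QR: "pseudo_divmod ?H ?F = (Q, R)" by force
  \<comment> \<open>The factor by which pseudo-division scales the dividend: a power of the leading
    coefficient, hence a nonzero constant.\<close>
  define c where "c = eval f u ^ (Suc (degree ?H) - degree ?F)"
  have c0: "c \<noteq> 0" using u by (simp add: c_def)
  have "[:eval f u:] ^ m = [:eval f u ^ m:]" for m
    using hom_power[OF is_hom_const_poly, of "eval f u" m] by simp
  then have eq: "Polynomial.smult [:c:] ?H = ?F * Q + R"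
    using pseudo_divmod(1)[OF F0 QR] degree_plane_f(2)[OF u, of v w] by (simp add: c_def)
  have degR: "R = 0 \<or> degree R < q + 1"
    using pseudo_divmod(2)[OF F0 QR] degree_plane_f(1)[OF u, of v w] by simp
  \<comment> \<open>For each such s the remainder has degree below q + 1 in t, yet it is divisible
    by the restriction of \<open>f\<close>, which has degree q + 1.\<close>
  have R0: "map_poly (\<lambda>c. poly c s) R = 0"
    if s: "\<forall>t. eval f (v + s *s w + t *s u) = 0 \<longrightarrow> eval H (v + s *s w + t *s u) = 0" for s
  proof -
    let ?m = "map_poly (\<lambda>c. poly c s)" and ?x = "v + s *s w"
    have hom: "is_hom ?m" by (rule is_hom_map_poly[OF is_hom_poly])
    have "Polynomial.smult [:c:] ?H = [:[:c:]:] * ?H" by simp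
    then have "[:c:] * line H ?x u ^ (q + 1) = line f ?x u * ?m Q + ?m R"
      using arg_cong[OF eq, of ?m]
      by (simp only: hom_mult[OF hom] hom_add[OF hom] hom_power[OF hom] map_poly_plane)
        (simp add: map_poly_pCons)
    moreover have "line f ?x u \<noteq> 0"
      using degree_line_f[OF u, of ?x] by auto
    then have "line f ?x u dvd line H ?x u ^ (q + 1)"
      using dvd_power_if_roots_subset[of "line f ?x u" "line H ?x u"] s degree_line_f[OF u, of ?x]
      by (auto simp: poly_line)
    ultimately have "line f ?x u dvd ?m R"
      by (metis dvd_add_times_triv_left_iff dvd_mult mult.commute)
    moreover have "degree (?m R) < q + 1"
      using degR map_poly_degree_leq[of "\<lambda>c. poly c s" R] by auto
    ultimately show ?thesis
      using degree_line_f[OF u, of ?x] by (metis dvd_imp_degree_le not_le)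
  qed
  have "R = 0"
  proof (rule poly_eqI)
    fix i
    have "infinite {s. poly (Polynomial.coeff R i) s = 0}"
    proof (rule infinite_super[OF _ inf], safe)
      fix s assume "\<forall>t. eval f (v + s *s w + t *s u) = 0 \<longrightarrow> eval H (v + s *s w + t *s u) = 0"
      from R0[OF this] have "Polynomial.coeff (map_poly (\<lambda>c. poly c s) R) i = 0" by simp
      then show "poly (Polynomial.coeff R i) s = 0" by (simp add: coeff_map_poly)
    qed
    then show "Polynomial.coeff R i = Polynomial.coeff 0 i"
      using poly_eq_0_if_infinite_zeros by auto
  qed
  with eq c0 show ?thesis by auto
qed

text \<open>A substitute for a dense open set: it contains all but finitely many points of every line through
  one of its points.\<close>

definition root_locus :: "'k ^ 'n \<Rightarrow> ('n, 'k) mpoly \<Rightarrow> ('k ^ 'n) set"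
  where "root_locus u H = {x. \<exists>t. eval f (x + t *s u) = 0 \<and> eval H (x + t *s u) \<noteq> 0}"

text \<open>With infinitely many bad s, \<open>plane_dvd\<close> would give divisibility on the
  whole plane; specialising to s = 0 then forces \<open>H\<close> to vanish at every zero of
  \<open>f\<close> on the line x + t u, against the choice of x.\<close>

lemma finite_line_diff_root_locus:
  assumes u: "eval f u \<noteq> 0" and x: "x \<in> root_locus u H"
  shows "finite {s. x + s *s w \<notin> root_locus u H}"
proof (rule ccontr)
  assume "infinite {s. x + s *s w \<notin> root_locus u H}"
  then have "infinite {s. \<forall>t. eval f (x + s *s w + t *s u) = 0 \<longrightarrow> eval H (x + s *s w + t *s u) = 0}"
    by (simp add: root_locus_def)
  from plane_dvd[OF u this] obtain c Q
    where c: "c \<noteq> 0" "Polynomial.smult [:c:] (plane H x w u ^ (q + 1)) = plane f x w u * Q" by blast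
  let ?m = "map_poly (\<lambda>c. poly c 0)"
  have hom: "is_hom ?m" by (rule is_hom_map_poly[OF is_hom_poly])
  have "[:[:c:]:] * plane H x w u ^ (q + 1) = plane f x w u * Q"
    using c(2) by simp
  from arg_cong[OF this, of ?m]
  have eq: "[:c:] * line H x u ^ (q + 1) = line f x u * ?m Q"
    by (simp only: hom_mult[OF hom] hom_power[OF hom] map_poly_plane) (simp add: map_poly_pCons)
  obtain t where t: "eval f (x + t *s u) = 0" "eval H (x + t *s u) \<noteq> 0"
    using x by (auto simp: root_locus_def)
  from arg_cong[OF eq, of "\<lambda>p. poly p t"] show False
    using t c(1) by (simp add: poly_line)
qed

text \<open>An elementary form of the irreducibility of affine space: a point good for
  \<open>S\<close> and a point good for \<open>H\<close> are joined by a line on which only finitely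
  many points are bad.\<close>

lemma Inter_root_locus_nonempty:
  assumes u: "eval f u \<noteq> 0" and "finite S" "\<And>H. H \<in> S \<Longrightarrow> \<exists>v. eval f v = 0 \<and> eval H v \<noteq> 0"
  shows "\<exists>x. \<forall>H\<in>S. x \<in> root_locus u H"
  using assms(2,3)
proof (induction S)
  case (insert H S)
  obtain x where x: "\<forall>H\<in>S. x \<in> root_locus u H"
    using insert by blast
  obtain v where "eval f v = 0" "eval H v \<noteq> 0"
    using insert.prems by blast
  then have v: "v \<in> root_locus u H"
    unfolding root_locus_def by (auto intro!: exI[of _ 0])
  let ?B = "\<lambda>y z H. {s. y + s *s (z - y) \<notin> root_locus u H}"
  have "finite (?B v x H)"
    by (rule finite_line_diff_root_locus[OF u v])
  \<comment> \<open>Reversing the parameter moves the base point from \<open>v\<close>, which is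
    good for \<open>H\<close>, to \<open>x\<close>.\<close>
  moreover have "?B x v H \<subseteq> (\<lambda>s. 1 - s) ` ?B v x H"
  proof
    fix s assume "s \<in> ?B x v H"
    moreover have "v + (1 - s) *s (x - v) = x + s *s (v - x)"
      by (simp add: vec_eq_iff algebra_simps)
    ultimately have "1 - s \<in> ?B v x H" by simp
    then show "s \<in> (\<lambda>s. 1 - s) ` ?B v x H"
      by (intro image_eqI[of _ _ "1 - s"]) auto
  qed
  ultimately have "finite (?B x v H)"
    by (meson finite_imageI finite_subset)
  moreover have "finite (?B x v G)" if "G \<in> S" for G
    using that x finite_line_diff_root_locus[OF u] by blast
  ultimately have "finite (\<Union>G\<in>insert H S. ?B x v G)"
    using insert.hyps by blast
  then obtain s where "s \<notin> (\<Union>G\<in>insert H S. ?B x v G)"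
    using infinite_UNIV_alg_closed_field ex_new_if_finite by blast
  then show ?case by blast
qed simp

text \<open>A single line serves all members at once; sending each of them to a root of
  \<open>f\<close> where it is nonzero is injective by orthogonality.\<close>

lemma card_orthogonal_le:
  assumes u: "eval f u \<noteq> 0" and fin: "finite S"
    and nz: "\<And>H. H \<in> S \<Longrightarrow> \<exists>v. eval f v = 0 \<and> eval H v \<noteq> 0"
    and orth: "\<And>G H v. G \<in> S \<Longrightarrow> H \<in> S \<Longrightarrow> G \<noteq> H \<Longrightarrow> eval f v = 0 \<Longrightarrow> eval G v * eval H v = 0"
  shows "card S \<le> q + 1"
proof -
  obtain x where x: "\<forall>H\<in>S. x \<in> root_locus u H"
    using Inter_root_locus_nonempty[OF u fin nz] by blast
  then have "\<forall>H\<in>S. \<exists>t. eval f (x + t *s u) = 0 \<and> eval H (x + t *s u) \<noteq> 0"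
    by (simp add: root_locus_def)
  then obtain t where t: "\<And>H. H \<in> S \<Longrightarrow> eval f (x + t H *s u) = 0 \<and> eval H (x + t H *s u) \<noteq> 0"
    by metis
  have nz: "line f x u \<noteq> 0"
    using degree_line_f[OF u, of x] by auto
  have "inj_on t S"
  proof (rule inj_onI)
    fix G H assume *: "G \<in> S" "H \<in> S" "t G = t H"
    show "G = H"
      using orth[OF *(1,2), of "x + t G *s u"] t[OF *(1)] t[OF *(2)] *(3) by auto
  qed
  then have "card S = card (t ` S)"
    by (simp add: card_image)
  also have "\<dots> \<le> card {s. poly (line f x u) s = 0}"
    using t by (intro card_mono poly_roots_finite[OF nz]) (auto simp: poly_line)
  also have "\<dots> \<le> q + 1"
    using card_poly_roots_bound[OF nz] degree_line_f[OF u, of x] by simp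
  finally show ?thesis .
qed

lemma exists_nonzero_value: "\<exists>u. eval f u \<noteq> 0"
proof (rule ccontr)
  assume "\<not> ?thesis"
  then have zero: "eval f v = 0" for v by blast
  have "(1 :: 'k ^ 'n) \<noteq> 0" by simp
  then obtain w where w: "form 1 w \<noteq> 0" using form_nonzero by blast
  have "line f 1 w = 0"
    by (rule poly_eq_0_if_infinite_zeros)
      (simp add: poly_line zero infinite_UNIV_alg_closed_field)
  \<comment> \<open>Since q \<ge> 2, the linear coefficient \<open>form 1 w\<close> does not mix
    with the terms of exponents q and q + 1.\<close>
  then have "Polynomial.coeff (line f 1 w) 1 = 0" by simp
  then show False
    using w q_ge_2 by (auto simp: line_f coeff_pCons split: nat.splits)
qed

text \<open>Two demands on u: \<open>eval f u\<close> nonzero for the division in t, and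
  \<open>form v u\<close> nonzero as the derivative in the Hensel argument. Each excludes only
  finitely many points of the line x + s y.\<close>

lemma exists_transversal_direction:
  assumes "v \<noteq> 0"
  shows "\<exists>u. eval f u \<noteq> 0 \<and> form v u \<noteq> 0"
proof -
  obtain x where x: "eval f x \<noteq> 0" using exists_nonzero_value by blast
  obtain y where y: "form v y \<noteq> 0" using form_nonzero[OF assms] by blast
  have "line f x y \<noteq> 0"
    using x poly_line[of f x y 0] by auto
  then have "finite {s. poly (line f x y) s = 0}" by (rule poly_roots_finite)
  moreover have "finite {s. poly [:form v x, form v y:] s = 0}"
    using y by (intro poly_roots_finite) auto
  ultimately have "finite ({s. poly (line f x y) s = 0} \<union> {s. poly [:form v x, form v y:] s = 0})"
    by blast
  then obtain s where "s \<notin> {s. poly (line f x y) s = 0} \<union> {s. poly [:form v x, form v y:] s = 0}"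
    using infinite_UNIV_alg_closed_field ex_new_if_finite by blast
  then show ?thesis
    by (intro exI[of _ "x + s *s y"]) (auto simp: poly_line form_add_scale)
qed

end


section \<open>Tangent lines\<close>

lemma poly_minus_poly_0_dvd: "\<phi> dvd poly P \<phi> - poly P 0" for P :: "'r::comm_ring_1 poly"
  by (cases P) simp

lemma is_hom_pcompose: "is_hom (\<lambda>P :: 'r::comm_ring_1 poly. pcompose P L)"
  by (rule is_homI) (simp_all add: pcompose_1 pcompose_add pcompose_mult)

lemma pcompose_monom: "pcompose (Polynomial.monom a m) L = [:a:] * L ^ m" for L :: "'r::comm_ring_1 poly"
  by (simp add: monom_altdef pcompose_smult hom_power[OF is_hom_pcompose] pcompose_pCons)

context frobenius_hypersurface
begin

text \<open>Newton iteration with the constant slope \<beta>: subtracting the current value divided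
  by \<beta> cancels the leading error, and additivity of the q-th power makes the new error
  explicit. Each step gains one factor of s.\<close>

lemma hensel_approximation:
  fixes \<beta> :: 'k and E \<gamma> G \<delta> :: "'k poly"
  assumes "\<beta> \<noteq> 0"
  shows "\<exists>\<phi>. [:0, 1:] ^ q dvd \<phi> \<and> [:0, 1:] ^ N dvd
    [:0, 1:] ^ q * E + \<phi> * ([:\<beta>:] + [:0, 1:] ^ q * \<gamma>) + \<phi> ^ q * G + \<phi> ^ (q + 1) * \<delta>"
proof (induction N)
  case 0
  show ?case by (intro exI[of _ 0]) simp
next
  case (Suc N)
  let ?s = "[:0, 1:] :: 'k poly"
  define \<Phi> where "\<Phi> \<phi> = ?s ^ q * E + \<phi> * ([:\<beta>:] + ?s ^ q * \<gamma>) + \<phi> ^ q * G + \<phi> ^ (q + 1) * \<delta>" for \<phi>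
  show ?case
  proof (cases "Suc N \<le> q")
    case True
    \<comment> \<open>Up to order q the zero solution suffices. Corrections begin only once N \<ge>
      q, so they are divisible by s^q.\<close>
    then have "?s ^ Suc N dvd ?s ^ q * E"
      by (intro dvd_mult2 le_imp_power_dvd)
    moreover have "\<Phi> 0 = ?s ^ q * E"
      using q_ge_2 by (simp add: \<Phi>_def power_0_left)
    ultimately show ?thesis unfolding \<Phi>_def by (metis dvd_0_right)
  next
    case False
    obtain \<phi> where \<phi>: "?s ^ q dvd \<phi>" "?s ^ N dvd \<Phi> \<phi>"
      using Suc unfolding \<Phi>_def by blast
    define \<epsilon> where "\<epsilon> = [:1 / \<beta>:] * \<Phi> \<phi>"
    have \<epsilon>: "?s ^ N dvd \<epsilon>"
      unfolding \<epsilon>_def by (rule dvd_mult[OF \<phi>(2)])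
    have pow: "(\<phi> - \<epsilon>) ^ q = \<phi> ^ q - \<epsilon> ^ q"
      by (rule frobenius_diff) (simp add: char)
    define b where "b = [:\<beta>:]"
    have "b * \<epsilon> = \<Phi> \<phi>"
      using assms by (simp add: \<epsilon>_def b_def)
    moreover have "\<Phi> (\<phi> - \<epsilon>) = \<Phi> \<phi> - b * \<epsilon> +
      (- (\<epsilon> * ?s ^ q) * \<gamma> - \<epsilon> ^ q * G - (\<epsilon> * \<phi> ^ q) * \<delta> - \<epsilon> ^ q * \<phi> * \<delta> + \<epsilon> ^ q * \<epsilon> * \<delta>)"
      unfolding \<Phi>_def b_def[symmetric] power_add power_one_right pow by (simp add: algebra_simps)
    ultimately have eq: "\<Phi> (\<phi> - \<epsilon>) =
      - (\<epsilon> * ?s ^ q) * \<gamma> - \<epsilon> ^ q * G - (\<epsilon> * \<phi> ^ q) * \<delta> - \<epsilon> ^ q * \<phi> * \<delta> + \<epsilon> ^ q * \<epsilon> * \<delta>"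
      by simp
    have s: "?s dvd ?s ^ q"
      using q_ge_2 by (intro dvd_power) auto
    have "\<phi> dvd \<phi> ^ q"
      using q_ge_2 by (intro dvd_power) auto
    then have "?s dvd \<phi> ^ q"
      using dvd_trans[OF s \<phi>(1)] dvd_trans by blast
    then have 1: "?s ^ Suc N dvd \<epsilon> * ?s ^ q" "?s ^ Suc N dvd \<epsilon> * \<phi> ^ q"
      unfolding power_Suc2 by (intro mult_dvd_mono \<epsilon> s; assumption)+
    \<comment> \<open>Here N \<ge> q \<ge> 2, so N q \<ge> N + 1 and the q-th power of the
      correction gains a factor of s.\<close>
    have "N * 2 \<le> N * q" using q_ge_2 by simp
    then have "Suc N \<le> N * q" using False q_ge_2 by linarith
    then have "?s ^ Suc N dvd (?s ^ N) ^ q"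
      unfolding power_mult[symmetric] by (rule le_imp_power_dvd)
    then have 2: "?s ^ Suc N dvd \<epsilon> ^ q"
      using dvd_power_same[OF \<epsilon>] dvd_trans by blast
    have "?s ^ Suc N dvd \<Phi> (\<phi> - \<epsilon>)"
      unfolding eq using 1 2 by (intro dvd_add dvd_diff) (auto intro: dvd_mult2)
    moreover have "?s ^ q dvd \<phi> - \<epsilon>"
      using \<phi>(1) \<epsilon> False le_imp_power_dvd[of q N ?s] by (intro dvd_diff) (auto intro: dvd_trans)
    ultimately show ?thesis unfolding \<Phi>_def by blast
  qed
qed

text \<open>Along a tangent line \<open>v + s w\<close>, the equation \<open>f (v + s w + t u) = 0\<close> has, up to arbitrarily high order, a solution
  \<open>t = \<phi>(s)\<close> divisible by \<open>s\<^sup>q\<close>, so \<open>H (v + s w) \<equiv> H (v + s w + \<phi>(s) u) \<equiv> 0\<close> modulo \<open>s\<^sup>q\<close>.\<close>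

lemma tangent_line_dvd:
  assumes v: "eval f v = 0" "v \<noteq> 0" and w: "form v w = 0"
    and H: "\<And>v. eval f v = 0 \<Longrightarrow> eval H v = 0"
  shows "[:0, 1:] ^ q dvd line H v w"
proof -
  let ?s = "[:0, 1:] :: 'k poly"
  obtain u where u: "eval f u \<noteq> 0" "form v u \<noteq> 0"
    using exists_transversal_direction[OF v(2)] by blast
  have "infinite {s. \<forall>t. eval f (v + s *s w + t *s u) = 0 \<longrightarrow> eval H (v + s *s w + t *s u) = 0}"
    using H infinite_UNIV_alg_closed_field by simp
  from plane_dvd[OF u(1) this] obtain c Q
    where c: "c \<noteq> 0" "Polynomial.smult [:c:] (plane H v w u ^ (q + 1)) = plane f v w u * Q" by blast
  let ?c = "\<lambda>c :: 'k. [:c:]"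
  let ?C = "\<lambda>v i. [:v $ i:] :: 'k poly"
  let ?X = "\<lambda>i. ?C v i + ?s * ?C w i"
  have *: "bil ?c (?C x) (?C y) = [:form x y:]" for x y
    using hom_bil[OF is_hom_const_poly, of "\<lambda>c. c" "($) x" "($) y"] by simp
  have ch: "CHAR('k poly) = p" by (simp add: char)
  \<comment> \<open>This is f (v + s w): the constant and linear terms vanish because v lies on the
    cone and w is tangent at v.\<close>
  have XX: "bil ?c ?X ?X = ?s ^ q * ([:form w v:] + ?s * [:form w w:])"
    using v(1) w unfolding bil_expand[OF ch] * eval_f by (simp add: algebra_simps)
  have XU: "bil ?c ?X (?C u) = [:form v u:] + ?s ^ q * [:form w u:]"
    unfolding bil_add_left[OF ch] * by simp
  \<comment> \<open>The divisibility will be one of an \<open>H\<close>-value raised to the power q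
    + 1; precision q (q + 1) leaves order q after the root is taken.\<close>
  obtain \<phi> where \<phi>: "?s ^ q dvd \<phi>" "?s ^ (q * (q + 1)) dvd
      ?s ^ q * ([:form w v:] + ?s * [:form w w:]) + \<phi> * ([:form v u:] + ?s ^ q * [:form w u:])
      + \<phi> ^ q * bil ?c (?C u) ?X + \<phi> ^ (q + 1) * bil ?c (?C u) (?C u)"
    using hensel_approximation[OF u(2), of "q * (q + 1)" "[:form w v:] + ?s * [:form w w:]" "[:form w u:]"
        "bil ?c (?C u) ?X" "bil ?c (?C u) (?C u)"] by (elim exE conjE)
  have plane_at: "poly (plane H v w u) \<phi> = eval_hom ?c (\<lambda>i. ?X i + \<phi> * ?C u i) H" for H
    unfolding poly_plane by simp
  have "poly (plane f v w u) \<phi> = bil ?c ?X ?X + \<phi> * bil ?c ?X (?C u) + \<phi> ^ q * bil ?c (?C u) ?X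
    + \<phi> ^ (q + 1) * bil ?c (?C u) (?C u)"
    unfolding plane_at eval_hom_f[OF is_hom_const_poly] by (rule bil_expand[OF ch])
  then have "?s ^ (q * (q + 1)) dvd poly (plane f v w u) \<phi>"
    using \<phi>(2) unfolding XX XU by simp
  then have "?s ^ (q * (q + 1)) dvd [:1 / c:] * poly (plane f v w u * Q) \<phi>"
    by (simp del: mult_pCons_left)
  also have "[:1 / c:] * poly (plane f v w u * Q) \<phi> = poly (plane H v w u) \<phi> ^ (q + 1)"
    using c(1) unfolding c(2)[symmetric] by simp
  finally have "?s ^ q dvd poly (plane H v w u) \<phi>"
    by (rule X_power_dvd_power_cancel) simp
  moreover have "?s ^ q dvd poly (plane H v w u) \<phi> - line H v w"
    using poly_minus_poly_0_dvd[of \<phi> "plane H v w u"] \<phi>(1)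
    unfolding poly_plane_0 by (rule dvd_trans[rotated])
  ultimately have "?s ^ q dvd poly (plane H v w u) \<phi> - (poly (plane H v w u) \<phi> - line H v w)"
    by (rule dvd_diff)
  then show ?thesis by simp
qed

text \<open>A tangent vector at v that moves only the coordinates i and j. Coordinate i moves with
  speed \<open>grad v j\<close>, which is why this partial derivative has to be nonzero in what
  follows.\<close>

definition tangent :: "'n \<Rightarrow> 'n \<Rightarrow> 'k ^ 'n \<Rightarrow> 'k ^ 'n"
  where "tangent j i v = grad v j *s axis i 1 - grad v i *s axis j 1"

lemma tangent_nth:
  "i \<noteq> j \<Longrightarrow> tangent j i v $ i = grad v j"
  "l \<noteq> i \<Longrightarrow> l \<noteq> j \<Longrightarrow> tangent j i v $ l = 0"
  by (auto simp: tangent_def axis_def)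

lemma form_tangent: "form v (tangent j i v) = 0"
proof -
  have "form v (tangent j i v) = (\<Sum>l\<in>UNIV. grad v l * (grad v j * axis i 1 $ l) - grad v l * (grad v i * axis j 1 $ l))"
    unfolding form_grad tangent_def by (simp add: algebra_simps)
  also have "\<dots> = 0"
    by (simp add: axis_def sum_subtractf if_distrib[of "\<lambda>x. _ * x"] cong: if_cong)
  finally show ?thesis .
qed

text \<open>Constant to order \<open>q\<close> along the tangent directions that move only the coordinates \<open>i\<close> and \<open>j\<close>.\<close>

definition tangent_const :: "'n \<Rightarrow> 'n \<Rightarrow> ('n, 'k) mpoly \<Rightarrow> bool"
  where "tangent_const j i K \<longleftrightarrow> (\<forall>v. [:0, 1:] ^ q dvd line K v (tangent j i v) - [:eval K v:])"

lemma tangent_const_mult: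
  assumes "tangent_const j i K" "tangent_const j i L"
  shows "tangent_const j i (K * L)"
  unfolding tangent_const_def
proof
  fix v
  let ?l = "\<lambda>K. line K v (tangent j i v)" and ?e = "\<lambda>K. [:eval K v:]"
  have "?l (K * L) - ?e (K * L) = (?l K - ?e K) * ?l L + ?e K * (?l L - ?e L)"
    by (simp add: hom_mult[OF is_hom_line] eval_mult algebra_simps)
  then show "[:0, 1:] ^ q dvd ?l (K * L) - ?e (K * L)"
    using assms unfolding tangent_const_def
    by (metis dvd_add dvd_mult dvd_mult2)
qed

lemma tangent_const_sum:
  assumes "\<And>a. a \<in> S \<Longrightarrow> tangent_const j i (K a)"
  shows "tangent_const j i (sum K S)"
  unfolding tangent_const_def
proof
  fix v
  let ?l = "\<lambda>K. line K v (tangent j i v)" and ?e = "\<lambda>K. [:eval K v:]"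
  have "?l (sum K S) - ?e (sum K S) = (\<Sum>a\<in>S. ?l (K a) - ?e (K a))"
    by (simp add: hom_sum[OF is_hom_line] eval_sum hom_sum[OF is_hom_const_poly] sum_subtractf)
  then show "[:0, 1:] ^ q dvd ?l (sum K S) - ?e (sum K S)"
    using assms unfolding tangent_const_def by (simp add: dvd_sum)
qed

lemma tangent_const_1: "tangent_const j i 1"
  by (simp add: tangent_const_def hom_one[OF is_hom_line] eval_1 one_pCons)

lemma tangent_const_power: "tangent_const j i K \<Longrightarrow> tangent_const j i (K ^ m)"
  by (induction m) (auto intro: tangent_const_1 tangent_const_mult)

lemma tangent_const_prod:
  "(\<And>a. a \<in> S \<Longrightarrow> tangent_const j i (K a)) \<Longrightarrow> tangent_const j i (prod K S)"
  by (induction S rule: infinite_finite_induct) (auto intro: tangent_const_1 tangent_const_mult)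

lemma line_Var: "line (Var l) v w = [:v $ l, w $ l:]"
  by (simp add: line_def eval_hom_Var[OF is_hom_const_poly])

lemma tangent_const_Var: "l \<noteq> i \<Longrightarrow> l \<noteq> j \<Longrightarrow> tangent_const j i (Var l)"
  by (simp add: tangent_const_def line_Var eval_Var tangent_nth)

text \<open>Along the line \<open>G\<close> differs from its value at s = 0 by a multiple of s, and
  the q-th power of this difference is the difference of the q-th powers.\<close>

lemma tangent_const_frobenius: "tangent_const j i (G ^ q)"
  unfolding tangent_const_def
proof
  fix v
  let ?l = "line G v (tangent j i v)"
  have "line (G ^ q) v (tangent j i v) - [:eval (G ^ q) v:] = (?l - [:eval G v:]) ^ q"
    by (simp add: hom_power[OF is_hom_line] eval_power frobenius_diff char hom_power[OF is_hom_const_poly])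
  moreover have "poly ?l 0 = eval G v"
    by (simp add: poly_line)
  then have "[:0, 1:] dvd ?l - [:eval G v:]"
    using poly_eq_0_iff_dvd[of "?l - [:eval G v:]" 0] by simp
  ultimately show "[:0, 1:] ^ q dvd line (G ^ q) v (tangent j i v) - [:eval (G ^ q) v:]"
    by (simp add: dvd_power_same)
qed

text \<open>Modulo s^q the coefficients are frozen along the tangent line, while x_i becomes a
  linear polynomial in s with slope \<open>grad v j\<close>. The relation turns into a polynomial of
  degree below q divisible by s^q, hence zero, and a substitution of nonzero slope is
  injective.\<close>

lemma tangent_independent_single:
  assumes ij: "i \<noteq> j"
    and C: "\<And>m. m < q \<Longrightarrow> tangent_const j i (C m)"
    and zero: "\<And>v. eval f v = 0 \<Longrightarrow> grad v j \<noteq> 0 \<Longrightarrow> (\<Sum>m<q. eval (C m) v * v $ i ^ m) = 0"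
    and v: "eval f v = 0" "grad v j \<noteq> 0" and m: "m < q"
  shows "eval (C m) v = 0"
proof -
  let ?s = "[:0, 1:] :: 'k poly"
  let ?H = "\<Sum>m<q. C m * Var i ^ m" and ?w = "tangent j i v"
  have v0: "v \<noteq> 0"
    using v(2) q_ge_2 by (auto simp: grad_def power_0_left)
  \<comment> \<open>The relation is given only where \<open>grad v j\<close> is nonzero. The factor
    \<open>partial j f\<close> extends it to the whole cone and is cancelled afterwards, being
    nonzero at s = 0.\<close>
  have "?s ^ q dvd line (partial j f * ?H) v ?w"
  proof (rule tangent_line_dvd[OF v(1) v0 form_tangent])
    fix x assume "eval f x = 0"
    then show "eval (partial j f * ?H) x = 0"
      using zero[of x] by (cases "grad x j = 0") (auto simp: eval_simps eval_partial)
  qed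
  moreover have "Polynomial.coeff (line (partial j f) v ?w) 0 \<noteq> 0"
    using v(2) poly_line[of "partial j f" v ?w 0] by (simp add: poly_0_coeff_0 eval_partial)
  ultimately have "?s ^ q dvd line ?H v ?w"
    unfolding hom_mult[OF is_hom_line] by (rule X_power_dvd_mult_cancel)
  also have "line ?H v ?w = (\<Sum>m<q. line (C m) v ?w * [:v $ i, grad v j:] ^ m)"
    using ij by (simp add: hom_sum[OF is_hom_line] hom_mult[OF is_hom_line] hom_power[OF is_hom_line]
        line_Var tangent_nth)
  finally have 1: "?s ^ q dvd (\<Sum>m<q. line (C m) v ?w * [:v $ i, grad v j:] ^ m)" .
  have 2: "?s ^ q dvd (\<Sum>m<q. (line (C m) v ?w - [:eval (C m) v:]) * [:v $ i, grad v j:] ^ m)"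
    using C by (intro dvd_sum dvd_mult2) (auto simp: tangent_const_def)
  define P where "P = (\<Sum>m<q. Polynomial.monom (eval (C m) v) m)"
  let ?L = "[:v $ i, grad v j:]"
  have P: "pcompose P ?L = (\<Sum>m<q. [:eval (C m) v:] * ?L ^ m)"
    unfolding P_def pcompose_sum
    by (simp only: pcompose_monom)
  have "?s ^ q dvd pcompose P ?L"
    using dvd_diff[OF 1 2] unfolding P by (simp add: sum_subtractf[symmetric] algebra_simps)
  moreover have "degree (pcompose P ?L) < q"
  proof -
    have "degree P < q"
      using q_ge_2 unfolding P_def
      by (intro degree_lessI) (auto simp: coeff_sum coeff_monom intro!: sum.neutral)
    then show ?thesis using degree_pcompose_le[of P ?L] v(2) by simp
  qed
  moreover have "degree (?s ^ q) = q"
    by (simp add: degree_power_eq)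
  ultimately have "pcompose P ?L = 0"
    by (metis dvd_imp_degree_le not_le)
  then have "P = 0"
    using v(2) by (intro pcompose_eq_0[of P ?L]) auto
  then have "Polynomial.coeff P m = 0" by simp
  then show ?thesis
    using m unfolding P_def by (simp add: coeff_sum coeff_monom if_distrib cong: if_cong)
qed

end


section \<open>Irreducible components\<close>

text \<open>One variable at a time: the sum is sorted by the exponent of x_i, and each collected
  coefficient involves only \<open>K\<close> and the other variables of \<open>J\<close>, so it is
  still constant along the direction belonging to i.\<close>

lemma (in frobenius_hypersurface) tangent_independent:
  assumes "finite J" "j \<notin> J"
    and "\<And>a i. a \<in> PiE J (\<lambda>_. {..<q}) \<Longrightarrow> i \<in> J \<Longrightarrow> tangent_const j i (K a)"
    and "\<And>v. eval f v = 0 \<Longrightarrow> grad v j \<noteq> 0 \<Longrightarrow>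
      (\<Sum>a\<in>PiE J (\<lambda>_. {..<q}). eval (K a) v * (\<Prod>i\<in>J. v $ i ^ a i)) = 0"
    and "a \<in> PiE J (\<lambda>_. {..<q})" "eval f v = 0" "grad v j \<noteq> 0"
  shows "eval (K a) v = 0"
  using assms
proof (induction J arbitrary: K a v)
  case empty
  then show ?case by simp
next
  case (insert i J)
  let ?E = "PiE J (\<lambda>_. {..<q})"
  let ?u = "\<lambda>m a. a(i := m)"
  define C where "C m = (\<Sum>a\<in>?E. K (?u m a) * (\<Prod>l\<in>J. Var l ^ a l))" for m
  have E: "PiE (insert i J) (\<lambda>_. {..<q}) = (\<lambda>(m, a). ?u m a) ` ({..<q} \<times> ?E)"
    by (rule PiE_insert_eq)
  have inj: "inj_on (\<lambda>(m, a). ?u m a) ({..<q} \<times> ?E)"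
    by (rule inj_combinator[OF insert.hyps(2)])
  have mem: "?u m a \<in> PiE (insert i J) (\<lambda>_. {..<q})" if "m < q" "a \<in> ?E" for m a
    unfolding E using that by auto
  have prod: "(\<Prod>l\<in>J. v $ l ^ ?u m a l) = (\<Prod>l\<in>J. v $ l ^ a l)" for v :: "'k ^ 'n" and m a
    using insert.hyps(2) by (intro prod.cong) auto
  have C_zero: "eval (C m) v = 0" if "eval f v = 0" "grad v j \<noteq> 0" "m < q" for m v
  proof (rule tangent_independent_single[where C = C, OF _ _ _ that])
    show "i \<noteq> j" using insert.prems(1) by auto
    show "tangent_const j i (C m)" if "m < q" for m
      unfolding C_def using insert.prems(1,2) insert.hyps(2) mem[OF that]
      by (intro tangent_const_sum tangent_const_mult tangent_const_prod tangent_const_power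
          tangent_const_Var) auto
    fix v assume v: "eval f v = 0" "grad v j \<noteq> 0"
    have "(\<Sum>m<q. eval (C m) v * v $ i ^ m) =
      (\<Sum>(m, a)\<in>{..<q} \<times> ?E. eval (K (?u m a)) v * (\<Prod>l\<in>J. v $ l ^ a l) * v $ i ^ m)"
      unfolding C_def by (simp add: eval_simps sum_distrib_right sum.cartesian_product)
    also have "\<dots> = (\<Sum>a\<in>PiE (insert i J) (\<lambda>_. {..<q}). eval (K a) v * (\<Prod>i\<in>insert i J. v $ i ^ a i))"
      unfolding E using insert.hyps
      by (subst sum.reindex[OF inj]) (auto intro!: sum.cong simp: prod mult_ac fun_upd_same simp del: fun_upd_apply)
    also have "\<dots> = 0"
      by (rule insert.prems(3)[OF v])
    finally show "(\<Sum>m<q. eval (C m) v * v $ i ^ m) = 0" .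
  qed
  obtain m b where a: "a = ?u m b" "m < q" "b \<in> ?E"
    using insert.prems(4) unfolding E by auto
  have "eval (K (?u m b)) v = 0"
  proof (rule insert.IH[of "\<lambda>b. K (?u m b)"])
    show "j \<notin> J" using insert.prems(1) by simp
    show "tangent_const j l (K (?u m b))" if "b \<in> ?E" "l \<in> J" for b l
      using insert.prems(2) mem[OF a(2) that(1)] that(2) by blast
    show "(\<Sum>b\<in>?E. eval (K (?u m b)) v * (\<Prod>l\<in>J. v $ l ^ b l)) = 0"
      if "eval f v = 0" "grad v j \<noteq> 0" for v
      using C_zero[OF that a(2)] by (simp add: C_def eval_simps)
  qed (use a insert.prems in auto)
  then show ?case unfolding a(1) .
qed

section \<open>Projective points and irreducible closed sets\<close>

lemma mem_point: "v \<in> point v"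
  unfolding point_def by (intro CollectI exI[of _ 1]) auto

lemma point_scale:
  assumes "c \<noteq> 0"
  shows "point (c *s v) = point v"
proof
  show "point (c *s v) \<subseteq> point v"
    using assms by (force simp: point_def)
  show "point v \<subseteq> point (c *s v)"
  proof
    fix x assume "x \<in> point v"
    then obtain b where "x = b *s v" "b \<noteq> 0" by (auto simp: point_def)
    then show "x \<in> point (c *s v)"
      unfolding point_def using assms
      by (intro CollectI exI[of _ "b / c"]) (auto simp: vec_eq_iff)
  qed
qed

lemma point_eqD:
  assumes "point v = point w"
  shows "\<exists>c. c \<noteq> 0 \<and> v = c *s w"
  using mem_point[of v] unfolding assms by (auto simp: point_def)

lemma point_mem_proj_space: "point v \<in> proj_space \<longleftrightarrow> v \<noteq> 0"
proof
  assume "point v \<in> proj_space"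
  then obtain w where "w \<noteq> 0" "point v = point w" by (auto simp: proj_space_def)
  then show "v \<noteq> 0"
    using point_eqD[of v w] by (auto simp: vec_eq_iff)
qed (simp add: proj_space_def)

lemma vanishes_at_point:
  assumes "homogeneous m g"
  shows "vanishes_at g (point v) \<longleftrightarrow> eval g v = 0"
proof
  show "vanishes_at g (point v) \<Longrightarrow> eval g v = 0"
    using mem_point[of v] by (auto simp: vanishes_at_def)
  show "eval g v = 0 \<Longrightarrow> vanishes_at g (point v)"
    by (auto simp: vanishes_at_def point_def eval_homogeneous[OF assms])
qed

lemma zeros_subset_proj_space: "zeros S \<subseteq> proj_space"
  by (auto simp: zeros_def)

lemma irreducible_closed_subset_proj_space: "irreducible_closed Y \<Longrightarrow> Y \<subseteq> proj_space"
  using zeros_subset_proj_space by (auto simp: irreducible_closed_def zariski_closed_def)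

text \<open>The zero sets of g and h cut \<open>Y\<close> into two closed pieces that cover it, so
  one piece is all of \<open>Y\<close>: the ideal of \<open>Y\<close> is prime with respect to
  forms.\<close>

lemma irreducible_closed_prime:
  assumes Y: "irreducible_closed Y" and hom: "homogeneous m g" "homogeneous n h"
    and zero: "\<forall>P\<in>Y. vanishes_at (g * h) P"
  shows "(\<forall>P\<in>Y. vanishes_at g P) \<or> (\<forall>P\<in>Y. vanishes_at h P)"
proof -
  obtain S where S: "\<forall>g\<in>S. \<exists>m. homogeneous m g" "Y = zeros S"
    using Y by (auto simp: irreducible_closed_def zariski_closed_def)
  have closed: "zariski_closed (zeros (insert g S))" "zariski_closed (zeros (insert h S))"
    unfolding zariski_closed_def using S(1) hom by blast+
  have "Y = zeros (insert g S) \<union> zeros (insert h S)"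
  proof
    show "zeros (insert g S) \<union> zeros (insert h S) \<subseteq> Y"
      unfolding S(2) by (auto simp: zeros_def)
    show "Y \<subseteq> zeros (insert g S) \<union> zeros (insert h S)"
    proof
      fix P assume P: "P \<in> Y"
      then obtain v where v: "P = point v"
        using S(2) by (auto simp: zeros_def proj_space_def)
      have "eval g v * eval h v = 0"
        using zero P mem_point[of v] by (auto simp: v vanishes_at_def eval_mult)
      then have "vanishes_at g P \<or> vanishes_at h P"
        unfolding v vanishes_at_point[OF hom(1)] vanishes_at_point[OF hom(2)] by simp
      then show "P \<in> zeros (insert g S) \<union> zeros (insert h S)"
        using P unfolding S(2) by (auto simp: zeros_def)
    qed
  qed
  then have "Y = zeros (insert g S) \<or> Y = zeros (insert h S)"
    using Y closed unfolding irreducible_closed_def by blast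
  then show ?thesis by (auto simp: zeros_def)
qed

lemma irreducible_closed_not_vanishing_prod:
  assumes Y: "irreducible_closed Y" and "finite S"
    and "\<And>i. i \<in> S \<Longrightarrow> \<exists>m. homogeneous m (F i)"
    and "\<And>i. i \<in> S \<Longrightarrow> \<not> (\<forall>P\<in>Y. vanishes_at (F i) P)"
  shows "\<exists>m. homogeneous m (prod F S)" "\<not> (\<forall>P\<in>Y. vanishes_at (prod F S) P)"
proof -
  have "(\<exists>m. homogeneous m (prod F S)) \<and> \<not> (\<forall>P\<in>Y. vanishes_at (prod F S) P)"
    using assms(2-)
  proof (induction S)
    case empty
    obtain P where "P \<in> Y" using Y by (auto simp: irreducible_closed_def)
    moreover from this obtain v where "P = point v"
      using irreducible_closed_subset_proj_space[OF Y] by (auto simp: proj_space_def)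
    ultimately show ?case
      using homogeneous_1 vanishes_at_point[OF homogeneous_1, of v] by (auto simp: eval_1)
  next
    case (insert i S)
    then obtain m n where mn: "homogeneous m (F i)" "homogeneous n (prod F S)" by blast
    have "\<not> (\<forall>P\<in>Y. vanishes_at (F i) P)" "\<not> (\<forall>P\<in>Y. vanishes_at (prod F S) P)"
      using insert by blast+
    then have "\<not> (\<forall>P\<in>Y. vanishes_at (F i * prod F S) P)"
      using irreducible_closed_prime[OF Y mn] by blast
    then show ?case
      unfolding prod.insert[OF insert.hyps] using homogeneous_mult[OF mn] by blast
  qed
  then show "\<exists>m. homogeneous m (prod F S)" "\<not> (\<forall>P\<in>Y. vanishes_at (prod F S) P)" by blast+
qed

context frobenius_hypersurface
begin

lemma homogeneous_f: "homogeneous (q + 1) f"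
  unfolding f_eq by (rule homogeneous_frobenius_poly)

lemma point_mem_hypersurface: "point v \<in> hypersurface f \<longleftrightarrow> v \<noteq> 0 \<and> eval f v = 0"
  by (simp add: hypersurface_def zeros_def point_mem_proj_space vanishes_at_point[OF homogeneous_f])

lemma hypersurface_eq: "hypersurface f = point ` {v. v \<noteq> 0 \<and> eval f v = 0}"
proof -
  have "\<exists>v. P = point v" if "P \<in> hypersurface f" for P
    using that by (auto simp: hypersurface_def zeros_def proj_space_def)
  then show ?thesis using point_mem_hypersurface by blast
qed

text \<open>Vanishing on the affine cone, origin included; lines and planes of coordinate vectors
  meet this set rather than the set of projective points.\<close>

definition cone_zero :: "('n, 'k) mpoly \<Rightarrow> bool"
  where "cone_zero g \<longleftrightarrow> (\<forall>v. eval f v = 0 \<longrightarrow> eval g v = 0)"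

lemma cone_zero_mult: "cone_zero g \<Longrightarrow> cone_zero (h * g)" "cone_zero g \<Longrightarrow> cone_zero (g * h)"
  by (auto simp: cone_zero_def eval_mult)

lemma cone_zero_square: "cone_zero (g * g) \<Longrightarrow> cone_zero g"
  by (auto simp: cone_zero_def eval_mult)

lemma cone_zero_if_vanishing:
  assumes ne: "hypersurface f \<noteq> {}" and hom: "homogeneous m g"
    and zero: "\<forall>P\<in>hypersurface f. vanishes_at g P"
  shows "cone_zero g"
proof -
  have nz: "eval g v = 0" if "v \<noteq> 0" "eval f v = 0" for v
    using zero that by (metis point_mem_hypersurface vanishes_at_point[OF hom])
  \<comment> \<open>At the origin the value is 0^m times the value at an actual zero, which settles
    m = 0 as well. This is where the hypersurface must have a point.\<close>
  moreover obtain v where "v \<noteq> 0" "eval f v = 0"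
    using ne unfolding hypersurface_eq by auto
  then have "eval g 0 = 0"
    using nz[of v] eval_homogeneous[OF hom, of 0 v] by simp
  ultimately show ?thesis unfolding cone_zero_def by metis
qed

text \<open>On a generic line with direction \<open>u\<close>, the members of an orthogonal family are supported on disjoint sets of roots of
  \<open>f\<close>, so the family is finite; the members of a maximal family single out the irreducible components.
  This replaces the Noetherian decomposition.\<close>

definition orthogonal :: "('n, 'k) mpoly set \<Rightarrow> bool"
  where "orthogonal S \<longleftrightarrow> finite S \<and> (\<forall>h\<in>S. (\<exists>m. homogeneous m h) \<and> \<not> cone_zero h) \<and>
    (\<forall>g\<in>S. \<forall>h\<in>S. g \<noteq> h \<longrightarrow> cone_zero (g * h))"

lemma card_le_if_orthogonal:
  assumes "orthogonal S"
  shows "card S \<le> q + 1"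
proof -
  obtain u where "eval f u \<noteq> 0" using exists_nonzero_value by blast
  then show ?thesis
    by (rule card_orthogonal_le)
      (use assms in \<open>auto simp: orthogonal_def cone_zero_def eval_mult\<close>)
qed

text \<open>The Zariski closure of the part of the hypersurface where \<open>h\<close> is nonzero,
  cut out by the annihilator of \<open>h\<close> modulo forms vanishing on the cone.\<close>

definition support_closure :: "('n, 'k) mpoly \<Rightarrow> ('k ^ 'n) set set"
  where "support_closure h = zeros {a. (\<exists>m. homogeneous m a) \<and> cone_zero (a * h)}"

lemma zariski_closed_support_closure: "zariski_closed (support_closure h)"
  unfolding zariski_closed_def support_closure_def by (intro exI conjI refl) auto

lemma support_closure_subset: "support_closure h \<subseteq> hypersurface f"
proof -
  have "cone_zero (f * h)" by (simp add: cone_zero_def eval_mult)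
  then have "{f} \<subseteq> {a. (\<exists>m. homogeneous m a) \<and> cone_zero (a * h)}"
    using homogeneous_f by blast
  then show ?thesis
    unfolding support_closure_def hypersurface_def zeros_def by blast
qed

lemma point_mem_support_closure:
  assumes "v \<noteq> 0" "eval f v = 0" "eval h v \<noteq> 0"
  shows "point v \<in> support_closure h"
  unfolding support_closure_def zeros_def
proof (intro CollectI conjI ballI)
  show "point v \<in> proj_space" using assms by (simp add: point_mem_proj_space)
  fix a assume "a \<in> {a. (\<exists>m. homogeneous m a) \<and> cone_zero (a * h)}"
  then obtain m where "homogeneous m a" "cone_zero (a * h)" by blast
  then show "vanishes_at a (point v)"
    using assms by (auto simp: vanishes_at_point cone_zero_def eval_mult)
qed

lemma cone_zero_if_vanishing_support_closure:
  assumes ne: "hypersurface f \<noteq> {}" and hom: "homogeneous m a" "homogeneous n h"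
    and zero: "\<forall>P\<in>support_closure h. vanishes_at a P"
  shows "cone_zero (a * h)"
proof (rule cone_zero_if_vanishing[OF ne homogeneous_mult[OF hom]])
  show "\<forall>P\<in>hypersurface f. vanishes_at (a * h) P"
  proof
    fix P assume "P \<in> hypersurface f"
    then obtain v where v: "P = point v" "v \<noteq> 0" "eval f v = 0"
      unfolding hypersurface_eq by blast
    have "eval a v * eval h v = 0"
      using zero point_mem_support_closure[OF v(2,3)] vanishes_at_point[OF hom(1)] by fastforce
    then show "vanishes_at (a * h) P"
      unfolding v(1) vanishes_at_point[OF homogeneous_mult[OF hom]] eval_mult .
  qed
qed

text \<open>If the closure splits into two proper closed pieces, forms a and b vanishing on one
  piece each satisfy a b h = 0 on the cone, while a h and b h are nonzero there. Replacing
  \<open>h\<close> by these two products enlarges the orthogonal family beyond the maximum.\<close>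

lemma irreducible_support_closure:
  assumes ne: "hypersurface f \<noteq> {}" and S: "orthogonal S"
    and max: "\<And>T. orthogonal T \<Longrightarrow> card T \<le> card S" and h: "h \<in> S"
  shows "irreducible_closed (support_closure h)"
  unfolding irreducible_closed_def
proof (intro conjI allI impI)
  obtain n where hom: "homogeneous n h" and h0: "\<not> cone_zero h"
    using S h by (auto simp: orthogonal_def)
  show "zariski_closed (support_closure h)" by (rule zariski_closed_support_closure)
  show "support_closure h \<noteq> {}"
  proof
    assume "support_closure h = {}"
    then have "cone_zero (1 * h)"
      by (intro cone_zero_if_vanishing_support_closure[OF ne homogeneous_1 hom]) auto
    with h0 show False by simp
  qed
  fix Z Z' assume Z: "zariski_closed Z" "zariski_closed Z'" "support_closure h = Z \<union> Z'"
  show "support_closure h = Z \<or> support_closure h = Z'"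
  proof (rule ccontr)
    assume contr: "\<not> ?thesis"
    have sep: "\<exists>a m. homogeneous m a \<and> \<not> cone_zero (a * h) \<and> (\<forall>P\<in>W. vanishes_at a P)"
      if W: "zariski_closed W" "W \<subseteq> support_closure h" "support_closure h \<noteq> W" for W
    proof -
      obtain T where T: "\<forall>g\<in>T. \<exists>m. homogeneous m g" "W = zeros T"
        using W(1) by (auto simp: zariski_closed_def)
      obtain P where P: "P \<in> support_closure h" "P \<notin> W" using W by blast
      then obtain a where a: "a \<in> T" "\<not> vanishes_at a P"
        using T(2) by (auto simp: zeros_def support_closure_def)
      then have "\<not> cone_zero (a * h)"
        using P(1) T(1) by (auto simp: zeros_def support_closure_def)
      moreover have "\<forall>P\<in>W. vanishes_at a P"
        using a(1) by (auto simp: T(2) zeros_def)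
      ultimately show ?thesis using a(1) T(1) by blast
    qed
    obtain a k where a: "homogeneous k a" "\<not> cone_zero (a * h)" "\<forall>P\<in>Z. vanishes_at a P"
      using sep[OF Z(1)] Z(3) contr by blast
    obtain b l where b: "homogeneous l b" "\<not> cone_zero (b * h)" "\<forall>P\<in>Z'. vanishes_at b P"
      using sep[OF Z(2)] Z(3) contr by blast
    have "\<forall>P\<in>support_closure h. vanishes_at (a * b) P"
      using a(3) b(3) unfolding Z(3) by (auto simp: vanishes_at_def eval_mult)
    then have abh: "cone_zero (a * b * h)"
      by (rule cone_zero_if_vanishing_support_closure[OF ne homogeneous_mult[OF a(1) b(1)] hom])
    define T where "T = insert (a * h) (insert (b * h) (S - {h}))"
    have ab: "cone_zero (a * h * (b * h))"
      using abh by (auto simp: cone_zero_def eval_mult)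
    have orth: "cone_zero (g * g')" if "g \<in> S" "g' \<in> S" "g \<noteq> g'" for g g'
      using S[unfolded orthogonal_def, THEN conjunct2, THEN conjunct2] that by simp
    have hg: "cone_zero (h * g)" if "g \<in> S - {h}" for g
      by (rule orth[OF h]) (use that in auto)
    then have cg: "cone_zero (c * h * g)" "cone_zero (g * (c * h))" if "g \<in> S - {h}" for g c
      using that by (auto simp: cone_zero_def eval_mult)
    \<comment> \<open>A coincidence would make a product zero on the cone into a square, so the form
      itself would vanish there.\<close>
    have neq: "a * h \<noteq> b * h"
      using ab a(2) cone_zero_square by metis
    have notin: "a * h \<notin> S - {h}" "b * h \<notin> S - {h}"
      using cg a(2) b(2) cone_zero_square by metis+
    have "orthogonal T"
      unfolding orthogonal_def
    proof (intro conjI ballI impI)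
      show "finite T" using S by (simp add: T_def orthogonal_def)
      show "\<exists>m. homogeneous m g" if "g \<in> T" for g
        using that S homogeneous_mult[OF a(1) hom] homogeneous_mult[OF b(1) hom]
        by (auto simp: T_def orthogonal_def)
      show "\<not> cone_zero g" if "g \<in> T" for g
        using that S a(2) b(2) by (auto simp: T_def orthogonal_def)
      show "cone_zero (g * g')" if "g \<in> T" "g' \<in> T" "g \<noteq> g'" for g g'
      proof -
        have ba: "cone_zero (b * h * (a * h))" using ab by (simp add: mult.commute)
        have "g = a * h \<or> g = b * h \<or> g \<in> S - {h}" "g' = a * h \<or> g' = b * h \<or> g' \<in> S - {h}"
          using that(1,2) unfolding T_def by auto
        then show ?thesis
          using that(3) ab ba cg orth by (elim disjE) auto
      qed
    qed
    moreover have "card T = Suc (card S)"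
      using notin neq S h card_gt_0_iff[of S] unfolding T_def orthogonal_def
      by (auto simp: card_Diff_singleton)
    ultimately show False using max by force
  qed
qed

text \<open>Supplies the multiplier that turns vanishing on \<open>Y\<close> into vanishing on the
  whole cone while being nonzero on \<open>Y\<close> itself. It is the member of a maximal
  orthogonal family whose support closure is \<open>Y\<close>.\<close>

lemma component_localization:
  assumes "Y \<in> irreducible_components (hypersurface f)"
  shows "\<exists>h m. homogeneous m h \<and> \<not> (\<forall>P\<in>Y. vanishes_at h P) \<and>
    (\<forall>g k. homogeneous k g \<longrightarrow> (\<forall>P\<in>Y. vanishes_at g P) \<longrightarrow> cone_zero (g * h))"
proof -
  have Y: "irreducible_closed Y" "Y \<subseteq> hypersurface f"
    and Ymax: "\<And>Y'. irreducible_closed Y' \<Longrightarrow> Y' \<subseteq> hypersurface f \<Longrightarrow> Y \<subseteq> Y' \<Longrightarrow> Y' = Y"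
    using assms unfolding irreducible_components_def by auto
  have ne: "hypersurface f \<noteq> {}"
    using Y by (auto simp: irreducible_closed_def)
  have "orthogonal {}" by (simp add: orthogonal_def)
  then obtain S where S: "orthogonal S" and max: "\<And>T. orthogonal T \<Longrightarrow> card T \<le> card S"
    using ex_has_greatest_nat[of orthogonal "{}" card "q + 2"] card_le_if_orthogonal by fastforce
  have "\<exists>h\<in>S. Y \<subseteq> support_closure h"
  proof (rule ccontr)
    assume contr: "\<not> ?thesis"
    have "\<exists>a m. homogeneous m a \<and> cone_zero (a * h) \<and> \<not> (\<forall>P\<in>Y. vanishes_at a P)" if "h \<in> S" for h
      using contr that irreducible_closed_subset_proj_space[OF Y(1)]
      by (fastforce simp: support_closure_def zeros_def)
    \<comment> \<open>The product of these separators annihilates every member of \<open>S\<close>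
      but does not vanish on the irreducible \<open>Y\<close>, so it could be added to the
      family.\<close>
    then obtain F where F: "\<And>h. h \<in> S \<Longrightarrow>
      (\<exists>m. homogeneous m (F h)) \<and> cone_zero (F h * h) \<and> \<not> (\<forall>P\<in>Y. vanishes_at (F h) P)"
      by metis
    have fin: "finite S" using S by (simp add: orthogonal_def)
    obtain m where m: "homogeneous m (prod F S)"
      using irreducible_closed_not_vanishing_prod(1)[OF Y(1) fin] F by metis
    have nv: "\<not> (\<forall>P\<in>Y. vanishes_at (prod F S) P)"
      using irreducible_closed_not_vanishing_prod(2)[OF Y(1) fin] F by metis
    have nz: "\<not> cone_zero (prod F S)"
    proof
      assume z: "cone_zero (prod F S)"
      have "vanishes_at (prod F S) P" if "P \<in> Y" for P
      proof -
        obtain v where "P = point v" "eval f v = 0"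
          using \<open>P \<in> Y\<close> Y(2) unfolding hypersurface_eq by blast
        then show ?thesis using z vanishes_at_point[OF m] by (auto simp: cone_zero_def)
      qed
      with nv show False by blast
    qed
    have z: "cone_zero (prod F S * h)" "cone_zero (h * prod F S)" if "h \<in> S" for h
    proof -
      have "prod F S * h = (prod F (S - {h})) * (F h * h)"
        using that fin by (simp add: prod.remove mult_ac)
      then show "cone_zero (prod F S * h)"
        using F[OF that] by (simp add: cone_zero_mult(1))
      then show "cone_zero (h * prod F S)" by (simp add: mult.commute)
    qed
    have "prod F S \<notin> S"
      using z nz cone_zero_square by blast
    moreover have "orthogonal (insert (prod F S) S)"
      using S m nz z unfolding orthogonal_def by blast
    ultimately show False
      using max[of "insert (prod F S) S"] fin by simp
  qed
  then obtain h where h: "h \<in> S" "Y \<subseteq> support_closure h" by blast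
  have eq: "support_closure h = Y"
    by (rule Ymax[OF irreducible_support_closure[OF ne S max h(1)] support_closure_subset h(2)])
  obtain m where m: "homogeneous m h" "\<not> cone_zero h"
    using S h(1) by (auto simp: orthogonal_def)
  have "cone_zero (g * h)" if "homogeneous k g" "\<forall>P\<in>Y. vanishes_at g P" for g k
    using cone_zero_if_vanishing_support_closure[OF ne that(1) m(1)] that(2) unfolding eq by blast
  \<comment> \<open>If \<open>h\<close> vanished on \<open>Y\<close>, then \<open>h * h\<close>, and
    hence \<open>h\<close>, would vanish on the cone.\<close>
  then show ?thesis
    using m cone_zero_square by blast
qed

end


section \<open>The function field of an irreducible variety\<close>

lemma UN_constant_on:
  "A \<noteq> {} \<Longrightarrow> (\<And>x. x \<in> A \<Longrightarrow> F x = c) \<Longrightarrow> (\<Union>x\<in>A. F x) = c"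
  by auto

locale irreducible_variety =
  fixes Y :: "('k::field ^ 'n::finite) set set"
  assumes irreducible: "irreducible_closed Y"
begin

definition vanishing :: "('n, 'k) mpoly \<Rightarrow> bool"
  where "vanishing g \<longleftrightarrow> (\<forall>v\<in>\<Union>Y. eval g v = 0)"

lemma vanishing_iff: "(\<forall>P\<in>Y. vanishes_at g P) \<longleftrightarrow> vanishing g"
  by (auto simp: vanishing_def vanishes_at_def)

lemma vanishing_prime:
  "homogeneous m g \<Longrightarrow> homogeneous n h \<Longrightarrow> vanishing (g * h) \<Longrightarrow> vanishing g \<or> vanishing h"
  using irreducible_closed_prime[OF irreducible] unfolding vanishing_iff by blast

lemma not_vanishing_1: "\<not> vanishing 1"
  using irreducible_closed_not_vanishing_prod(2)[OF irreducible, of "{}"]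
  unfolding vanishing_iff by simp

lemma not_vanishing_power:
  assumes "homogeneous m g" "\<not> vanishing g"
  shows "\<not> vanishing (g ^ l)"
proof (induction l)
  case (Suc l)
  then show ?case
    using vanishing_prime[OF assms(1) homogeneous_power[OF assms(1)]] assms(2) by auto
qed (simp add: not_vanishing_1)

definition fraction :: "('n, 'k) mpoly \<Rightarrow> ('n, 'k) mpoly \<Rightarrow> bool"
  where "fraction g h \<longleftrightarrow> (\<exists>m. homogeneous m g \<and> homogeneous m h) \<and> \<not> vanishing h"

lemma mem_fractions: "(g, h) \<in> fractions Y \<longleftrightarrow> fraction g h"
  by (simp add: fractions_def fraction_def vanishing_iff)

definition cls :: "('n, 'k) mpoly \<Rightarrow> ('n, 'k) mpoly \<Rightarrow> (('n, 'k) mpoly \<times> ('n, 'k) mpoly) set"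
  where "cls g h = fraction_rel Y `` {(g, h)}"

lemma mem_fraction_rel:
  "((g, h), (g', h')) \<in> fraction_rel Y \<longleftrightarrow> fraction g h \<and> fraction g' h' \<and> vanishing (g * h' - g' * h)"
  by (simp add: fraction_rel_def mem_fractions vanishing_iff)

lemma fraction_mult: "fraction g h \<Longrightarrow> fraction g' h' \<Longrightarrow> fraction (g * g') (h * h')"
  unfolding fraction_def using vanishing_prime homogeneous_mult by blast

lemma fraction_add:
  assumes "fraction g h" "fraction g' h'"
  shows "fraction (g * h' + g' * h) (h * h')"
proof -
  obtain m n where m: "homogeneous m g" "homogeneous m h" and n: "homogeneous n g'" "homogeneous n h'"
    using assms unfolding fraction_def by blast
  have "homogeneous (m + n) (g * h' + g' * h)"
    using homogeneous_mult[OF m(1) n(2)] homogeneous_mult[OF n(1) m(2)]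
    by (intro homogeneous_add) (simp_all add: add.commute)
  then show ?thesis
    using assms vanishing_prime homogeneous_mult[OF m(2) n(2)] m n unfolding fraction_def by blast
qed

lemma fraction_power: "fraction g h \<Longrightarrow> fraction (g ^ l) (h ^ l)"
  unfolding fraction_def using not_vanishing_power homogeneous_power by blast

lemma fraction_0_1: "fraction 0 1"
  unfolding fraction_def using homogeneous_0 homogeneous_1 not_vanishing_1 by blast

lemma fraction_1_1: "fraction 1 1"
  unfolding fraction_def using homogeneous_1 not_vanishing_1 by blast

lemma fraction_uminus: "fraction g h \<Longrightarrow> fraction (0 - g) h"
  unfolding fraction_def using homogeneous_diff homogeneous_0 by blast

lemma equiv_fraction_rel: "equiv (fractions Y) (fraction_rel Y)"
proof (rule equivI)
  show "fraction_rel Y \<subseteq> fractions Y \<times> fractions Y"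
    by (auto simp: mem_fraction_rel mem_fractions)
  show "refl_on (fractions Y) (fraction_rel Y)"
    by (auto simp: refl_on_def mem_fraction_rel mem_fractions vanishing_def eval_simps)
  show "sym (fraction_rel Y)"
    by (auto simp: sym_def mem_fraction_rel vanishing_def eval_simps)
  show "trans (fraction_rel Y)"
  proof (rule transI, clarify)
    fix a b c d a' b'
    assume 1: "((a, b), (c, d)) \<in> fraction_rel Y" and 2: "((c, d), (a', b')) \<in> fraction_rel Y"
    then obtain m n where m: "homogeneous m a" "homogeneous m b" and n: "homogeneous n a'" "homogeneous n b'"
      unfolding mem_fraction_rel fraction_def by blast
    obtain l where l: "homogeneous l d" "\<not> vanishing d"
      using 1 unfolding mem_fraction_rel fraction_def by blast
    have hom: "homogeneous (m + n) (a * b' - a' * b)"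
      using homogeneous_mult[OF m(1) n(2)] homogeneous_mult[OF n(1) m(2)]
      by (intro homogeneous_diff) (simp_all add: add.commute)
    \<comment> \<open>The middle denominator d can be cancelled because vanishing on the irreducible
      \<open>Y\<close> is a prime condition.\<close>
    have "d * (a * b' - a' * b) = b' * (a * d - c * b) + b * (c * b' - a' * d)"
      by (simp add: algebra_simps)
    then have "vanishing (d * (a * b' - a' * b))"
      using 1 2 unfolding mem_fraction_rel vanishing_def by (simp add: eval_add eval_mult)
    then have "vanishing (a * b' - a' * b)"
      using vanishing_prime[OF l(1) hom] l(2) by blast
    then show "((a, b), (a', b')) \<in> fraction_rel Y"
      using 1 2 unfolding mem_fraction_rel by blast
  qed
qed

lemma cls_eq_iff:
  "fraction g h \<Longrightarrow> fraction g' h' \<Longrightarrow> cls g h = cls g' h' \<longleftrightarrow> vanishing (g * h' - g' * h)"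
  unfolding cls_def using eq_equiv_class_iff[OF equiv_fraction_rel]
  by (auto simp: mem_fractions mem_fraction_rel)

lemma cls_eqI:
  "fraction g h \<Longrightarrow> fraction g' h' \<Longrightarrow> (\<And>v. v \<in> \<Union>Y \<Longrightarrow> eval g v * eval h' v = eval g' v * eval h v) \<Longrightarrow>
    cls g h = cls g' h'"
  by (simp add: cls_eq_iff vanishing_def eval_diff eval_mult)

lemma mem_cls: "(a, b) \<in> cls g h \<longleftrightarrow> fraction g h \<and> fraction a b \<and> vanishing (g * b - a * h)"
  by (auto simp: cls_def mem_fraction_rel)

abbreviation "L \<equiv> function_field Y"

lemma carrier_L: "carrier L = {cls g h |g h. fraction g h}"
proof -
  have "fractions Y = {(g, h). fraction g h}"
    using mem_fractions by auto
  then show ?thesis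
    by (auto simp: function_field_def quotient_def cls_def)
qed

lemma clsI: "fraction g h \<Longrightarrow> cls g h \<in> carrier L"
  by (auto simp: carrier_L)

lemma clsE:
  assumes "a \<in> carrier L"
  obtains g h where "a = cls g h" "fraction g h"
  using assms by (auto simp: carrier_L)

lemma one_L: "\<one>\<^bsub>L\<^esub> = cls 1 1" and zero_L: "\<zero>\<^bsub>L\<^esub> = cls 0 1"
  by (simp_all add: function_field_def cls_def)

lemma mult_L:
  assumes "fraction g h" "fraction g' h'"
  shows "cls g h \<otimes>\<^bsub>L\<^esub> cls g' h' = cls (g * g') (h * h')"
proof -
  have ne: "cls g h \<noteq> {}" "cls g' h' \<noteq> {}"
    using assms mem_cls[of g h g h] mem_cls[of g' h' g' h'] by (auto simp: vanishing_def eval_simps)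
  have "cls (a * a') (b * b') = cls (g * g') (h * h')" if "(a, b) \<in> cls g h" "(a', b') \<in> cls g' h'" for a b a' b'
  proof (rule cls_eqI)
    show "fraction (a * a') (b * b')" "fraction (g * g') (h * h')"
      using assms that by (auto intro: fraction_mult simp: mem_cls)
    fix v assume "v \<in> \<Union>Y"
    then have eq: "eval a v * eval h v = eval g v * eval b v" "eval a' v * eval h' v = eval g' v * eval b' v"
      using that by (auto simp: mem_cls vanishing_def eval_simps)
    have "eval (a * a') v * eval (h * h') v = (eval a v * eval h v) * (eval a' v * eval h' v)"
      by (simp add: eval_mult mult_ac)
    then show "eval (a * a') v * eval (h * h') v = eval (g * g') v * eval (b * b') v"
      unfolding eq by (simp add: eval_mult mult_ac)
  qed
  then show ?thesis
    using ne unfolding function_field_def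
    by (auto simp: cls_def[symmetric] intro!: UN_constant_on split: prod.splits)
qed

lemma add_L:
  assumes "fraction g h" "fraction g' h'"
  shows "cls g h \<oplus>\<^bsub>L\<^esub> cls g' h' = cls (g * h' + g' * h) (h * h')"
proof -
  have ne: "cls g h \<noteq> {}" "cls g' h' \<noteq> {}"
    using assms mem_cls[of g h g h] mem_cls[of g' h' g' h'] by (auto simp: vanishing_def eval_simps)
  have "cls (a * b' + a' * b) (b * b') = cls (g * h' + g' * h) (h * h')"
    if "(a, b) \<in> cls g h" "(a', b') \<in> cls g' h'" for a b a' b'
  proof (rule cls_eqI)
    show "fraction (a * b' + a' * b) (b * b')" "fraction (g * h' + g' * h) (h * h')"
      using assms that by (auto intro: fraction_add simp: mem_cls)
    fix v assume "v \<in> \<Union>Y"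
    then have eq: "eval a v * eval h v = eval g v * eval b v" "eval a' v * eval h' v = eval g' v * eval b' v"
      using that by (auto simp: mem_cls vanishing_def eval_simps)
    have "eval (a * b' + a' * b) v * eval (h * h') v =
      (eval a v * eval h v) * (eval b' v * eval h' v) + (eval a' v * eval h' v) * (eval b v * eval h v)"
      by (simp add: eval_mult eval_add algebra_simps)
    then show "eval (a * b' + a' * b) v * eval (h * h') v = eval (g * h' + g' * h) v * eval (b * b') v"
      unfolding eq by (simp add: eval_mult eval_add algebra_simps)
  qed
  then show ?thesis
    using ne unfolding function_field_def
    by (auto simp: cls_def[symmetric] intro!: UN_constant_on split: prod.splits)
qed

lemmas fraction_intros = fraction_mult fraction_add fraction_0_1 fraction_1_1 fraction_uminus

lemma cls_eq_zero: "fraction g h \<Longrightarrow> cls g h = \<zero>\<^bsub>L\<^esub> \<longleftrightarrow> vanishing g"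
  by (simp add: zero_L cls_eq_iff fraction_0_1)

lemma field_L: "field L"
proof -
  have "cring L"
  proof (rule cringI)
    show "abelian_group L"
    proof (rule abelian_groupI)
      show "x \<oplus>\<^bsub>L\<^esub> y \<in> carrier L" if "x \<in> carrier L" "y \<in> carrier L" for x y
        using that by (elim clsE) (auto simp: add_L intro!: clsI fraction_intros)
      show "\<zero>\<^bsub>L\<^esub> \<in> carrier L"
        by (auto simp: zero_L intro!: clsI fraction_intros)
      show "x \<oplus>\<^bsub>L\<^esub> y \<oplus>\<^bsub>L\<^esub> z = x \<oplus>\<^bsub>L\<^esub> (y \<oplus>\<^bsub>L\<^esub> z)"
        if "x \<in> carrier L" "y \<in> carrier L" "z \<in> carrier L" for x y z
        using that by (elim clsE) (simp add: add_L fraction_intros, rule cls_eqI, (blast intro: fraction_intros)+, simp add: eval_simps algebra_simps)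
      show "x \<oplus>\<^bsub>L\<^esub> y = y \<oplus>\<^bsub>L\<^esub> x" if "x \<in> carrier L" "y \<in> carrier L" for x y
        using that by (elim clsE) (simp add: add_L fraction_intros, rule cls_eqI, (blast intro: fraction_intros)+, simp add: eval_simps algebra_simps)
      show "\<zero>\<^bsub>L\<^esub> \<oplus>\<^bsub>L\<^esub> x = x" if "x \<in> carrier L" for x
        using that by (elim clsE) (simp add: zero_L add_L fraction_intros)
      show "\<exists>y\<in>carrier L. y \<oplus>\<^bsub>L\<^esub> x = \<zero>\<^bsub>L\<^esub>" if "x \<in> carrier L" for x
      proof -
        obtain g h where gh: "x = cls g h" "fraction g h" by (rule clsE[OF \<open>x \<in> carrier L\<close>])
        have "cls (0 - g) h \<oplus>\<^bsub>L\<^esub> x = \<zero>\<^bsub>L\<^esub>"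
          unfolding gh(1) add_L[OF fraction_uminus[OF gh(2)] gh(2)]
          using cls_eq_zero[OF fraction_add[OF fraction_uminus[OF gh(2)] gh(2)]]
          by (simp add: vanishing_def eval_simps)
        then show ?thesis using clsI[OF fraction_uminus[OF gh(2)]] by blast
      qed
    qed
    show "comm_monoid L"
    proof (rule comm_monoidI)
      show "x \<otimes>\<^bsub>L\<^esub> y \<in> carrier L" if "x \<in> carrier L" "y \<in> carrier L" for x y
        using that by (elim clsE) (auto simp: mult_L intro!: clsI fraction_intros)
      show "\<one>\<^bsub>L\<^esub> \<in> carrier L"
        by (auto simp: one_L intro!: clsI fraction_intros)
      show "x \<otimes>\<^bsub>L\<^esub> y \<otimes>\<^bsub>L\<^esub> z = x \<otimes>\<^bsub>L\<^esub> (y \<otimes>\<^bsub>L\<^esub> z)"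
        if "x \<in> carrier L" "y \<in> carrier L" "z \<in> carrier L" for x y z
        using that by (elim clsE) (simp add: mult_L fraction_intros mult_ac)
      show "x \<otimes>\<^bsub>L\<^esub> y = y \<otimes>\<^bsub>L\<^esub> x" if "x \<in> carrier L" "y \<in> carrier L" for x y
        using that by (elim clsE) (simp add: mult_L fraction_intros mult_ac)
      show "\<one>\<^bsub>L\<^esub> \<otimes>\<^bsub>L\<^esub> x = x" if "x \<in> carrier L" for x
        using that by (elim clsE) (simp add: one_L mult_L fraction_intros)
    qed
    show "(x \<oplus>\<^bsub>L\<^esub> y) \<otimes>\<^bsub>L\<^esub> z = x \<otimes>\<^bsub>L\<^esub> z \<oplus>\<^bsub>L\<^esub> y \<otimes>\<^bsub>L\<^esub> z"
      if "x \<in> carrier L" "y \<in> carrier L" "z \<in> carrier L" for x y z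
      using that by (elim clsE) (simp add: mult_L add_L fraction_intros, rule cls_eqI, (blast intro: fraction_intros)+, simp add: eval_simps algebra_simps)
  qed
  then interpret cring L .
  show ?thesis
  proof (rule cring_fieldI2)
    show "\<zero>\<^bsub>L\<^esub> \<noteq> \<one>\<^bsub>L\<^esub>"
      using cls_eq_zero[OF fraction_1_1] not_vanishing_1 by (simp add: one_L eq_commute)
    fix x assume x: "x \<in> carrier L" "x \<noteq> \<zero>\<^bsub>L\<^esub>"
    obtain g h where gh: "x = cls g h" "fraction g h" by (rule clsE[OF x(1)])
    have hg: "fraction h g"
      using gh x(2) cls_eq_zero[OF gh(2)] unfolding fraction_def by blast
    have "x \<otimes>\<^bsub>L\<^esub> cls h g = \<one>\<^bsub>L\<^esub>"
      unfolding gh(1) mult_L[OF gh(2) hg] one_L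
      by (rule cls_eqI) (auto intro!: fraction_intros gh(2) hg simp: eval_simps)
    then show "\<exists>y\<in>carrier L. x \<otimes>\<^bsub>L\<^esub> y = \<one>\<^bsub>L\<^esub>" using clsI[OF hg] by blast
  qed
qed

lemma pow_L: "fraction g h \<Longrightarrow> cls g h [^]\<^bsub>L\<^esub> (l::nat) = cls (g ^ l) (h ^ l)"
proof (induction l)
  case (Suc l)
  then show ?case
    by (simp add: mult_L fraction_power mult.commute)
qed (simp add: one_L)

end


section \<open>The subfield of the Gauss map\<close>

context frobenius_hypersurface
begin

definition gradient :: "'k ^ 'n \<Rightarrow> 'k ^ 'n"
  where "gradient v = (\<chi> i. grad v i)"

lemma gradient_nth: "gradient v $ i = grad v i"
  by (simp add: gradient_def)

lemma gradient_scale: "gradient (c *s v) = c ^ q *s gradient v"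
  by (simp add: vec_eq_iff gradient_def grad_def power_mult_distrib sum_distrib_left mult_ac)

lemma gradient_eq_0: "gradient v = 0 \<longleftrightarrow> v = 0"
  using grad_nonzero[of v] q_ge_2
  by (auto simp: vec_eq_iff gradient_def grad_def power_0_left)

lemma homogeneous_partial_f: "homogeneous q (partial i f)"
  using homogeneous_f by (intro homogeneous_partial) simp

lemma smooth_f: "smooth f"
proof -
  have "\<exists>i. \<not> vanishes_at (partial i f) P" if "P \<in> hypersurface f" for P
  proof -
    obtain v where v: "P = point v" "v \<noteq> 0"
      using \<open>P \<in> hypersurface f\<close> unfolding hypersurface_eq by blast
    then show ?thesis
      using grad_nonzero[OF v(2)] vanishes_at_point[OF homogeneous_partial_f] by (simp add: eval_partial)
  qed
  then show ?thesis
    by (auto simp: smooth_def smooth_points_def)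
qed

lemma gauss_map_point: "gauss_map f (point v) = point (gradient v)"
  unfolding gauss_map_def
proof (rule UN_constant_on)
  show "point v \<noteq> {}" using mem_point by blast
  fix w assume "w \<in> point v"
  then obtain c where c: "c \<noteq> 0" "w = c *s v" by (auto simp: point_def)
  have "point (\<chi> i. eval (partial i f) w) = point (gradient (c *s v))"
    by (simp add: c(2) gradient_def eval_partial)
  also have "\<dots> = point (gradient v)"
    unfolding gradient_scale using c(1) by (intro point_scale) simp
  finally show "point (\<chi> i. eval (partial i f) w) = point (gradient v)" .
qed

definition q_root :: "'k \<Rightarrow> 'k"
  where "q_root c = (SOME x. x ^ q = c)"

lemma q_root_power: "q_root c ^ q = c"
proof -
  have "q > 0" using q_ge_2 by simp
  then obtain x where "x ^ q = c" using nth_root_exists[of q c] by blast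
  then show ?thesis unfolding q_root_def by (rule someI)
qed

lemma eval_subst_partial: "eval (subst g (\<lambda>i. partial i f)) v = eval g (gradient v)"
  by (simp add: eval_subst gradient_def eval_partial)

lemma homogeneous_subst_partial:
  "homogeneous m g \<Longrightarrow> homogeneous (m * q) (subst g (\<lambda>i. partial i f))"
  by (rule homogeneous_subst[OF _ homogeneous_partial_f])

lemma eval_hom_power_q:
  fixes x :: "'n \<Rightarrow> 'k"
  shows "eval_hom r x (g :: ('n, 'k) mpoly) ^ q = eval_hom (\<lambda>c. r c ^ q) (\<lambda>i. x i ^ q) g"
proof -
  have "(y ^ t) ^ q = (y ^ q) ^ t" for y :: 'k and t
    by (simp add: mult.commute flip: power_mult)
  then show ?thesis
    unfolding eval_hom_def by (simp add: frobenius_sum[OF char(1)] power_mult_distrib prod_power_distrib)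
qed

text \<open>Each gradient component is the q-th power of a linear form whose coefficients are q-th
  roots of entries of \<open>A\<close>. Taking q-th roots of the coefficients of \<open>g\<close> as
  well moves the Frobenius outside.\<close>

lemma gradient_pullback_is_power:
  assumes "homogeneous m g"
  shows "\<exists>g'. homogeneous m g' \<and> (\<forall>v. eval g (gradient v) = eval g' v ^ q)"
proof -
  define F where "F i = (\<Sum>l\<in>UNIV. Const (q_root (A $ l $ i)) * Var l)" for i
  have "homogeneous (0 + 1) (F i)" for i
    unfolding F_def by (intro homogeneous_sum homogeneous_mult homogeneous_Const homogeneous_Var)
  then have F: "homogeneous 1 (F i)" for i by simp
  have eval_F: "eval (F i) v ^ q = grad v i" for i v
    unfolding F_def grad_def by (simp add: eval_simps frobenius_sum[OF char(1)] power_mult_distrib q_root_power)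
  define g' where "g' = eval_hom (\<lambda>a. Const (q_root a)) F g"
  have "eval g' v ^ q = eval g (gradient v)" for v
    unfolding g'_def eval_eval_hom_Const eval_hom_power_q
    by (simp add: q_root_power eval_F eval_def[of g] gradient_def)
  moreover have "homogeneous m g'"
    using homogeneous_eval_hom_Const[OF assms F] by (simp add: g'_def)
  ultimately show ?thesis by metis
qed

text \<open>Conversely, \<open>M\<close> expresses the q-th power of each coordinate as a linear
  form in the gradient. Substituting these forms into \<open>g'\<close>, with coefficients raised to
  the q-th power, gives the required form.\<close>

lemma power_is_gradient_pullback:
  assumes "homogeneous m g'"
  shows "\<exists>g. homogeneous m g \<and> (\<forall>v. eval g (gradient v) = eval g' v ^ q)"
proof -
  define F where "F i = (\<Sum>l\<in>UNIV. Const (M $ l $ i) * Var l)" for i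
  have "homogeneous (0 + 1) (F i)" for i
    unfolding F_def by (intro homogeneous_sum homogeneous_mult homogeneous_Const homogeneous_Var)
  then have F: "homogeneous 1 (F i)" for i by simp
  have eval_F: "eval (F i) (gradient v) = v $ i ^ q" for i v
    using grad_inverse[of v i] by (simp add: F_def eval_simps gradient_nth mult.commute)
  define g where "g = eval_hom (\<lambda>a. Const (a ^ q)) F g'"
  have "eval g (gradient v) = eval g' v ^ q" for v
    unfolding g_def eval_eval_hom_Const eval_F eval_def[of g'] eval_hom_power_q ..
  moreover have "homogeneous m g"
    using homogeneous_eval_hom_Const[OF assms F] by (simp add: g_def)
  ultimately show ?thesis by metis
qed

end

locale gauss_component = frobenius_hypersurface A M p e q f
  for A M :: "'k::alg_closed_field ^ 'n::finite ^ 'n" and p e q f +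
  fixes Y
  assumes component: "Y \<in> irreducible_components (hypersurface f)"
begin

lemma Y_subset: "Y \<subseteq> hypersurface f"
  using component by (simp add: irreducible_components_def)

sublocale irreducible_variety Y
  using component by unfold_locales (simp add: irreducible_components_def)

lemma eval_f_Union_Y: "v \<in> \<Union>Y \<Longrightarrow> eval f v = 0"
  using Y_subset by (auto simp: hypersurface_def zeros_def vanishes_at_def)

lemma gauss_image_Y: "gauss_image f Y = gauss_map f ` Y"
  using Y_subset smooth_f by (auto simp: gauss_image_def smooth_def)

lemma Y_point: "P \<in> Y \<Longrightarrow> \<exists>v. v \<noteq> 0 \<and> P = point v"
  using Y_subset unfolding hypersurface_eq by blast

lemma vanishing_gauss_image:
  assumes "homogeneous m g"
  shows "(\<forall>P\<in>gauss_image f Y. vanishes_at g P) \<longleftrightarrow> vanishing (subst g (\<lambda>i. partial i f))"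
proof -
  have "vanishes_at g (gauss_map f P) \<longleftrightarrow> vanishes_at (subst g (\<lambda>i. partial i f)) P" if P: "P \<in> Y" for P
    using Y_point[OF P]
    by (auto simp: gauss_map_point vanishes_at_point[OF assms]
        vanishes_at_point[OF homogeneous_subst_partial[OF assms]] eval_subst_partial)
  then show ?thesis
    unfolding gauss_image_Y vanishing_iff[symmetric] by simp
qed

lemma mem_fractions_gauss_image:
  "(g, h) \<in> fractions (gauss_image f Y) \<longleftrightarrow>
    (\<exists>m. homogeneous m g \<and> homogeneous m h) \<and> \<not> vanishing (subst h (\<lambda>i. partial i f))"
  using vanishing_gauss_image by (auto simp: fractions_def)

lemma fraction_subst_partial:
  assumes "(g, h) \<in> fractions (gauss_image f Y)"
  shows "fraction (subst g (\<lambda>i. partial i f)) (subst h (\<lambda>i. partial i f))"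
  using assms homogeneous_subst_partial unfolding mem_fractions_gauss_image fraction_def by blast

text \<open>The pullback is a union over all representatives of a class. It is a single class
  because equality on the image can be tested at the gradients of coordinate vectors of
  \<open>Y\<close>.\<close>

lemma gauss_pullback_class:
  assumes gh: "(g, h) \<in> fractions (gauss_image f Y)"
  shows "gauss_pullback f Y (fraction_rel (gauss_image f Y) `` {(g, h)}) =
    cls (subst g (\<lambda>i. partial i f)) (subst h (\<lambda>i. partial i f))"
proof -
  let ?s = "\<lambda>g. subst g (\<lambda>i. partial i f)"
  let ?A = "fraction_rel (gauss_image f Y) `` {(g, h)}"
  have "(g, h) \<in> ?A"
    using gh by (auto simp: fraction_rel_def vanishes_at_def eval_simps)
  then have ne: "?A \<noteq> {}" by blast
  have "cls (?s a) (?s b) = cls (?s g) (?s h)" if ab: "(a, b) \<in> ?A" for a b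
  proof (rule cls_eqI)
    have abf: "(a, b) \<in> fractions (gauss_image f Y)"
      using ab by (auto simp: fraction_rel_def)
    then show "fraction (?s a) (?s b)" by (rule fraction_subst_partial)
    show "fraction (?s g) (?s h)" using gh by (rule fraction_subst_partial)
    fix v assume "v \<in> \<Union>Y"
    then obtain P where P: "v \<in> P" "P \<in> Y" by blast
    then obtain w where w: "P = point w" using Y_point by blast
    then obtain c where c: "c \<noteq> 0" "v = c *s w" using P(1) by (auto simp: point_def)
    \<comment> \<open>Rescaling a coordinate vector by c rescales the gradient by c^q, so the
      gradient of every representative of P represents the image point.\<close>
    have "gauss_map f P = point (gradient v)"
      using c(1) unfolding w gauss_map_point c(2) gradient_scale by (subst point_scale) auto
    then have "gradient v \<in> gauss_map f P" using mem_point by simp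
    moreover have "vanishes_at (g * b - a * h) (gauss_map f P)"
      using ab P(2) by (auto simp: fraction_rel_def gauss_image_Y)
    ultimately show "eval (?s a) v * eval (?s h) v = eval (?s g) v * eval (?s b) v"
      by (auto simp: eval_subst_partial vanishes_at_def eval_simps)
  qed
  then show ?thesis
    using ne unfolding gauss_pullback_def
    by (auto simp: cls_def[symmetric] intro!: UN_constant_on)
qed

definition Kq :: "(('n, 'k) mpoly \<times> ('n, 'k) mpoly) set set"
  where "Kq = {a [^]\<^bsub>L\<^esub> q |a. a \<in> carrier L}"

lemma KqI: "fraction g h \<Longrightarrow> cls (g ^ q) (h ^ q) \<in> Kq"
  unfolding Kq_def using pow_L clsI by (metis (mono_tags, lifting) mem_Collect_eq)

lemma KqE:
  assumes "a \<in> Kq"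
  obtains g h where "a = cls (g ^ q) (h ^ q)" "fraction g h"
  using assms unfolding Kq_def by (auto simp: carrier_L pow_L)

lemma vanishing_if_power:
  assumes "\<And>v. eval h v = eval h' v ^ q"
  shows "vanishing h \<longleftrightarrow> vanishing h'"
  using assms q_ge_2 by (auto simp: vanishing_def)

text \<open>Up to an invertible linear change of coordinates the Gauss map is the Frobenius, so the
  pulled-back fractions are exactly the q-th powers of fractions.\<close>

lemma gauss_subfield_eq: "gauss_subfield f Y = Kq"
proof
  let ?s = "\<lambda>g. subst g (\<lambda>i. partial i f)"
  have carrier: "carrier (function_field (gauss_image f Y)) =
      (\<lambda>x. fraction_rel (gauss_image f Y) `` {x}) ` fractions (gauss_image f Y)"
    by (auto simp: function_field_def quotient_def)
  have sub: "gauss_subfield f Y = {cls (?s g) (?s h) |g h. (g, h) \<in> fractions (gauss_image f Y)}"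
    unfolding gauss_subfield_def carrier image_image
    using gauss_pullback_class by (auto simp: image_iff) (metis gauss_pullback_class)+
  show "gauss_subfield f Y \<subseteq> Kq"
  proof
    fix x assume "x \<in> gauss_subfield f Y"
    then obtain g h where x: "x = cls (?s g) (?s h)" and gh: "(g, h) \<in> fractions (gauss_image f Y)"
      unfolding sub by blast
    obtain m where m: "homogeneous m g" "homogeneous m h"
      using gh by (auto simp: mem_fractions_gauss_image)
    obtain g' where g': "homogeneous m g'" "\<And>v. eval g (gradient v) = eval g' v ^ q"
      using gradient_pullback_is_power[OF m(1)] by blast
    obtain h' where h': "homogeneous m h'" "\<And>v. eval h (gradient v) = eval h' v ^ q"
      using gradient_pullback_is_power[OF m(2)] by blast
    have "\<not> vanishing h'"
      using gh vanishing_if_power[of "?s h" h'] h'(2)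
      by (auto simp: mem_fractions_gauss_image eval_subst_partial)
    then have f': "fraction g' h'"
      using g' h' unfolding fraction_def by blast
    have "x = cls (g' ^ q) (h' ^ q)"
      unfolding x by (rule cls_eqI)
        (auto intro: fraction_subst_partial[OF gh] fraction_power[OF f']
          simp: eval_subst_partial g' h' eval_power)
    then show "x \<in> Kq" using KqI[OF f'] by simp
  qed
  show "Kq \<subseteq> gauss_subfield f Y"
  proof
    fix x assume "x \<in> Kq"
    then obtain g' h' where x: "x = cls (g' ^ q) (h' ^ q)" and f': "fraction g' h'"
      by (rule KqE)
    obtain m where m: "homogeneous m g'" "homogeneous m h'"
      using f' by (auto simp: fraction_def)
    obtain g where g: "homogeneous m g" "\<And>v. eval g (gradient v) = eval g' v ^ q"
      using power_is_gradient_pullback[OF m(1)] by blast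
    obtain h where h: "homogeneous m h" "\<And>v. eval h (gradient v) = eval h' v ^ q"
      using power_is_gradient_pullback[OF m(2)] by blast
    have "\<not> vanishing (?s h)"
      using f' vanishing_if_power[of "?s h" h'] h(2) by (auto simp: fraction_def eval_subst_partial)
    then have gh: "(g, h) \<in> fractions (gauss_image f Y)"
      using g(1) h(1) by (auto simp: mem_fractions_gauss_image)
    have "cls (?s g) (?s h) = x"
      unfolding x by (rule cls_eqI)
        (auto intro: fraction_subst_partial[OF gh] fraction_power[OF f']
          simp: eval_subst_partial g h eval_power)
    then show "x \<in> gauss_subfield f Y"
      unfolding sub using gh by blast
  qed
qed

lemma subfield_Kq: "subfield Kq L"
proof -
  interpret field L by (rule field_L)
  show ?thesis
  proof (rule subfieldI')
    show "subring Kq L"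
    proof (rule subringI)
      show "Kq \<subseteq> carrier L" by (auto simp: Kq_def)
      show "\<one>\<^bsub>L\<^esub> \<in> Kq" using nat_pow_one[of q] one_closed unfolding Kq_def by force
      show "\<ominus>\<^bsub>L\<^esub> a \<in> Kq" if "a \<in> Kq" for a
      proof -
        obtain g h where gh: "a = cls (g ^ q) (h ^ q)" "fraction g h" by (rule KqE[OF \<open>a \<in> Kq\<close>])
        note fr = fraction_power[OF gh(2), of q] fraction_power[OF fraction_uminus[OF gh(2)], of q]
        have "cls ((0 - g) ^ q) (h ^ q) \<oplus>\<^bsub>L\<^esub> a = \<zero>\<^bsub>L\<^esub>"
          unfolding gh(1) add_L[OF fr(2,1)] cls_eq_zero[OF fraction_add[OF fr(2,1)]]
          using q_ge_2 frobenius_diff[OF char(1), of 0]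
          by (simp add: vanishing_def eval_simps hom_uminus[OF is_hom_eval] power_0_left)
        then have "\<ominus>\<^bsub>L\<^esub> a = cls ((0 - g) ^ q) (h ^ q)"
          by (rule minus_equality) (use gh clsI fr in auto)
        then show ?thesis using KqI[OF fraction_uminus[OF gh(2)]] by simp
      qed
      show "a \<otimes>\<^bsub>L\<^esub> b \<in> Kq" if "a \<in> Kq" "b \<in> Kq" for a b
        using that unfolding Kq_def by (auto simp: nat_pow_distrib[symmetric])
      show "a \<oplus>\<^bsub>L\<^esub> b \<in> Kq" if "a \<in> Kq" "b \<in> Kq" for a b
      proof -
        obtain g h where gh: "a = cls (g ^ q) (h ^ q)" "fraction g h" by (rule KqE[OF \<open>a \<in> Kq\<close>])
        obtain g' h' where gh': "b = cls (g' ^ q) (h' ^ q)" "fraction g' h'" by (rule KqE[OF \<open>b \<in> Kq\<close>])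
        note fr = fraction_power[OF gh(2), of q] fraction_power[OF gh'(2), of q]
          and fr' = fraction_add[OF gh(2) gh'(2)]
        have "a \<oplus>\<^bsub>L\<^esub> b = cls ((g * h' + g' * h) ^ q) ((h * h') ^ q)"
          unfolding gh(1) gh'(1) add_L[OF fr]
          by (rule cls_eqI[OF fraction_add[OF fr] fraction_power[OF fr']])
            (simp add: eval_simps frobenius_add[OF char(1)] power_mult_distrib)
        then show ?thesis using KqI[OF fr'] by simp
      qed
    qed
    show "inv\<^bsub>L\<^esub> a \<in> Kq" if a: "a \<in> Kq - {\<zero>\<^bsub>L\<^esub>}" for a
    proof -
      obtain b where b: "b \<in> carrier L" "a = b [^]\<^bsub>L\<^esub> q" using a by (auto simp: Kq_def)
      have "b \<noteq> \<zero>\<^bsub>L\<^esub>"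
        using a q_ge_2 unfolding b(2) by (auto simp: nat_pow_zero)
      then have u: "b \<in> Units L" using b(1) by (simp add: field_Units)
      have "a \<otimes>\<^bsub>L\<^esub> (inv\<^bsub>L\<^esub> b) [^]\<^bsub>L\<^esub> q = \<one>\<^bsub>L\<^esub>"
        using nat_pow_distrib[OF b(1) Units_inv_closed[OF u], of q] Units_r_inv[OF u]
        unfolding b(2) by (simp add: nat_pow_one)
      then have "inv\<^bsub>L\<^esub> a = (inv\<^bsub>L\<^esub> b) [^]\<^bsub>L\<^esub> q"
        using b Units_inv_closed[OF u] by (intro comm_inv_char) auto
      then show ?thesis using Units_inv_closed[OF u] unfolding Kq_def by auto
    qed
  qed
qed

text \<open>The single exponent e serves all elements, since \<open>q = p ^ e\<close>.\<close>

lemma purely_inseparable_L: "purely_inseparable p (gauss_subfield f Y) L"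
  unfolding purely_inseparable_def field_extension_def gauss_subfield_eq
proof (intro conjI ballI)
  fix a assume "a \<in> carrier L"
  then have "a [^]\<^bsub>L\<^esub> (p ^ e) \<in> Kq"
    unfolding Kq_def exponent(2)[symmetric] by blast
  then show "\<exists>m::nat. a [^]\<^bsub>L\<^esub> (p ^ m) \<in> Kq" by blast
qed (rule field_L subfield_Kq)+

text \<open>If x_j were the only coordinate not vanishing on \<open>Y\<close>, the relation f(v) =
  \<Sum> \<open>grad v l * v $ l\<close> would reduce to its term for j. Then x_j would vanish on
  \<open>Y\<close> too, leaving a point without nonzero coordinates.\<close>

lemma exists_coordinates:
  "\<exists>i0 j. i0 \<noteq> j \<and> \<not> vanishing (Var i0) \<and> \<not> vanishing (partial j f)"
proof -
  obtain P where P: "P \<in> Y" using irreducible by (auto simp: irreducible_closed_def)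
  then obtain v where v: "v \<noteq> 0" "P = point v" using Y_point by blast
  then have vY: "v \<in> \<Union>Y" using P mem_point by blast
  obtain j where "grad v j \<noteq> 0" using grad_nonzero[OF v(1)] by blast
  then have j: "\<not> vanishing (partial j f)"
    using vY by (auto simp: vanishing_def eval_partial)
  have "\<exists>i0. i0 \<noteq> j \<and> \<not> vanishing (Var i0)"
  proof (rule ccontr)
    assume contr: "\<not> ?thesis"
    then have zero: "w $ i = 0" if "i \<noteq> j" "w \<in> \<Union>Y" for i w
      using that unfolding vanishing_def eval_Var by blast
    have "grad w j * w $ j = 0" if "w \<in> \<Union>Y" for w
    proof -
      have "(\<Sum>l\<in>UNIV. grad w l * w $ l) = (\<Sum>l\<in>UNIV. if l = j then grad w j * w $ j else 0)"
        using zero[OF _ that] by (intro sum.cong) auto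
      then show ?thesis
        using eval_f_Union_Y[OF that] by (simp add: eval_f form_grad)
    qed
    then have "vanishing (partial j f * Var j)"
      by (simp add: vanishing_def eval_simps eval_partial)
    then have "vanishing (Var j)"
      using vanishing_prime[OF homogeneous_partial_f homogeneous_Var] j by blast
    then have "v $ j = 0"
      using vY by (auto simp: vanishing_def eval_Var)
    then have "v = 0"
      using zero[OF _ vY] by (metis vec_eq_iff zero_index)
    with v(1) show False by simp
  qed
  with j show ?thesis by blast
qed

end


section \<open>A basis of monomials\<close>

locale gauss_coordinates = gauss_component A M p e q f Y
  for A M :: "'k::alg_closed_field ^ 'n::finite ^ 'n" and p e q f Y +
  fixes i0 j :: 'n
  assumes distinct: "i0 \<noteq> j"
    and x0_not_vanishing: "\<not> vanishing (Var i0)"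
    and partial_not_vanishing: "\<not> vanishing (partial j f)"
begin

definition J :: "'n set"
  where "J = UNIV - {i0, j}"

lemma UNIV_eq: "UNIV = insert i0 (insert j J)" "i0 \<notin> insert j J" "j \<notin> J"
  using distinct by (auto simp: J_def)

abbreviation E :: "('n \<Rightarrow> nat) set"
  where "E \<equiv> PiE J (\<lambda>_. {..<q})"

abbreviation x0 :: "('n, 'k) mpoly"
  where "x0 \<equiv> Var i0"

definition monomial_on :: "'n set \<Rightarrow> ('n \<Rightarrow> nat) \<Rightarrow> ('n, 'k) mpoly"
  where "monomial_on I t = (\<Prod>i\<in>I. Var i ^ t i)"

text \<open>The monomial with exponents \<open>a\<close> in the affine coordinates x_i /
  x_i0.\<close>

definition basis_element :: "('n \<Rightarrow> nat) \<Rightarrow> (('n, 'k) mpoly \<times> ('n, 'k) mpoly) set"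
  where "basis_element a = cls (monomial_on J a) (x0 ^ sum a J)"

lemma homogeneous_monomial_on: "homogeneous (sum t I) (monomial_on I t)"
  unfolding monomial_on_def
proof (rule homogeneous_prod)
  show "homogeneous (t i) (Var i ^ t i :: ('n, 'k) mpoly)" for i
    using homogeneous_power[OF homogeneous_Var, of "t i" i] by simp
qed

lemma eval_monomial_on: "eval (monomial_on I t) v = (\<Prod>i\<in>I. v $ i ^ t i)"
  by (simp add: monomial_on_def eval_simps)

lemma homogeneous_x0_power: "homogeneous m (x0 ^ m)"
  using homogeneous_power[OF homogeneous_Var, of m i0] by simp

lemma x0_power_not_vanishing: "\<not> vanishing (x0 ^ m)"
  by (rule not_vanishing_power[OF homogeneous_Var x0_not_vanishing])

lemma fraction_x0: "homogeneous m g \<Longrightarrow> fraction g (x0 ^ m)"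
  unfolding fraction_def using homogeneous_x0_power x0_power_not_vanishing by blast

lemma basis_element_in_carrier: "basis_element a \<in> carrier L"
  unfolding basis_element_def by (rule clsI[OF fraction_x0[OF homogeneous_monomial_on]])

section \<open>Spanning: an arbitrary \<open>Kq\<close>-subspace \<open>S\<close> that contains the
  monomials\<close>

context
  fixes S
  assumes S_zero: "\<zero>\<^bsub>L\<^esub> \<in> S"
    and S_add: "\<And>x y. x \<in> S \<Longrightarrow> y \<in> S \<Longrightarrow> x \<oplus>\<^bsub>L\<^esub> y \<in> S"
    and S_smult: "\<And>k x. k \<in> Kq \<Longrightarrow> x \<in> S \<Longrightarrow> k \<otimes>\<^bsub>L\<^esub> x \<in> S"
    and S_basis: "\<And>a. a \<in> E \<Longrightarrow> basis_element a \<in> S"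
begin

lemma cls_sum_mem:
  assumes "finite I" "homogeneous m h" "\<not> vanishing h"
    and "\<And>l. l \<in> I \<Longrightarrow> homogeneous m (F l)" "\<And>l. l \<in> I \<Longrightarrow> cls (F l) h \<in> S"
  shows "cls (sum F I) h \<in> S"
  using assms(1,4,5)
proof (induction I)
  case empty
  have "fraction 0 h" using assms(2,3) homogeneous_0 unfolding fraction_def by blast
  then have "cls 0 h = \<zero>\<^bsub>L\<^esub>" by (simp add: cls_eq_zero vanishing_def eval_0)
  then show ?case using S_zero by simp
next
  case (insert l I)
  have fr: "fraction (F l) h" "fraction (sum F I) h"
    using assms(2,3) insert.prems(1) homogeneous_sum[of I m F] unfolding fraction_def by blast+
  have fr': "fraction (F l + sum F I) h"
    using assms(2,3) insert.prems(1) homogeneous_add[of m "F l" "sum F I"] homogeneous_sum[of I m F]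
    unfolding fraction_def by blast
  have "cls (F l) h \<oplus>\<^bsub>L\<^esub> cls (sum F I) h = cls (F l + sum F I) h"
    unfolding add_L[OF fr] by (rule cls_eqI[OF fraction_add[OF fr] fr'])
      (simp add: eval_simps algebra_simps)
  moreover have "cls (F l) h \<oplus>\<^bsub>L\<^esub> cls (sum F I) h \<in> S"
    using insert by (intro S_add) auto
  ultimately show ?case using insert.hyps by simp
qed

lemma cls_smult_mem:
  assumes ab: "fraction a b" and gh: "fraction g h" "cls g h \<in> S" and gh': "fraction g' h'"
    and eq: "\<And>v. v \<in> \<Union>Y \<Longrightarrow> eval g' v * (eval b v ^ q * eval h v) = eval a v ^ q * eval g v * eval h' v"
  shows "cls g' h' \<in> S"
proof -
  note fr = fraction_power[OF ab, of q]
  have "cls (a ^ q) (b ^ q) \<otimes>\<^bsub>L\<^esub> cls g h = cls g' h'"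
    unfolding mult_L[OF fr gh(1)]
    by (rule cls_eqI[OF fraction_mult[OF fr gh(1)] gh']) (simp add: eval_simps eq)
  then show ?thesis using S_smult[OF KqI[OF ab] gh(2)] by simp
qed

text \<open>The induction is on the exponent of x_j. At exponent 0, division with remainder by q
  splits off a q-th power, and the power of x_i0 cancels against the denominator. Otherwise one
  factor x_j is traded for the other variables with coefficients in \<open>Kq\<close>.\<close>

lemma monomial_mem: "cls (monomial_on UNIV t) (x0 ^ sum t UNIV) \<in> S"
proof (induction "t j" arbitrary: t)
  case 0
  let ?a = "restrict (\<lambda>i. t i mod q) J" and ?b = "\<lambda>i. t i div q"
  have a: "?a \<in> E" using q_ge_2 by auto
  show ?case
  proof (rule cls_smult_mem)
    show "fraction (monomial_on J ?b) (x0 ^ sum ?b J)"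
      "fraction (monomial_on J ?a) (x0 ^ sum ?a J)"
      "fraction (monomial_on UNIV t) (x0 ^ sum t UNIV)"
      by (rule fraction_x0[OF homogeneous_monomial_on])+
    show "cls (monomial_on J ?a) (x0 ^ sum ?a J) \<in> S"
      using S_basis[OF a] by (simp add: basis_element_def)
    fix v :: "'k ^ 'n"
    let ?c = "v $ i0"
    have "(\<Prod>i\<in>J. v $ i ^ t i) = (\<Prod>i\<in>J. v $ i ^ (t i div q * q + t i mod q))" by simp
    also have "\<dots> = (\<Prod>i\<in>J. v $ i ^ ?b i) ^ q * (\<Prod>i\<in>J. v $ i ^ (t i mod q))"
      by (simp only: power_add power_mult prod.distrib prod_power_distrib)
    also have "(\<Prod>i\<in>J. v $ i ^ (t i mod q)) = (\<Prod>i\<in>J. v $ i ^ ?a i)"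
      by (rule prod.cong) auto
    finally have P: "(\<Prod>i\<in>J. v $ i ^ t i) = (\<Prod>i\<in>J. v $ i ^ ?b i) ^ q * (\<Prod>i\<in>J. v $ i ^ ?a i)" .
    have "sum t J = (\<Sum>i\<in>J. t i div q * q + t i mod q)" by simp
    also have "\<dots> = sum ?b J * q + (\<Sum>i\<in>J. t i mod q)"
      by (simp only: sum.distrib sum_distrib_right)
    also have "(\<Sum>i\<in>J. t i mod q) = sum ?a J"
      by (rule sum.cong) auto
    finally have "sum t J = sum ?b J * q + sum ?a J" .
    then have Q: "?c ^ sum t J = (?c ^ sum ?b J) ^ q * ?c ^ sum ?a J"
      by (simp add: power_add power_mult)
    have U: "(\<Prod>i\<in>UNIV. v $ i ^ t i) = ?c ^ t i0 * (\<Prod>i\<in>J. v $ i ^ t i)"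
      "?c ^ sum t UNIV = ?c ^ t i0 * ?c ^ sum t J"
      using UNIV_eq(2,3) 0 unfolding UNIV_eq(1) by (simp_all add: power_add)
    show "eval (monomial_on UNIV t) v * (eval (x0 ^ sum ?b J) v ^ q * eval (x0 ^ sum ?a J) v) =
      eval (monomial_on J ?b) v ^ q * eval (monomial_on J ?a) v * eval (x0 ^ sum t UNIV) v"
      unfolding eval_monomial_on eval_power eval_Var U P Q by (simp add: mult_ac)
  qed
next
  case (Suc k)
  \<comment> \<open>\<open>s\<close> is t with one factor x_j removed, and \<open>?u l\<close> puts
    x_l in its place. All \<open>?u l\<close> have the degree of t and, for l \<noteq> j, a smaller
    exponent of x_j.\<close>
  define s where "s = t(j := k)"
  let ?N = "Suc (sum s UNIV)" and ?u = "\<lambda>l. s(l := Suc (s l))"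
  have sum_u: "sum (?u l) UNIV = ?N" for l
  proof -
    have "sum (?u l) UNIV = (\<Sum>i\<in>UNIV. s i + (if i = l then 1 else 0))"
      by (rule sum.cong) auto
    then show ?thesis by (simp add: sum.distrib)
  qed
  have mon_u: "eval (monomial_on UNIV (?u l)) v = v $ l * eval (monomial_on UNIV s) v" for l v
  proof -
    have "(\<Prod>i\<in>UNIV. v $ i ^ ?u l i) = (\<Prod>i\<in>UNIV. v $ i ^ s i * (if i = l then v $ l else 1))"
      by (rule prod.cong) auto
    then show ?thesis by (simp add: eval_monomial_on prod.distrib mult.commute)
  qed
  have t: "t = ?u j" using Suc(2) by (auto simp: s_def)
  \<comment> \<open>The partial derivatives are q-th powers of the linear forms
    \<open>\<mu> l\<close>, so the coefficients of the traded terms are the q-th powers of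
    -\<open>\<mu> l\<close> / \<open>\<mu> j\<close>.\<close>
  obtain \<mu> where lam: "\<And>l. homogeneous 1 (\<mu> l)" "\<And>l v. grad v l = eval (\<mu> l) v ^ q"
    using gradient_pullback_is_power[OF homogeneous_Var] unfolding eval_Var gradient_nth by metis
  have "\<not> vanishing (\<mu> j)"
    using partial_not_vanishing vanishing_if_power[of "partial j f" "\<mu> j"]
    by (simp add: eval_partial lam(2))
  then have fr: "fraction (0 - \<mu> l) (\<mu> j)" for l
    using lam(1) homogeneous_diff[OF homogeneous_0 lam(1)] unfolding fraction_def by blast
  let ?h = "partial j f * x0 ^ ?N" and ?F = "\<lambda>l. (0 - partial l f) * monomial_on UNIV (?u l)"
  have hom_F: "homogeneous (q + ?N) (?F l)" for l
    using homogeneous_mult[OF homogeneous_diff[OF homogeneous_0 homogeneous_partial_f]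
        homogeneous_monomial_on[of "?u l" UNIV]] by (simp only: sum_u)
  have hom_h: "homogeneous (q + ?N) ?h"
    by (rule homogeneous_mult[OF homogeneous_partial_f homogeneous_x0_power])
  have nv_h: "\<not> vanishing ?h"
    using vanishing_prime[OF homogeneous_partial_f homogeneous_x0_power]
      partial_not_vanishing x0_power_not_vanishing by blast
  have "cls (sum ?F (UNIV - {j})) ?h \<in> S"
  proof (rule cls_sum_mem[OF _ hom_h nv_h hom_F])
    fix l assume l: "l \<in> UNIV - {j}"
    then have IH: "cls (monomial_on UNIV (?u l)) (x0 ^ sum (?u l) UNIV) \<in> S"
      by (intro Suc(1)) (auto simp: s_def)
    show "cls (?F l) ?h \<in> S"
    proof (rule cls_smult_mem[OF fr _ IH])
      show "fraction (monomial_on UNIV (?u l)) (x0 ^ sum (?u l) UNIV)"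
        by (rule fraction_x0[OF homogeneous_monomial_on])
      show "fraction (?F l) ?h"
        unfolding fraction_def using hom_F hom_h nv_h by blast
      have "(0 - x) ^ q = 0 - x ^ q" for x :: 'k
        using q_ge_2 frobenius_diff[OF char(1), of 0 x] by (simp add: power_0_left)
      then show "eval (?F l) v * (eval (\<mu> j) v ^ q * eval (x0 ^ sum (?u l) UNIV) v) =
        eval (0 - \<mu> l) v ^ q * eval (monomial_on UNIV (?u l)) v * eval ?h v" for v
        unfolding sum_u by (simp only: eval_mult eval_diff eval_0 eval_partial lam(2) mult_ac)
    qed
  qed simp
  also have "cls (sum ?F (UNIV - {j})) ?h = cls (monomial_on UNIV t) (x0 ^ sum t UNIV)"
  proof (rule cls_eqI)
    show "fraction (sum ?F (UNIV - {j})) ?h"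
      unfolding fraction_def
      by (intro conjI exI[of _ "q + ?N"] homogeneous_sum hom_F hom_h nv_h)
    show "fraction (monomial_on UNIV t) (x0 ^ sum t UNIV)"
      by (rule fraction_x0[OF homogeneous_monomial_on])
    fix v assume v: "v \<in> \<Union>Y"
    have "(\<Sum>l\<in>UNIV. grad v l * v $ l) = 0"
      using eval_f_Union_Y[OF v] by (simp add: eval_f form_grad)
    then have "(\<Sum>l\<in>UNIV - {j}. grad v l * v $ l) = - (grad v j * v $ j)"
      by (simp add: sum.remove[of UNIV j] eq_neg_iff_add_eq_0 add.commute)
    moreover have "eval (sum ?F (UNIV - {j})) v =
      - (\<Sum>l\<in>UNIV - {j}. grad v l * v $ l) * eval (monomial_on UNIV s) v"
      unfolding eval_sum eval_mult eval_diff eval_0 eval_partial mon_u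
      by (simp add: sum_distrib_left sum_negf mult_ac)
    ultimately have "eval (sum ?F (UNIV - {j})) v = grad v j * v $ j * eval (monomial_on UNIV s) v"
      by simp
    moreover have "sum t UNIV = ?N" "eval (monomial_on UNIV t) v = v $ j * eval (monomial_on UNIV s) v"
      by (subst t, rule sum_u) (subst t, rule mon_u)
    ultimately show "eval (sum ?F (UNIV - {j})) v * eval (x0 ^ sum t UNIV) v =
      eval (monomial_on UNIV t) v * eval ?h v"
      by (simp add: eval_mult eval_partial mult_ac)
  qed
  finally show ?case .
qed

lemma carrier_subset: "carrier L \<subseteq> S"
proof
  fix x assume "x \<in> carrier L"
  then obtain g h where x: "x = cls g h" and gh: "fraction g h" by (rule clsE)
  then obtain m where m: "homogeneous m g" "homogeneous m h" unfolding fraction_def by blast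
  \<comment> \<open>Rewrites g / h as (x_i0^m / h)^q times G / x_i0^(m q): the denominator moves
    into \<open>Kq\<close>, and only monomials over a power of x_i0 remain.\<close>
  define G where "G = g * h ^ (q - 1)"
  have q: "m + m * (q - 1) = m * q"
    using q_ge_2 by (cases q) auto
  have hom_G: "homogeneous (m * q) G"
    using homogeneous_mult[OF m(1) homogeneous_power[OF m(2), of "q - 1"]] unfolding q G_def .
  let ?mon = "\<lambda>t. Poly_Mapping.single t (Poly_Mapping.lookup G t)"
  have G_sum: "(\<Sum>t\<in>Poly_Mapping.keys G. ?mon t) = G"
    by (rule mpoly_sum_monomials[symmetric])
  have "cls (\<Sum>t\<in>Poly_Mapping.keys G. ?mon t) (x0 ^ (m * q)) \<in> S"
  proof (rule cls_sum_mem[OF _ homogeneous_x0_power x0_power_not_vanishing])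
    fix t assume t: "t \<in> Poly_Mapping.keys G"
    then have deg: "sum (Poly_Mapping.lookup t) UNIV = m * q"
      using hom_G by (simp add: homogeneous_def)
    then show hom: "homogeneous (m * q) (?mon t)"
      by (simp add: homogeneous_def)
    show "cls (?mon t) (x0 ^ (m * q)) \<in> S"
    proof (rule cls_smult_mem[OF _ _ monomial_mem fraction_x0[OF hom]])
      \<comment> \<open>Constants lie in \<open>Kq\<close> because every coefficient has a q-th root
        in k.\<close>
      show "fraction (Const (q_root (Poly_Mapping.lookup G t))) 1"
        unfolding fraction_def using homogeneous_Const homogeneous_1 not_vanishing_1 by blast
      show "fraction (monomial_on UNIV (Poly_Mapping.lookup t)) (x0 ^ sum (Poly_Mapping.lookup t) UNIV)"
        by (rule fraction_x0[OF homogeneous_monomial_on])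
      have "eval (?mon t) v = Poly_Mapping.lookup G t * (\<Prod>i\<in>UNIV. v $ i ^ Poly_Mapping.lookup t i)" for v
        unfolding eval_def by (rule eval_hom_single) simp
      then show "eval (?mon t) v * (eval 1 v ^ q * eval (x0 ^ sum (Poly_Mapping.lookup t) UNIV) v) =
        eval (Const (q_root (Poly_Mapping.lookup G t))) v ^ q *
        eval (monomial_on UNIV (Poly_Mapping.lookup t)) v * eval (x0 ^ (m * q)) v" for v
        unfolding deg by (simp add: eval_1 eval_Const q_root_power eval_monomial_on)
    qed
  qed simp
  then have G_mem: "cls G (x0 ^ (m * q)) \<in> S"
    unfolding G_sum .
  have "\<not> vanishing h" using gh by (simp add: fraction_def)
  then have "fraction (x0 ^ m) h"
    unfolding fraction_def using homogeneous_x0_power m(2) by blast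
  then show "x \<in> S"
    unfolding x
  proof (rule cls_smult_mem[OF _ fraction_x0[OF hom_G] G_mem gh])
    fix v :: "'k ^ 'n"
    have "eval h v ^ q = eval h v ^ (q - 1) * eval h v"
      using q_ge_2 by (simp flip: power_Suc2)
    then show "eval g v * (eval h v ^ q * eval (x0 ^ (m * q)) v) =
      eval (x0 ^ m) v ^ q * eval G v * eval h v"
      by (simp add: G_def eval_simps power_mult mult_ac)
  qed
qed

end

text \<open>Clears denominators in a \<open>Kq\<close>-linear combination: one common
  \<open>H ^ q\<close>, with every monomial padded by a power of x_i0 up to degree N. The
  coefficients stay explicit q-th powers, as the tangent line argument requires.\<close>

lemma combine_representation:
  assumes "length Ks = length as" "set Ks \<subseteq> Kq" "distinct as" "\<forall>a\<in>set as. sum a J \<le> N"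
  shows "\<exists>G H m. homogeneous m H \<and> \<not> vanishing H \<and> (\<forall>a\<in>set as. homogeneous m (G a)) \<and>
    (\<forall>i<length as. Ks ! i = cls (G (as ! i) ^ q) (H ^ q)) \<and>
    ring.combine L Ks (map basis_element as) =
      cls (\<Sum>a\<in>set as. G a ^ q * monomial_on J a * x0 ^ (N - sum a J)) (H ^ q * x0 ^ N)"
  using assms
proof (induction Ks as rule: list_induct2)
  case Nil
  interpret F: field L by (rule field_L)
  have fr: "fraction 0 (x0 ^ N)" using fraction_x0[OF homogeneous_0] .
  have "\<zero>\<^bsub>L\<^esub> = cls 0 (1 ^ q * x0 ^ N)"
    using cls_eq_zero[OF fr] by (simp add: vanishing_def eval_0)
  then show ?case
    by (intro exI[of _ "\<lambda>_. 0"] exI[of _ 1] exI[of _ 0]) (auto simp: homogeneous_1 not_vanishing_1)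
next
  case (Cons k Ks a as)
  interpret F: field L by (rule field_L)
  have "set Ks \<subseteq> Kq" "distinct as" "\<forall>a\<in>set as. sum a J \<le> N"
    using Cons.prems by auto
  from Cons.IH[OF this] obtain G H m where H: "homogeneous m H" "\<not> vanishing H"
    and G0: "\<forall>b\<in>set as. homogeneous m (G b)"
    and nth0: "\<forall>i<length as. Ks ! i = cls (G (as ! i) ^ q) (H ^ q)"
    and comb: "F.combine Ks (map basis_element as) =
      cls (\<Sum>a\<in>set as. G a ^ q * monomial_on J a * x0 ^ (N - sum a J)) (H ^ q * x0 ^ N)"
    by (elim exE conjE)
  have G: "homogeneous m (G b)" if "b \<in> set as" for b
    using G0 that by blast
  have nth: "Ks ! i = cls (G (as ! i) ^ q) (H ^ q)" if "i < length as" for i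
    using nth0 that by blast
  obtain g h where k: "k = cls (g ^ q) (h ^ q)" and gh: "fraction g h"
    using Cons.prems(1) by (auto elim: KqE)
  obtain r where r: "homogeneous r g" "homogeneous r h" and h: "\<not> vanishing h"
    using gh by (auto simp: fraction_def)
  have a: "a \<notin> set as" "sum a J \<le> N" using Cons.prems by auto
  \<comment> \<open>Numerators after bringing g / h and all G b / H over the common denominator H
    h.\<close>
  define G' where "G' b = (if b = a then H * g else G b * h)" for b
  define T where "T G = (\<Sum>a\<in>set as. G a ^ q * monomial_on J a * x0 ^ (N - sum a J))"
    for G :: "('n \<Rightarrow> nat) \<Rightarrow> ('n, 'k) mpoly"
  have hom_term: "homogeneous (l * q + N) (P ^ q * monomial_on J b * x0 ^ (N - sum b J))"
    if "homogeneous l P" "sum b J \<le> N" for P b l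
  proof -
    have "homogeneous (l * q + sum b J + (N - sum b J)) (P ^ q * monomial_on J b * x0 ^ (N - sum b J))"
      by (intro homogeneous_mult homogeneous_power that homogeneous_monomial_on homogeneous_x0_power)
    then show ?thesis using that(2) by simp
  qed
  have H': "homogeneous (m + r) (H * h)" "\<not> vanishing (H * h)"
    using homogeneous_mult[OF H(1) r(2)] vanishing_prime[OF H(1) r(2)] H(2) h by blast+
  have hom_G': "homogeneous (m + r) (G' b)" if "b \<in> set (a # as)" for b
    using that G homogeneous_mult[OF H(1) r(1)] homogeneous_mult[OF _ r(2)] by (auto simp: G'_def)
  have fr_H: "fraction P (X ^ q * x0 ^ N)"
    if "homogeneous l X" "\<not> vanishing X" "homogeneous (l * q + N) P" for P X l
    unfolding fraction_def
    using that homogeneous_mult[OF homogeneous_power[OF that(1)] homogeneous_x0_power]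
      vanishing_prime[OF homogeneous_power[OF that(1)] homogeneous_x0_power]
      not_vanishing_power[OF that(1,2)] x0_power_not_vanishing by blast
  have fr1: "fraction (T G) (H ^ q * x0 ^ N)"
    unfolding T_def using Cons.prems(3) by (intro fr_H[OF H] homogeneous_sum hom_term G) auto
  have fr2: "fraction (\<Sum>a\<in>set (a # as). G' a ^ q * monomial_on J a * x0 ^ (N - sum a J)) ((H * h) ^ q * x0 ^ N)"
    using Cons.prems(3) by (intro fr_H[OF H'] homogeneous_sum hom_term hom_G') auto
  note frk = fraction_power[OF gh, of q] and fra = fraction_x0[OF homogeneous_monomial_on[of a J]]
  note frka = fraction_mult[OF frk fra]
  have "F.combine (k # Ks) (map basis_element (a # as)) =
    cls (g ^ q * monomial_on J a * (H ^ q * x0 ^ N) + T G * (h ^ q * x0 ^ sum a J))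
      (h ^ q * x0 ^ sum a J * (H ^ q * x0 ^ N))"
    using comb unfolding T_def[symmetric]
    by (simp add: k basis_element_def mult_L[OF frk fra] add_L[OF frka fr1])
  also have "\<dots> = cls (\<Sum>a\<in>set (a # as). G' a ^ q * monomial_on J a * x0 ^ (N - sum a J)) ((H * h) ^ q * x0 ^ N)"
  proof (rule cls_eqI[OF fraction_add[OF frka fr1] fr2])
    fix v :: "'k ^ 'n"
    have T: "eval (\<Sum>b\<in>set as. G' b ^ q * monomial_on J b * x0 ^ (N - sum b J)) v = eval h v ^ q * eval (T G) v"
      unfolding T_def eval_sum sum_distrib_left
      using a(1) by (intro sum.cong) (auto simp: G'_def eval_simps power_mult_distrib)
    have c: "v $ i0 ^ N = v $ i0 ^ (N - sum a J) * v $ i0 ^ sum a J"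
      using a(2) by (simp flip: power_add)
    have sum_split: "(\<Sum>a\<in>set (a # as). G' a ^ q * monomial_on J a * x0 ^ (N - sum a J)) =
      (H * g) ^ q * monomial_on J a * x0 ^ (N - sum a J) +
      (\<Sum>b\<in>set as. G' b ^ q * monomial_on J b * x0 ^ (N - sum b J))"
      using a(1) by (simp add: G'_def)
    show "eval (g ^ q * monomial_on J a * (H ^ q * x0 ^ N) + T G * (h ^ q * x0 ^ sum a J)) v *
      eval ((H * h) ^ q * x0 ^ N) v =
      eval (\<Sum>a\<in>set (a # as). G' a ^ q * monomial_on J a * x0 ^ (N - sum a J)) v *
      eval (h ^ q * x0 ^ sum a J * (H ^ q * x0 ^ N)) v"
      unfolding sum_split eval_add T
      by (simp add: eval_mult eval_power eval_Var c power_mult_distrib algebra_simps)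
  qed
  finally have comb': "F.combine (k # Ks) (map basis_element (a # as)) =
    cls (\<Sum>a\<in>set (a # as). G' a ^ q * monomial_on J a * x0 ^ (N - sum a J)) ((H * h) ^ q * x0 ^ N)" .
  have nth': "(k # Ks) ! i = cls (G' ((a # as) ! i) ^ q) ((H * h) ^ q)" if "i < length (a # as)" for i
  proof (cases i)
    case 0
    have "fraction (H * g) (H * h)"
      unfolding fraction_def using H' homogeneous_mult[OF H(1) r(1)] by blast
    then have "k = cls ((H * g) ^ q) ((H * h) ^ q)"
      unfolding k by (intro cls_eqI fraction_power gh) (simp_all add: eval_simps power_mult_distrib mult_ac)
    then show ?thesis using 0 by (simp add: G'_def)
  next
    case (Suc i')
    then have i': "i' < length as" using that by simp
    then have b: "as ! i' \<in> set as" by simp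
    then have ne: "as ! i' \<noteq> a" using a(1) by auto
    have fr: "fraction (G (as ! i')) H" "fraction (G (as ! i') * h) (H * h)"
      unfolding fraction_def using H H' G[OF b] homogeneous_mult[OF G[OF b] r(2)] by blast+
    have "cls (G (as ! i') ^ q) (H ^ q) = cls ((G (as ! i') * h) ^ q) ((H * h) ^ q)"
      by (intro cls_eqI fraction_power fr) (simp add: eval_simps power_mult_distrib mult_ac)
    then show ?thesis using Suc nth[OF i'] ne by (simp add: G'_def)
  qed
  show ?case
    by (intro exI[of _ G'] exI[of _ "H * h"] exI[of _ "m + r"] conjI H' allI ballI impI comb' nth' hom_G')
qed

text \<open>A relation gives a numerator vanishing on \<open>Y\<close> only. Multiplied by a q-th
  power of the form from \<open>component_localization\<close> it vanishes on the cone, tangent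
  lines kill each coefficient where \<open>grad v j\<close> is nonzero, and primality on
  \<open>Y\<close> removes the auxiliary factors.\<close>

lemma basis_independent:
  assumes as: "distinct as" "set as = E"
  shows "ring.independent L Kq (map basis_element as)"
proof -
  interpret F: field L by (rule field_L)
  let ?Us = "map basis_element as"
  have Us: "set ?Us \<subseteq> carrier L"
    using basis_element_in_carrier by auto
  define N where "N = (\<Sum>a\<in>E. sum a J)"
  have finE: "finite E" using as(2) by (metis List.finite_set)
  have N: "\<forall>a\<in>set as. sum a J \<le> N"
    unfolding N_def as(2) using finE by (intro ballI member_le_sum) auto
  have trivial: "set Ks \<subseteq> {\<zero>\<^bsub>L\<^esub>}"
    if Ks: "length Ks = length as" "set Ks \<subseteq> Kq" "F.combine Ks ?Us = \<zero>\<^bsub>L\<^esub>" for Ks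
  proof -
    from combine_representation[OF Ks(1,2) as(1) N]
    obtain G H m where H: "homogeneous m H" "\<not> vanishing H"
      and G0: "\<forall>a\<in>E. homogeneous m (G a)"
      and nth0: "\<forall>i<length as. Ks ! i = cls (G (as ! i) ^ q) (H ^ q)"
      and comb: "F.combine Ks ?Us =
        cls (\<Sum>a\<in>E. G a ^ q * monomial_on J a * x0 ^ (N - sum a J)) (H ^ q * x0 ^ N)"
      unfolding as(2) by (elim exE conjE)
    have G: "homogeneous m (G a)" if "a \<in> E" for a
      using G0 that by blast
    have nth: "Ks ! i = cls (G (as ! i) ^ q) (H ^ q)" if "i < length as" for i
      using nth0 that by blast
    let ?P = "\<Sum>a\<in>E. G a ^ q * monomial_on J a * x0 ^ (N - sum a J)"
    have hom_term: "homogeneous (m * q + N) (G a ^ q * monomial_on J a * x0 ^ (N - sum a J))"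
      if "a \<in> E" for a
    proof -
      have "homogeneous (m * q + sum a J + (N - sum a J)) (G a ^ q * monomial_on J a * x0 ^ (N - sum a J))"
        by (intro homogeneous_mult homogeneous_power G that homogeneous_monomial_on homogeneous_x0_power)
      then show ?thesis using N that as(2) by simp
    qed
    have hom_P: "homogeneous (m * q + N) ?P"
      by (intro homogeneous_sum hom_term)
    have "fraction ?P (H ^ q * x0 ^ N)"
      unfolding fraction_def
      using hom_P homogeneous_mult[OF homogeneous_power[OF H(1)] homogeneous_x0_power]
        vanishing_prime[OF homogeneous_power[OF H(1)] homogeneous_x0_power]
        not_vanishing_power[OF H] x0_power_not_vanishing by blast
    then have van_P: "vanishing ?P"
      using Ks(3) unfolding comb by (simp add: cls_eq_zero)
    obtain h l where h: "homogeneous l h" "\<not> vanishing h"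
      and h_local: "\<And>g k. homogeneous k g \<Longrightarrow> vanishing g \<Longrightarrow> cone_zero (g * h)"
      using component_localization[OF component] unfolding vanishing_iff by blast
    \<comment> \<open>\<open>h\<close> enters inside the q-th power, so the coefficient stays
      constant to order q. The factor x_i0 is harmless because the tangent directions move only x_j
      and a variable from \<open>J\<close>.\<close>
    define K where "K a = (G a * h) ^ q * x0 ^ (N - sum a J)" for a
    have K_zero: "eval (K a) v = 0" if "a \<in> E" "eval f v = 0" "grad v j \<noteq> 0" for a v
    proof (rule tangent_independent[OF _ UNIV_eq(3) _ _ that])
      show "finite J" by simp
      show "tangent_const j i (K a)" if "a \<in> E" "i \<in> J" for a i
        unfolding K_def using that distinct
        by (intro tangent_const_mult tangent_const_frobenius tangent_const_power tangent_const_Var)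
          (auto simp: J_def)
      fix w assume w: "eval f w = 0"
      have "eval ?P w * eval h w = 0"
        using h_local[OF hom_P van_P] w by (simp add: cone_zero_def eval_mult)
      then have "eval ?P w * eval h w ^ q = 0" using q_ge_2 by auto
      moreover have "eval ?P w * eval h w ^ q = (\<Sum>a\<in>E. eval (K a) w * (\<Prod>i\<in>J. w $ i ^ a i))"
        unfolding eval_sum sum_distrib_right
        by (intro sum.cong) (simp_all add: K_def eval_simps eval_monomial_on power_mult_distrib mult_ac)
      ultimately show "(\<Sum>a\<in>E. eval (K a) w * (\<Prod>i\<in>J. w $ i ^ a i)) = 0" by simp
    qed
    have "vanishing (G a)" if a: "a \<in> E" for a
    proof -
      note hom1 = homogeneous_mult[OF G[OF a] h(1)]
        and hom2 = homogeneous_x0_power[of "N - sum a J"]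
      note hom3 = homogeneous_mult[OF homogeneous_power[OF hom1, of q] hom2]
      have "vanishing (K a * partial j f)"
        using K_zero[OF a] eval_f_Union_Y by (auto simp: vanishing_def eval_mult eval_partial)
      then have "vanishing ((G a * h) ^ q * x0 ^ (N - sum a J))"
        using vanishing_prime[OF hom3 homogeneous_partial_f] partial_not_vanishing
        unfolding K_def by blast
      then have "vanishing ((G a * h) ^ q)"
        using vanishing_prime[OF homogeneous_power[OF hom1] hom2] x0_power_not_vanishing by blast
      then have "vanishing (G a * h)"
        using not_vanishing_power[OF hom1] by blast
      then show ?thesis
        using vanishing_prime[OF G[OF a] h(1)] h(2) by blast
    qed
    then have "Ks ! i = \<zero>\<^bsub>L\<^esub>" if "i < length as" for i
    proof -
      have a: "as ! i \<in> E" using that as(2) by auto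
      have "fraction (G (as ! i)) H"
        unfolding fraction_def using G[OF a] H by blast
      moreover have "vanishing (G (as ! i) ^ q)"
        using \<open>\<And>a. a \<in> E \<Longrightarrow> vanishing (G a)\<close>[OF a] q_ge_2
        by (auto simp: vanishing_def eval_power)
      ultimately show ?thesis
        unfolding nth[OF that] by (simp add: cls_eq_zero fraction_power)
    qed
    then show ?thesis using Ks(1) by (auto simp: in_set_conv_nth)
  qed
  show ?thesis
  proof (rule F.trivial_combine_imp_independent[OF subfield_Kq Us])
    fix Ks assume Ks: "set Ks \<subseteq> Kq" "F.combine Ks ?Us = \<zero>\<^bsub>L\<^esub>"
    \<comment> \<open>Coefficient lists of any length are truncated or padded with zeros to the
      length of the basis.\<close>
    define Ks' where "Ks' = take (length as) Ks @ replicate (length as - length Ks) \<zero>\<^bsub>L\<^esub>"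
    have zero: "\<zero>\<^bsub>L\<^esub> \<in> Kq"
      using subringE(2)[OF subfieldE(1)[OF subfield_Kq]] .
    have "length Ks' = length as" by (simp add: Ks'_def)
    moreover have "set Ks' \<subseteq> Kq"
      using Ks(1) zero set_take_subset[of "length as" Ks] by (auto simp: Ks'_def)
    moreover have "F.combine Ks' ?Us = \<zero>\<^bsub>L\<^esub>"
      using Ks(2) F.combine_take[of ?Us Ks] Us by (simp add: Ks'_def F.combine_append_replicate)
    ultimately have "set Ks' \<subseteq> {\<zero>\<^bsub>L\<^esub>}" by (rule trivial)
    then show "set (take (length ?Us) Ks) \<subseteq> {\<zero>\<^bsub>L\<^esub>}"
      by (simp add: Ks'_def)
  qed
qed

text \<open>The span of the monomials meets the closure conditions of the spanning argument, and
  each index in \<open>J\<close> allows q exponents.\<close>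

lemma dimension_L: "ring.dimension L (q ^ card J) Kq (carrier L)"
proof -
  interpret F: field L by (rule field_L)
  have "finite E" by (rule finite_PiE) simp_all
  from finite_distinct_list[OF this] obtain as where as: "set as = E" "distinct as"
    by (elim exE conjE)
  let ?Us = "map basis_element as"
  have Us: "set ?Us \<subseteq> carrier L"
    using basis_element_in_carrier by auto
  note span = F.Span_subgroup_props[OF subfield_Kq Us]
  have "carrier L \<subseteq> F.Span Kq ?Us"
  proof (rule carrier_subset)
    show "basis_element a \<in> F.Span Kq ?Us" if "a \<in> E" for a
      using F.Span_base_incl[OF subfield_Kq Us] that as(1) by auto
  qed (use span F.Span_smult_closed[OF subfield_Kq Us] in blast)+
  then have "F.Span Kq ?Us = carrier L" using span(1) by blast
  moreover have "length ?Us = q ^ card J"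
    using distinct_card[OF as(2)] by (simp add: as(1) card_PiE)
  ultimately show ?thesis
    using F.dimension_independent[OF basis_independent[OF as(2,1)]] by simp
qed

end


section \<open>The dual hypersurface\<close>

lemma (in gauss_component) extension_degree_L:
  assumes "CARD('n) = d + 2"
  shows "extension_degree (q ^ d) (gauss_subfield f Y) L"
proof -
  obtain i0 j where "i0 \<noteq> j" "\<not> vanishing (Var i0)" "\<not> vanishing (partial j f)"
    using exists_coordinates by blast
  then interpret gauss_coordinates A M p e q f Y i0 j by unfold_locales
  have "card J = d"
    using assms distinct by (simp add: J_def card_Diff_subset)
  then show ?thesis
    using dimension_L field_L subfield_Kq
    by (simp add: extension_degree_def field_extension_def gauss_subfield_eq)
qed

context frobenius_hypersurface
begin

text \<open>With the transposed inverse, the linear slot of the new form turns a gradient back into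
  q-th powers of coordinates, so its value at a gradient becomes the q-th power of the value of
  \<open>f\<close>.\<close>

definition dual_poly :: "('n, 'k) mpoly"
  where "dual_poly = frobenius_poly q (\<chi> l m. M $ m $ l)"

text \<open>The dual form is again given by an invertible matrix, so its smoothness and the
  description of its points come from the same locale.\<close>

lemma dual: "frobenius_hypersurface (\<chi> l m. M $ m $ l) (\<chi> l m. A $ m $ l) p e q dual_poly"
proof
  show "(\<chi> l m. M $ m $ l) ** (\<chi> l m. A $ m $ l) = mat 1"
    using inverse by (auto simp: matrix_mult_eq_mat_1_iff mult.commute)
qed (rule char exponent dual_poly_def)+

lemma frobenius_form_dual_poly: "frobenius_form q dual_poly"
proof -
  have "(\<chi> l m. M $ m $ l) \<noteq> 0"
  proof
    assume "(\<chi> l m. M $ m $ l) = 0"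
    then have "M = 0" by (simp add: vec_eq_iff)
    then have "mat 1 $ i $ i = (0 :: 'k)" for i :: 'n
      unfolding inverse[symmetric] by (simp add: matrix_matrix_mult_def)
    then show False by (simp add: mat_def)
  qed
  then show ?thesis
    unfolding dual_poly_def by (rule frobenius_form_frobenius_poly[OF _ q_ge_2])
qed

lemma eval_dual_poly_gradient: "eval dual_poly (gradient v) = eval f v ^ q"
proof -
  interpret D: frobenius_hypersurface "\<chi> l m. M $ m $ l" "\<chi> l m. A $ m $ l" p e q dual_poly
    by (rule dual)
  have "eval dual_poly (gradient v) =
    (\<Sum>l\<in>UNIV. grad v l ^ q * (\<Sum>m\<in>UNIV. grad v m * M $ m $ l))"
    unfolding D.eval_f D.bil_def by (simp add: gradient_nth sum_distrib_left mult_ac)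
  also have "\<dots> = (\<Sum>l\<in>UNIV. grad v l * v $ l) ^ q"
    unfolding grad_inverse by (simp add: frobenius_sum[OF char(1)] power_mult_distrib)
  also have "\<dots> = eval f v ^ q"
    by (simp add: eval_f form_grad)
  finally show ?thesis .
qed

text \<open>Solve the linear system with \<open>M\<close>, then take q-th roots of the
  coordinates.\<close>

lemma gradient_surj: "\<exists>v. gradient v = w"
proof -
  have "M ** A = mat 1" using inverse by (simp add: matrix_left_right_inverse)
  then have MA: "(\<Sum>l\<in>UNIV. M $ i $ l * A $ l $ j) = (if i = j then 1 else 0)" for i j
    by (simp add: matrix_mult_eq_mat_1_iff)
  define v where "v = (\<chi> i. q_root (\<Sum>m\<in>UNIV. w $ m * M $ m $ i))"
  have "grad v l = w $ l" for l
  proof -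
    have "grad v l = (\<Sum>i\<in>UNIV. \<Sum>m\<in>UNIV. w $ m * (M $ m $ i * A $ i $ l))"
      unfolding grad_def v_def by (simp add: q_root_power sum_distrib_left mult_ac)
    also have "\<dots> = (\<Sum>m\<in>UNIV. w $ m * (\<Sum>i\<in>UNIV. M $ m $ i * A $ i $ l))"
      unfolding sum_distrib_left by (rule sum.swap)
    also have "\<dots> = w $ l"
      unfolding MA by (simp add: if_distrib[of "\<lambda>x. _ * x"] cong: if_cong)
    finally show ?thesis .
  qed
  then show ?thesis
    by (intro exI[of _ v]) (simp add: vec_eq_iff gradient_nth)
qed

lemma dual_hypersurface_eq: "dual_hypersurface f = hypersurface dual_poly"
proof -
  interpret D: frobenius_hypersurface "\<chi> l m. M $ m $ l" "\<chi> l m. A $ m $ l" p e q dual_poly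
    by (rule dual)
  have "dual_hypersurface f = gauss_map f ` hypersurface f"
    using smooth_f by (simp add: dual_hypersurface_def gauss_image_def smooth_def)
  also have "\<dots> = point ` gradient ` {v. v \<noteq> 0 \<and> eval f v = 0}"
    unfolding hypersurface_eq image_image gauss_map_point ..
  also have "gradient ` {v. v \<noteq> 0 \<and> eval f v = 0} = {w. w \<noteq> 0 \<and> eval dual_poly w = 0}"
  proof
    show "gradient ` {v. v \<noteq> 0 \<and> eval f v = 0} \<subseteq> {w. w \<noteq> 0 \<and> eval dual_poly w = 0}"
      using q_ge_2 by (auto simp: gradient_eq_0 eval_dual_poly_gradient power_0_left)
    show "{w. w \<noteq> 0 \<and> eval dual_poly w = 0} \<subseteq> gradient ` {v. v \<noteq> 0 \<and> eval f v = 0}"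
    proof
      fix w assume w: "w \<in> {w. w \<noteq> 0 \<and> eval dual_poly w = 0}"
      obtain v where v: "gradient v = w" using gradient_surj by blast
      then have "v \<noteq> 0" "eval f v = 0"
        using w gradient_eq_0[of v] eval_dual_poly_gradient[of v] by auto
      then show "w \<in> gradient ` {v. v \<noteq> 0 \<and> eval f v = 0}" using v by blast
    qed
  qed
  finally show ?thesis unfolding D.hypersurface_eq .
qed

end

text \<open>A kernel vector of the transpose has a coordinatewise q-th root v at which all partial
  derivatives vanish. Then f(v), being their combination with the coordinates of v, vanishes too, so
  smoothness forces v = 0.\<close>

lemma smooth_frobenius_poly_imp_right_inverse:
  fixes A :: "'k::alg_closed_field ^ 'n::finite ^ 'n"
  assumes smooth: "smooth (frobenius_poly q A)" and q: "q > 0" "of_nat q = (0 :: 'k)"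
  shows "\<exists>M. A ** M = mat 1"
proof -
  define A' where "A' = (\<chi> i l. A $ l $ i)"
  have "x = 0" if x: "A' *v x = 0" for x
  proof -
    have "\<exists>y. y ^ q = x $ l" for l using nth_root_exists[OF q(1)] .
    then obtain y where y: "\<And>l. y l ^ q = x $ l" by metis
    define v where "v = (\<chi> l. y l)"
    have grad: "(\<Sum>i\<in>UNIV. A $ i $ l * v $ i ^ q) = 0" for l
      using arg_cong[OF x, of "\<lambda>z. z $ l"]
      by (simp add: A'_def matrix_vector_mult_def v_def y)
    then have partial: "eval (partial l (frobenius_poly q A)) v = 0" for l
      unfolding eval_partial_frobenius_poly[OF q(2)] by simp
    have "eval (frobenius_poly q A) v = (\<Sum>l\<in>UNIV. (\<Sum>i\<in>UNIV. A $ i $ l * v $ i ^ q) * v $ l)"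
      unfolding eval_def eval_hom_frobenius_poly[OF is_hom_id] sum_distrib_right by (rule sum.swap)
    then have zero: "eval (frobenius_poly q A) v = 0" unfolding grad by simp
    have "v = 0"
    proof (rule ccontr)
      assume "v \<noteq> 0"
      then have "point v \<in> hypersurface (frobenius_poly q A)"
        using zero by (simp add: hypersurface_def zeros_def point_mem_proj_space
            vanishes_at_point[OF homogeneous_frobenius_poly])
      then obtain l where "\<not> vanishes_at (partial l (frobenius_poly q A)) (point v)"
        using smooth by (auto simp: smooth_def smooth_points_def)
      moreover have "homogeneous q (partial l (frobenius_poly q A))"
        using homogeneous_frobenius_poly[of q A] by (intro homogeneous_partial) simp
      ultimately show False
        using partial by (simp add: vanishes_at_point)
    qed
    then have "y l = 0" for l by (simp add: v_def vec_eq_iff)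
    then show "x = 0"
      using y q(1) by (simp add: vec_eq_iff power_0_left flip: y)
  qed
  then have "\<exists>B. B ** A' = mat 1"
    unfolding matrix_left_invertible_ker by blast
  then obtain B where B: "B ** A' = mat 1" by blast
  have "A ** (\<chi> i l. B $ l $ i) = mat 1"
    using B by (auto simp: A'_def matrix_mult_eq_mat_1_iff mult.commute)
  then show ?thesis by blast
qed

theorem proposition8p6:
  fixes f :: "('n::finite, 'k::alg_closed_field) mpoly"
    and p q e n d :: nat
  assumes "CHAR('k) = p" and "p > 0"
    and "e > 0" and "q = p ^ e"
    and "CARD('n) = n + 1" and "n = d + 1"
    and "frobenius_form q f"
    and "smooth f"
  shows "gauss_map_purely_inseparable f \<and>
    gauss_map_degree f (q ^ d) \<and>
    (\<exists>g :: ('n, 'k) mpoly. frobenius_form q g \<and> smooth g \<and> dual_hypersurface f = hypersurface g)"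
proof -
  have "prime p"
    using prime_CHAR_semidom[where ?'a = 'k] assms(1,2) by simp
  then have q: "q \<ge> 2"
    using assms(3,4) prime_ge_2_nat[of p] self_le_power[of p e] by linarith
  have q0: "of_nat q = (0 :: 'k)"
    using assms(1,3,4) by (simp add: of_nat_eq_0_iff_char_dvd)
  obtain A where A: "f = frobenius_poly q A"
    using frobenius_form_imp_frobenius_poly[OF assms(7) q] by blast
  obtain M where M: "A ** M = mat 1"
    using smooth_frobenius_poly_imp_right_inverse[OF assms(8)[unfolded A] _ q0] q by auto
  interpret frobenius_hypersurface A M p e q f
    using assms A M by unfold_locales auto
  interpret D: frobenius_hypersurface "\<chi> l m. M $ m $ l" "\<chi> l m. A $ m $ l" p e q dual_poly
    by (rule dual)
  have "purely_inseparable CHAR('k) (gauss_subfield f Y) (function_field Y) \<and>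
    extension_degree (q ^ d) (gauss_subfield f Y) (function_field Y)"
    if Y: "Y \<in> irreducible_components (hypersurface f)" for Y
  proof -
    interpret gauss_component A M p e q f Y
      using Y by unfold_locales
    show ?thesis
      using purely_inseparable_L extension_degree_L[of d] assms(1,5,6) by simp
  qed
  then have "gauss_map_purely_inseparable f" "gauss_map_degree f (q ^ d)"
    unfolding gauss_map_purely_inseparable_def gauss_map_degree_def by blast+
  then show ?thesis
    using frobenius_form_dual_poly D.smooth_f dual_hypersurface_eq by blast
qed

end
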